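(* A map $f:X\to Y$ of regular transition systems is a weak equivalence of the Bousfield localization $\mathbf L_{\underline{\mathrm{Cub}}}\mathbf{RTS}$ of $\mathbf{RTS}$ by the set of maps $\mathcal S=\{p_x\mid x\in\Sigma\}$ if and only if the map $\mathbf L^{\mathbf{RTS}}_{\mathcal S}(f):\mathbf L^{\mathbf{RTS}}_{\mathcal S}(X)\to\mathbf L^{\mathbf{RTS}}_{\mathcal S}(Y)$ is an isomorphism.
   Context: Fix a nonempty set $\Sigma$ of labels. A weak transition system is a triple $X=(S,\mu:L\to\Sigma,T=\bigcup_{n\ge1}T_n)$ where $S$ is a set (states), $L$ a set (actions), $\mu$ a map (labelling map), $T_n\subset S\times L^n\times S$ ($n$-transitions), such that: (Multiset axiom) if $(\alpha,u_1,\dots,u_n,\beta)$ is a transition with $n\ge2$, so is $(\alpha,u_{\sigma(1)},\dots,u_{\sigma(n)},\beta)$ for every permutation $\sigma$; (Composition axiom) for $n\ge3$ and $p,q\ge1$ with $p+q<n$, if $(\alpha,u_1,\dots,u_n,\beta)$, $(\alpha,u_1,\dots,u_p,\nu_1)$, $(\nu_1,u_{p+1},\dots,u_n,\beta)$, $(\alpha,u_1,\dots,u_{p+q},\nu_2)$, $(\nu_2,u_{p+q+1},\dots,u_n,\beta)$ are transitions, then so is $(\nu_1,u_{p+1},\dots,u_{p+q},\nu_2)$. A map consists of a map on states and a map on actions commuting with the labelling maps to $\Sigma$, sending transitions to transitions. $X$ is regular if every action $u$ occurs in some $1$-transition $(\alpha,u,\beta)$ and CSA2 holds: for every transition $(\alpha,u_1,\dots,u_n,\beta)$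 with $n\ge2$ and every $1\le p<n$ there is a unique state $\nu$ with $(\alpha,u_1,\dots,u_p,\nu)$ and $(\nu,u_{p+1},\dots,u_n,\beta)$ transitions. $\mathbf{RTS}$ is the category of regular transition systems. A set is viewed as a transition system with that set of states and no actions. For $x_1,\dots,x_n\in\Sigma$, the $n$-cube $C_n[x_1,\dots,x_n]$ has states $\{0,1\}^n$, actions $(x_1,1),\dots,(x_n,n)$ with $\mu(x_i,i)=x_i$, and transitions $((\epsilon_i),(x_{i_1},i_1),\dots,(x_{i_d},i_d),(\epsilon'_i))$, $d\geq1$, with $i_1,\dots,i_d$ distinct, $\epsilon_i\le\epsilon'_i$ for all $i$, and $\epsilon_i\ne\epsilon_i'$ iff $i\in\{i_1,\dots,i_d\}$. For $n\ge1$, the boundary $\partial C_n[x_1,\dots,x_n]$ is the regular transition system obtained by removing from the $n$-cube all its $n$-transitions (for $n=1$ it is the two-state set $\{0,1\}$, with no action). The double transition $\uparrow\! x\!\uparrow$ ($x\in\Sigma$) has states $1,2,3,4$, one action $x$ labelled $x$, and transitions $(1,x,2),(3,x,4)$. Let $\mathcal I=\{\varnothing\to\{0\},\ \{0,1\}\to\{0\}\}\cup\{\partial C_n[x_1,\dots,x_n]\to C_n[x_1,\dots,x_n]\mid n\ge1,\ x_i\in\Sigma\}\cup\{C_1[x]\to\ \uparrow\! x\!\uparrow\ \mid x\in\Sigma\}$. For $x\in\Sigma$, $p_x:C_1[x]\sqcup C_1[x]\to\ \uparrow\! x\!\uparrow$ is the map bijective on states sending the $1$-transitions of the two copies of $C_1[x]$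 to $(1,x,2)$ and $(3,x,4)$ respectively. The left determined model structure on $\mathbf{RTS}$ is the (existing, combinatorial, left proper) model structure with generating cofibrations $\mathcal I$ whose weak equivalences form the smallest Grothendieck localizer, where, $\mathcal C$ being the class of cofibrations, a Grothendieck localizer is a class of maps satisfying two-out-of-three, containing all maps with the right lifting property with respect to $\mathcal C$, and whose intersection with $\mathcal C$ is closed under pushouts and transfinite compositions. $\mathbf L_{\underline{\mathrm{Cub}}}\mathbf{RTS}$ is its left Bousfield localization with respect to $\mathcal S$; it coincides with the left Bousfield localization with respect to the class of maps $f$ such that $\underline{\mathrm{Cub}}(f)$ is a weak equivalence, where $\underline{\mathrm{Cub}}(X)$ is the canonical colimit of all cubes mapping to $X$. An object $X$ is $\mathcal S$-injective if for every $s:A\to B$ in $\mathcal S$ every map $A\to X$ extends along $s$. The full subcategory of $\mathcal S$-injective regular transition systems is reflective in $\mathbf{RTS}$; $\mathbf L^{\mathbf{RTS}}_{\mathcal S}:\mathbf{RTS}\to\mathbf{RTS}$ denotes the reflection. *)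

theory Defs
  imports "HOL-Library.Equipollence" "HOL-Combinatorics.Permutations"
begin

section \<open>Categories\<close>

text \<open>\<open>Comp C g f\<close> is \<open>g\<close> after \<open>f\<close>.  It is only meaningful if \<open>Cod C f = Dom C g\<close>.\<close>

record ('o, 'm) cat =
  Ob :: "'o set"
  Ar :: "'m set"
  Dom :: "'m \<Rightarrow> 'o"
  Cod :: "'m \<Rightarrow> 'o"
  Id :: "'o \<Rightarrow> 'm"
  Comp :: "'m \<Rightarrow> 'm \<Rightarrow> 'm"

definition hom :: "('o, 'm) cat \<Rightarrow> 'o \<Rightarrow> 'o \<Rightarrow> 'm set" where
  "hom C a b = {f \<in> Ar C. Dom C f = a \<and> Cod C f = b}"

definition is_iso :: "('o, 'm) cat \<Rightarrow> 'm \<Rightarrow> bool" where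
  "is_iso C f \<longleftrightarrow> f \<in> Ar C \<and>
     (\<exists>g \<in> hom C (Cod C f) (Dom C f).
        Comp C g f = Id C (Dom C f) \<and> Comp C f g = Id C (Cod C f))"

definition is_terminal :: "('o, 'm) cat \<Rightarrow> 'o \<Rightarrow> bool" where
  "is_terminal C t \<longleftrightarrow> t \<in> Ob C \<and> (\<forall>X \<in> Ob C. \<exists>!f. f \<in> hom C X t)"

text \<open>
  A diagram consists of a set \<open>J\<close> of indices, an object \<open>F j\<close> for each index, and a set \<open>E\<close>
  of edges \<open>(j, f, k)\<close> with \<open>f : F j \<rightarrow> F k\<close>.
\<close>

definition is_cocone ::
  "('o, 'm) cat \<Rightarrow> 'j set \<Rightarrow> ('j \<Rightarrow> 'o) \<Rightarrow> ('j \<times> 'm \<times> 'j) set \<Rightarrow> 'o \<Rightarrow> ('j \<Rightarrow> 'm) \<Rightarrow> bool" where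
  "is_cocone C J F E L c \<longleftrightarrow> L \<in> Ob C \<and> (\<forall>j \<in> J. c j \<in> hom C (F j) L) \<and>
     (\<forall>(j, f, k) \<in> E. Comp C (c k) f = c j)"

definition is_colimit ::
  "('o, 'm) cat \<Rightarrow> 'j set \<Rightarrow> ('j \<Rightarrow> 'o) \<Rightarrow> ('j \<times> 'm \<times> 'j) set \<Rightarrow> 'o \<Rightarrow> ('j \<Rightarrow> 'm) \<Rightarrow> bool" where
  "is_colimit C J F E L c \<longleftrightarrow> is_cocone C J F E L c \<and>
     (\<forall>L' c'. is_cocone C J F E L' c' \<longrightarrow>
        (\<exists>!h. h \<in> hom C L L' \<and> (\<forall>j \<in> J. Comp C h (c j) = c' j)))"

text \<open>
  \<open>i : A \<rightarrow> B\<close> and \<open>u : A \<rightarrow> A'\<close> are the given arrows; \<open>i' : A' \<rightarrow> B'\<close> is the pushout of \<open>i\<close>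
  along \<open>u\<close>.
\<close>

definition is_pushout :: "('o, 'm) cat \<Rightarrow> 'm \<Rightarrow> 'm \<Rightarrow> 'm \<Rightarrow> 'm \<Rightarrow> bool" where
  "is_pushout C i u i' u' \<longleftrightarrow>
     i \<in> Ar C \<and> u \<in> Ar C \<and> Dom C u = Dom C i \<and>
     i' \<in> Ar C \<and> Dom C i' = Cod C u \<and> u' \<in> hom C (Cod C i) (Cod C i') \<and>
     Comp C i' u = Comp C u' i \<and>
     (\<forall>Z v w. v \<in> hom C (Cod C u) Z \<and> w \<in> hom C (Cod C i) Z \<and> Comp C v u = Comp C w i \<longrightarrow>
        (\<exists>!h. h \<in> hom C (Cod C i') Z \<and> Comp C h i' = v \<and> Comp C h u' = w))"

subsection \<open>Lifting properties\<close>

definition lifts :: "('o, 'm) cat \<Rightarrow> 'm \<Rightarrow> 'm \<Rightarrow> bool" where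
  "lifts C i p \<longleftrightarrow>
     (\<forall>u \<in> hom C (Dom C i) (Dom C p). \<forall>v \<in> hom C (Cod C i) (Cod C p).
        Comp C p u = Comp C v i \<longrightarrow>
        (\<exists>h \<in> hom C (Cod C i) (Dom C p). Comp C h i = u \<and> Comp C p h = v))"

definition rlp :: "('o, 'm) cat \<Rightarrow> 'm set \<Rightarrow> 'm set" where
  "rlp C K = {p \<in> Ar C. \<forall>i \<in> K. lifts C i p}"

definition llp :: "('o, 'm) cat \<Rightarrow> 'm set \<Rightarrow> 'm set" where
  "llp C K = {i \<in> Ar C. \<forall>p \<in> K. lifts C i p}"

subsection \<open>Transfinite compositions\<close>

text \<open>
  Ordinals are represented by well-orders \<open>r\<close> on sets of elements of a type \<open>'i\<close>, and
  \<open>D a b : X a \<rightarrow> X b\<close> for \<open>a \<le> b\<close>.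
\<close>

definition chain_edges :: "'i rel \<Rightarrow> ('i \<Rightarrow> 'i \<Rightarrow> 'm) \<Rightarrow> 'i set \<Rightarrow> ('i \<times> 'm \<times> 'i) set" where
  "chain_edges r D A = {(a, D a b, b) | a b. (a, b) \<in> r \<and> a \<in> A \<and> b \<in> A}"

definition limit_elt :: "'i rel \<Rightarrow> 'i \<Rightarrow> bool" where
  "limit_elt r l \<longleftrightarrow> l \<in> Field r \<and> underS r l \<noteq> {} \<and>
     (\<forall>a \<in> underS r l. \<exists>b \<in> underS r l. (a, b) \<in> r \<and> a \<noteq> b)"

definition covers :: "'i rel \<Rightarrow> 'i \<Rightarrow> 'i \<Rightarrow> bool" where
  "covers r a b \<longleftrightarrow> (a, b) \<in> r \<and> a \<noteq> b \<and> (\<forall>c. (a, c) \<in> r \<and> (c, b) \<in> r \<longrightarrow> c = a \<or> c = b)"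

definition transfinite_sequence ::
  "('o, 'm) cat \<Rightarrow> 'i rel \<Rightarrow> ('i \<Rightarrow> 'o) \<Rightarrow> ('i \<Rightarrow> 'i \<Rightarrow> 'm) \<Rightarrow> bool" where
  "transfinite_sequence C r X D \<longleftrightarrow>
     (\<forall>a \<in> Field r. X a \<in> Ob C \<and> D a a = Id C (X a)) \<and>
     (\<forall>a b. (a, b) \<in> r \<longrightarrow> D a b \<in> hom C (X a) (X b)) \<and>
     (\<forall>a b c. (a, b) \<in> r \<and> (b, c) \<in> r \<longrightarrow> Comp C (D b c) (D a b) = D a c) \<and>
     (\<forall>l. limit_elt r l \<longrightarrow>
        is_colimit C (underS r l) X (chain_edges r D (underS r l)) (X l) (\<lambda>a. D a l))"

definition closed_under_transfinite_composition ::
  "'i itself \<Rightarrow> ('o, 'm) cat \<Rightarrow> 'm set \<Rightarrow> bool" where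
  "closed_under_transfinite_composition U C K \<longleftrightarrow>
     (\<forall>(r :: 'i rel) X D L c z.
        Well_order r \<and> Field r \<prec> (UNIV :: 'i set) \<and>
        z \<in> Field r \<and> (\<forall>a \<in> Field r. (z, a) \<in> r) \<and>
        transfinite_sequence C r X D \<and> (\<forall>a b. covers r a b \<longrightarrow> D a b \<in> K) \<and>
        is_colimit C (Field r) X (chain_edges r D (Field r)) L c \<longrightarrow> c z \<in> K)"

definition closed_under_pushouts :: "('o, 'm) cat \<Rightarrow> 'm set \<Rightarrow> bool" where
  "closed_under_pushouts C K \<longleftrightarrow>
     (\<forall>i u i' u'. i \<in> K \<and> is_pushout C i u i' u' \<longrightarrow> i' \<in> K)"

subsection \<open>Injective objects and reflections\<close>

definition injective_object :: "('o, 'm) cat \<Rightarrow> 'm set \<Rightarrow> 'o \<Rightarrow> bool" where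
  "injective_object C K X \<longleftrightarrow> X \<in> Ob C \<and>
     (\<forall>s \<in> K. \<forall>g \<in> hom C (Dom C s) X. \<exists>h \<in> hom C (Cod C s) X. Comp C h s = g)"

definition is_reflection :: "('o, 'm) cat \<Rightarrow> 'o set \<Rightarrow> 'o \<Rightarrow> 'm \<Rightarrow> bool" where
  "is_reflection C D X e \<longleftrightarrow> e \<in> Ar C \<and> Dom C e = X \<and> Cod C e \<in> D \<and>
     (\<forall>Z \<in> D. \<forall>g \<in> hom C X Z. \<exists>!h. h \<in> hom C (Cod C e) Z \<and> Comp C h e = g)"

definition reflection_unit :: "('o, 'm) cat \<Rightarrow> 'o set \<Rightarrow> 'o \<Rightarrow> 'm" where
  "reflection_unit C D X = (SOME e. is_reflection C D X e)"

definition reflection_map :: "('o, 'm) cat \<Rightarrow> 'o set \<Rightarrow> 'm \<Rightarrow> 'm" where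
  "reflection_map C D f =
     (THE g. g \<in> hom C (Cod C (reflection_unit C D (Dom C f)))
                       (Cod C (reflection_unit C D (Cod C f))) \<and>
             Comp C g (reflection_unit C D (Dom C f)) =
             Comp C (reflection_unit C D (Cod C f)) f)"

section \<open>Simplicial sets and weak equivalences of Kan complexes\<close>

definition Delta :: "nat \<Rightarrow> nat \<Rightarrow> (nat \<Rightarrow> nat) set" where
  "Delta m n = {\<theta> \<in> {..m} \<rightarrow>\<^sub>E {..n}. mono_on {..m} \<theta>}"

definition coface :: "nat \<Rightarrow> nat \<Rightarrow> nat \<Rightarrow> nat" where
  "coface n i = (\<lambda>j \<in> {..n}. if j < i then j else Suc j)"

text \<open>\<open>sop K m n \<theta>\<close> maps \<open>n\<close>-simplices to \<open>m\<close>-simplices, for \<open>\<theta> \<in> Delta m n\<close>.\<close>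

record 'x sset =
  simplices :: "nat \<Rightarrow> 'x set"
  sop :: "nat \<Rightarrow> nat \<Rightarrow> (nat \<Rightarrow> nat) \<Rightarrow> 'x \<Rightarrow> 'x"

text \<open>The \<open>i\<close>-th face of an \<open>(n+1)\<close>-simplex.\<close>

definition face :: "'x sset \<Rightarrow> nat \<Rightarrow> nat \<Rightarrow> 'x \<Rightarrow> 'x" where
  "face K n i = sop K n (Suc n) (coface n i)"

text \<open>The totally degenerate \<open>n\<close>-simplex at a vertex.\<close>

definition degen :: "'x sset \<Rightarrow> nat \<Rightarrow> 'x \<Rightarrow> 'x" where
  "degen K n v = sop K n 0 (\<lambda>j \<in> {..n}. 0) v"

definition pi0_rel :: "'x sset \<Rightarrow> 'x rel" where
  "pi0_rel K = {(x, y). x \<in> simplices K 0 \<and> y \<in> simplices K 0 \<and>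
     (\<exists>w \<in> simplices K 1. face K 0 1 w = x \<and> face K 0 0 w = y)}"

definition pi0 :: "'x sset \<Rightarrow> 'x set set" where
  "pi0 K = simplices K 0 // pi0_rel K"

text \<open>
  The combinatorial homotopy sets of a Kan complex: \<open>pi_cycles K n v\<close> consists of the
  \<open>(n+1)\<close>-simplices all of whose faces are degenerate at \<open>v\<close>, two of which are homotopic relative
  to the boundary if they are the last two faces of an \<open>(n+2)\<close>-simplex whose other faces are
  degenerate at \<open>v\<close>.  So \<open>pi_succ K n v\<close> is the set underlying the homotopy group of degree
  \<open>n+1\<close>.
\<close>

definition pi_cycles :: "'x sset \<Rightarrow> nat \<Rightarrow> 'x \<Rightarrow> 'x set" where
  "pi_cycles K n v = {x \<in> simplices K (Suc n). \<forall>i \<le> Suc n. face K n i x = degen K n v}"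

definition pi_rel :: "'x sset \<Rightarrow> nat \<Rightarrow> 'x \<Rightarrow> 'x rel" where
  "pi_rel K n v = {(x, y). x \<in> pi_cycles K n v \<and> y \<in> pi_cycles K n v \<and>
     (\<exists>w \<in> simplices K (Suc (Suc n)).
        (\<forall>i \<le> n. face K (Suc n) i w = degen K (Suc n) v) \<and>
        face K (Suc n) (Suc n) w = x \<and> face K (Suc n) (Suc (Suc n)) w = y)}"

definition pi_succ :: "'x sset \<Rightarrow> nat \<Rightarrow> 'x \<Rightarrow> 'x set set" where
  "pi_succ K n v = pi_cycles K n v // pi_rel K n v"

text \<open>
  A simplicial map between Kan complexes is a weak equivalence if it is bijective on \<open>\<pi>\<^sub>0\<close> and,
  at every vertex, on all higher homotopy groups (the induced maps being automatically
  homomorphisms).  The map on classes sends the class \<open>c\<close> to the class containing the image of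
  \<open>c\<close>.
\<close>

definition kan_weq :: "'x sset \<Rightarrow> 'y sset \<Rightarrow> (nat \<Rightarrow> 'x \<Rightarrow> 'y) \<Rightarrow> bool" where
  "kan_weq K L f \<longleftrightarrow>
     bij_betw (\<lambda>c. pi0_rel L `` (f 0 ` c)) (pi0 K) (pi0 L) \<and>
     (\<forall>v \<in> simplices K 0. \<forall>n.
        bij_betw (\<lambda>c. pi_rel L n (f 0 v) `` (f (Suc n) ` c))
                 (pi_succ K n v) (pi_succ L n (f 0 v)))"

section \<open>Model structures, localizers and left Bousfield localization\<close>

text \<open>The three distinguished classes of arrows of a model structure.\<close>

record 'm model =
  weq :: "'m set"
  cof :: "'m set"
  fib :: "'m set"

definition two_out_of_three :: "('o, 'm) cat \<Rightarrow> 'm set \<Rightarrow> bool" where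
  "two_out_of_three C W \<longleftrightarrow>
     (\<forall>f \<in> Ar C. \<forall>g \<in> Ar C. Cod C f = Dom C g \<longrightarrow>
        (f \<in> W \<and> g \<in> W \<longrightarrow> Comp C g f \<in> W) \<and>
        (f \<in> W \<and> Comp C g f \<in> W \<longrightarrow> g \<in> W) \<and>
        (g \<in> W \<and> Comp C g f \<in> W \<longrightarrow> f \<in> W))"

definition grothendieck_localizer ::
  "'i itself \<Rightarrow> ('o, 'm) cat \<Rightarrow> 'm set \<Rightarrow> 'm set \<Rightarrow> bool" where
  "grothendieck_localizer U C Cf W \<longleftrightarrow>
     W \<subseteq> Ar C \<and> two_out_of_three C W \<and> rlp C Cf \<subseteq> W \<and>
     closed_under_pushouts C (W \<inter> Cf) \<and> closed_under_transfinite_composition U C (W \<inter> Cf)"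

definition smallest_localizer :: "'i itself \<Rightarrow> ('o, 'm) cat \<Rightarrow> 'm set \<Rightarrow> 'm set" where
  "smallest_localizer U C Cf = \<Inter> {W. grothendieck_localizer U C Cf W}"

text \<open>
  The left determined model structure with generating cofibrations \<open>I\<close>: its trivial fibrations
  are the maps with the right lifting property with respect to \<open>I\<close>.
\<close>

definition left_determined :: "'i itself \<Rightarrow> ('o, 'm) cat \<Rightarrow> 'm set \<Rightarrow> 'm model" where
  "left_determined U C I =
     (let Cf = llp C (rlp C I); W = smallest_localizer U C Cf
      in \<lparr>weq = W, cof = Cf, fib = rlp C (W \<inter> Cf)\<rparr>)"

definition fibrant :: "('o, 'm) cat \<Rightarrow> 'm model \<Rightarrow> 'o \<Rightarrow> bool" where
  "fibrant C M X \<longleftrightarrow> X \<in> Ob C \<and> (\<exists>t. is_terminal C t \<and> (\<exists>p \<in> hom C X t. p \<in> fib M))"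

subsection \<open>Homotopy function complexes\<close>

text \<open>A cosimplicial object: \<open>coact A m n \<theta> : cobj A m \<rightarrow> cobj A n\<close> for \<open>\<theta> \<in> Delta m n\<close>.\<close>

record ('o, 'm) cosimp =
  cobj :: "nat \<Rightarrow> 'o"
  coact :: "nat \<Rightarrow> nat \<Rightarrow> (nat \<Rightarrow> nat) \<Rightarrow> 'm"

definition is_cosimplicial :: "('o, 'm) cat \<Rightarrow> ('o, 'm) cosimp \<Rightarrow> bool" where
  "is_cosimplicial C A \<longleftrightarrow>
     (\<forall>n. cobj A n \<in> Ob C \<and> coact A n n (\<lambda>j \<in> {..n}. j) = Id C (cobj A n)) \<and>
     (\<forall>m n. \<forall>\<theta> \<in> Delta m n. coact A m n \<theta> \<in> hom C (cobj A m) (cobj A n)) \<and>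
     (\<forall>k m n. \<forall>\<phi> \<in> Delta k m. \<forall>\<theta> \<in> Delta m n.
        coact A k n (compose {..k} \<theta> \<phi>) = Comp C (coact A m n \<theta>) (coact A k m \<phi>))"

text \<open>
  The latching category at \<open>n\<close>: its objects are the non-identity injective maps of \<open>\<Delta>\<close> with
  target \<open>[n]\<close>, its morphisms the maps over \<open>[n]\<close>.
\<close>

definition latching_index :: "nat \<Rightarrow> (nat \<times> (nat \<Rightarrow> nat)) set" where
  "latching_index n = {(m, \<theta>). m < n \<and> \<theta> \<in> Delta m n \<and> inj_on \<theta> {..m}}"

definition latching_edges ::
  "('o, 'm) cosimp \<Rightarrow> nat \<Rightarrow> ((nat \<times> (nat \<Rightarrow> nat)) \<times> 'm \<times> (nat \<times> (nat \<Rightarrow> nat))) set" where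
  "latching_edges A n =
     {((k, \<theta>), coact A k m \<phi>, (m, \<theta>')) | k \<theta> m \<theta>' \<phi>.
        (k, \<theta>) \<in> latching_index n \<and> (m, \<theta>') \<in> latching_index n \<and>
        \<phi> \<in> Delta k m \<and> compose {..k} \<theta>' \<phi> = \<theta>}"

definition reedy_cofibrant :: "('o, 'm) cat \<Rightarrow> 'm model \<Rightarrow> ('o, 'm) cosimp \<Rightarrow> bool" where
  "reedy_cofibrant C M A \<longleftrightarrow> is_cosimplicial C A \<and>
     (\<forall>n. \<exists>L c h.
        is_colimit C (latching_index n) (\<lambda>(m, \<theta>). cobj A m) (latching_edges A n) L c \<and>
        h \<in> hom C L (cobj A n) \<and>
        (\<forall>(m, \<theta>) \<in> latching_index n. Comp C h (c (m, \<theta>)) = coact A m n \<theta>) \<and>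
        h \<in> cof M)"

text \<open>
  A cosimplicial resolution of \<open>X\<close>: a Reedy cofibrant cosimplicial object with a levelwise weak
  equivalence \<open>e\<close> to the constant cosimplicial object at \<open>X\<close>.
\<close>

definition cosimplicial_resolution ::
  "('o, 'm) cat \<Rightarrow> 'm model \<Rightarrow> 'o \<Rightarrow> ('o, 'm) cosimp \<Rightarrow> (nat \<Rightarrow> 'm) \<Rightarrow> bool" where
  "cosimplicial_resolution C M X A e \<longleftrightarrow> X \<in> Ob C \<and> reedy_cofibrant C M A \<and>
     (\<forall>n. e n \<in> hom C (cobj A n) X \<and> e n \<in> weq M) \<and>
     (\<forall>m n. \<forall>\<theta> \<in> Delta m n. Comp C (e n) (coact A m n \<theta>) = e m)"

definition cosimplicial_map ::
  "('o, 'm) cat \<Rightarrow> ('o, 'm) cosimp \<Rightarrow> ('o, 'm) cosimp \<Rightarrow> (nat \<Rightarrow> 'm) \<Rightarrow> bool" where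
  "cosimplicial_map C A B q \<longleftrightarrow>
     (\<forall>n. q n \<in> hom C (cobj A n) (cobj B n)) \<and>
     (\<forall>m n. \<forall>\<theta> \<in> Delta m n. Comp C (coact B m n \<theta>) (q m) = Comp C (q n) (coact A m n \<theta>))"

definition function_complex ::
  "('o, 'm) cat \<Rightarrow> ('o, 'm) cosimp \<Rightarrow> 'o \<Rightarrow> 'm sset" where
  "function_complex C A Z =
     \<lparr>simplices = (\<lambda>n. hom C (cobj A n) Z), sop = (\<lambda>m n \<theta> g. Comp C g (coact A m n \<theta>))\<rparr>"

text \<open>
  For a fibrant \<open>Z\<close>, \<open>function_complex C A Z\<close> is a Kan complex, the (left) homotopy function
  complex \<open>map(X, Z)\<close> when \<open>A\<close> is a cosimplicial resolution of \<open>X\<close>.  The following predicate says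
  that \<open>f : X \<rightarrow> Y\<close> induces a weak equivalence \<open>map(Y, Z) \<rightarrow> map(X, Z)\<close>.  In a model category,
  the map \<open>f\<close> has a cosimplicial resolution \<open>q\<close>, and whether the induced map is a weak
  equivalence does not depend on its choice.
\<close>

definition induces_weq :: "('o, 'm) cat \<Rightarrow> 'm model \<Rightarrow> 'm \<Rightarrow> 'o \<Rightarrow> bool" where
  "induces_weq C M f Z \<longleftrightarrow>
     (\<exists>A a B b q.
        cosimplicial_resolution C M (Dom C f) A a \<and>
        cosimplicial_resolution C M (Cod C f) B b \<and>
        cosimplicial_map C A B q \<and> (\<forall>n. Comp C (b n) (q n) = Comp C f (a n)) \<and>
        kan_weq (function_complex C B Z) (function_complex C A Z) (\<lambda>n g. Comp C g (q n)))"

definition local_object :: "('o, 'm) cat \<Rightarrow> 'm model \<Rightarrow> 'm set \<Rightarrow> 'o \<Rightarrow> bool" where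
  "local_object C M K Z \<longleftrightarrow> fibrant C M Z \<and> (\<forall>s \<in> K. induces_weq C M s Z)"

definition local_equivalence :: "('o, 'm) cat \<Rightarrow> 'm model \<Rightarrow> 'm set \<Rightarrow> 'm \<Rightarrow> bool" where
  "local_equivalence C M K f \<longleftrightarrow> f \<in> Ar C \<and> (\<forall>Z. local_object C M K Z \<longrightarrow> induces_weq C M f Z)"

definition left_bousfield :: "('o, 'm) cat \<Rightarrow> 'm model \<Rightarrow> 'm set \<Rightarrow> 'm model" where
  "left_bousfield C M K =
     (let W = {f. local_equivalence C M K f}
      in \<lparr>weq = W, cof = cof M, fib = rlp C (W \<inter> cof M)\<rparr>)"

section \<open>Transition systems\<close>

record ('s, 'a, 'l) ts =
  states :: "'s set"
  actions :: "'a set"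
  label :: "'a \<Rightarrow> 'l"
  transitions :: "('s \<times> 'a list \<times> 's) set"

definition weak_ts :: "('s, 'a, 'l) ts \<Rightarrow> bool" where
  "weak_ts X \<longleftrightarrow>
     (\<forall>(\<alpha>, us, \<beta>) \<in> transitions X.
        \<alpha> \<in> states X \<and> us \<noteq> [] \<and> set us \<subseteq> actions X \<and> \<beta> \<in> states X) \<and>
     (\<forall>\<alpha> us \<beta> \<sigma>. (\<alpha>, us, \<beta>) \<in> transitions X \<and> length us \<ge> 2 \<and> \<sigma> permutes {..<length us} \<longrightarrow>
        (\<alpha>, permute_list \<sigma> us, \<beta>) \<in> transitions X) \<and>
     (\<forall>\<alpha> \<beta> \<nu>1 \<nu>2 us vs ws. us \<noteq> [] \<and> vs \<noteq> [] \<and> ws \<noteq> [] \<and>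
        (\<alpha>, us @ vs @ ws, \<beta>) \<in> transitions X \<and>
        (\<alpha>, us, \<nu>1) \<in> transitions X \<and> (\<nu>1, vs @ ws, \<beta>) \<in> transitions X \<and>
        (\<alpha>, us @ vs, \<nu>2) \<in> transitions X \<and> (\<nu>2, ws, \<beta>) \<in> transitions X \<longrightarrow>
        (\<nu>1, vs, \<nu>2) \<in> transitions X)"

definition CSA2 :: "('s, 'a, 'l) ts \<Rightarrow> bool" where
  "CSA2 X \<longleftrightarrow>
     (\<forall>\<alpha> us vs \<beta>. us \<noteq> [] \<and> vs \<noteq> [] \<and> (\<alpha>, us @ vs, \<beta>) \<in> transitions X \<longrightarrow>
        (\<exists>!\<nu>. \<nu> \<in> states X \<and> (\<alpha>, us, \<nu>) \<in> transitions X \<and> (\<nu>, vs, \<beta>) \<in> transitions X))"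

definition regular_ts :: "('s, 'a, 'l) ts \<Rightarrow> bool" where
  "regular_ts X \<longleftrightarrow> weak_ts X \<and>
     (\<forall>u \<in> actions X. \<exists>\<alpha> \<beta>. (\<alpha>, [u], \<beta>) \<in> transitions X) \<and> CSA2 X"

definition ts_map ::
  "('s, 'a, 'l) ts \<Rightarrow> ('t, 'b, 'l) ts \<Rightarrow> ('s \<Rightarrow> 't) \<Rightarrow> ('a \<Rightarrow> 'b) \<Rightarrow> bool" where
  "ts_map X Y g h \<longleftrightarrow>
     g ` states X \<subseteq> states Y \<and> h ` actions X \<subseteq> actions Y \<and>
     (\<forall>u \<in> actions X. label Y (h u) = label X u) \<and>
     (\<forall>(\<alpha>, us, \<beta>) \<in> transitions X. (g \<alpha>, map h us, g \<beta>) \<in> transitions Y)"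

definition ts_iso ::
  "('s, 'a, 'l) ts \<Rightarrow> ('t, 'b, 'l) ts \<Rightarrow> ('s \<Rightarrow> 't) \<Rightarrow> ('a \<Rightarrow> 'b) \<Rightarrow> bool" where
  "ts_iso X Y g h \<longleftrightarrow> ts_map X Y g h \<and>
     (\<exists>g' h'. ts_map Y X g' h' \<and>
        (\<forall>\<alpha> \<in> states X. g' (g \<alpha>) = \<alpha>) \<and> (\<forall>u \<in> actions X. h' (h u) = u) \<and>
        (\<forall>\<beta> \<in> states Y. g (g' \<beta>) = \<beta>) \<and> (\<forall>v \<in> actions Y. h (h' v) = v))"

subsection \<open>The category of regular transition systems\<close>

text \<open>
  Size conventions: the type \<open>'u\<close> plays the role of a Grothendieck universe (its cardinality is
  strongly inaccessible), and the sets of the mathematical text are the sets of cardinality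
  strictly less than that of \<open>'u\<close>.  Every such set is equipotent to a subset of \<open>'u\<close>.
\<close>

definition universe :: "'u itself \<Rightarrow> bool" where
  "universe U \<longleftrightarrow>
     uncountable (UNIV :: 'u set) \<and>
     (\<forall>A :: 'u set. A \<prec> (UNIV :: 'u set) \<longrightarrow> Pow A \<prec> (UNIV :: 'u set)) \<and>
     (\<forall>F :: 'u set set. F \<prec> (UNIV :: 'u set) \<and> (\<forall>A \<in> F. A \<prec> (UNIV :: 'u set)) \<longrightarrow>
        \<Union> F \<prec> (UNIV :: 'u set))"

record ('u, 'l) ts_arrow =
  src :: "('u, 'u, 'l) ts"
  tgt :: "('u, 'u, 'l) ts"
  on_states :: "'u \<Rightarrow> 'u"
  on_actions :: "'u \<Rightarrow> 'u"

text \<open>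
  Labelling maps and the components of arrows are extensional functions (equal to
  \<open>undefined\<close> outside their domains), so that equality in HOL is equality of maps between sets.
\<close>

definition RTS_ob :: "('u, 'u, 'l) ts set" where
  "RTS_ob = {X. regular_ts X \<and> label X \<in> extensional (actions X) \<and>
     states X \<prec> (UNIV :: 'u set) \<and> actions X \<prec> (UNIV :: 'u set)}"

definition RTS_ar :: "('u, 'l) ts_arrow set" where
  "RTS_ar = {f. src f \<in> RTS_ob \<and> tgt f \<in> RTS_ob \<and>
     ts_map (src f) (tgt f) (on_states f) (on_actions f) \<and>
     on_states f \<in> extensional (states (src f)) \<and>
     on_actions f \<in> extensional (actions (src f))}"

definition RTS :: "(('u, 'u, 'l) ts, ('u, 'l) ts_arrow) cat" where
  "RTS = \<lparr>Ob = RTS_ob, Ar = RTS_ar, Dom = src, Cod = tgt,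
     Id = (\<lambda>X. \<lparr>src = X, tgt = X,
                on_states = (\<lambda>\<alpha> \<in> states X. \<alpha>), on_actions = (\<lambda>u \<in> actions X. u)\<rparr>),
     Comp = (\<lambda>g f. \<lparr>src = src f, tgt = tgt g,
                on_states = compose (states (src f)) (on_states g) (on_states f),
                on_actions = compose (actions (src f)) (on_actions g) (on_actions f)\<rparr>)\<rparr>"

subsection \<open>Cubes, the generating cofibrations, and the maps to be inverted\<close>

text \<open>A set, viewed as a transition system without actions.\<close>

definition discrete_ts :: "'s set \<Rightarrow> ('s, unit, 'l) ts" where
  "discrete_ts A = \<lparr>states = A, actions = {}, label = (\<lambda>_. undefined), transitions = {}\<rparr>"

text \<open>
  The states of the cube are the boolean lists of length \<open>n\<close>, with \<open>False < True\<close> for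
  \<open>0 < 1\<close>; indices start from 0.
\<close>

definition cube :: "'l list \<Rightarrow> (bool list, 'l \<times> nat, 'l) ts" where
  "cube xs = \<lparr>states = {\<epsilon>. length \<epsilon> = length xs},
     actions = {(xs ! i, i) | i. i < length xs},
     label = fst,
     transitions = {(\<epsilon>, map (\<lambda>i. (xs ! i, i)) js, \<epsilon>') | \<epsilon> js \<epsilon>'.
        length \<epsilon> = length xs \<and> length \<epsilon>' = length xs \<and> js \<noteq> [] \<and> distinct js \<and>
        (\<forall>i < length xs. \<epsilon> ! i \<le> \<epsilon>' ! i) \<and> set js = {i. i < length xs \<and> \<epsilon> ! i \<noteq> \<epsilon>' ! i}}\<rparr>"

text \<open>For \<open>n = 1\<close> no transition is left, so that the action has to be removed as well.\<close>

definition boundary :: "'l list \<Rightarrow> (bool list, 'l \<times> nat, 'l) ts" where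
  "boundary xs = \<lparr>states = states (cube xs),
     actions = (if length xs = 1 then {} else actions (cube xs)),
     label = fst,
     transitions = {(\<epsilon>, us, \<epsilon>') \<in> transitions (cube xs). length us \<noteq> length xs}\<rparr>"

definition double_transition :: "'l \<Rightarrow> (nat, 'l, 'l) ts" where
  "double_transition x = \<lparr>states = {1, 2, 3, 4}, actions = {x}, label = id,
     transitions = {(1, [x], 2), (3, [x], 4)}\<rparr>"

definition ts_coprod :: "('s, 'a, 'l) ts \<Rightarrow> ('t, 'b, 'l) ts \<Rightarrow> ('s + 't, 'a + 'b, 'l) ts" where
  "ts_coprod X Y = \<lparr>states = states X <+> states Y, actions = actions X <+> actions Y,
     label = case_sum (label X) (label Y),
     transitions = {(Inl \<alpha>, map Inl us, Inl \<beta>) | \<alpha> us \<beta>. (\<alpha>, us, \<beta>) \<in> transitions X} \<union>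
       {(Inr \<alpha>, map Inr us, Inr \<beta>) | \<alpha> us \<beta>. (\<alpha>, us, \<beta>) \<in> transitions Y}\<rparr>"

text \<open>
  The cubes etc. have their own types of states and actions.  \<open>copies A B g h\<close> is the
  class of arrows of \<open>RTS\<close> which are isomorphic, as arrows, to the map \<open>(g, h) : A \<rightarrow> B\<close>.
\<close>

definition copies ::
  "('s, 'a, 'l) ts \<Rightarrow> ('t, 'b, 'l) ts \<Rightarrow> ('s \<Rightarrow> 't) \<Rightarrow> ('a \<Rightarrow> 'b) \<Rightarrow> ('u, 'l) ts_arrow set" where
  "copies A B g h = {f \<in> Ar RTS. \<exists>gA hA gB hB.
     ts_iso A (src f) gA hA \<and> ts_iso B (tgt f) gB hB \<and>
     (\<forall>\<alpha> \<in> states A. on_states f (gA \<alpha>) = gB (g \<alpha>)) \<and>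
     (\<forall>u \<in> actions A. on_actions f (hA u) = hB (h u))}"

definition gen_cofibrations :: "('u, 'l) ts_arrow set" where
  "gen_cofibrations =
     copies (discrete_ts ({} :: nat set)) (discrete_ts {0 :: nat}) id id \<union>
     copies (discrete_ts {0, 1 :: nat}) (discrete_ts {0 :: nat}) (\<lambda>_. 0) id \<union>
     (\<Union>xs \<in> {xs. length xs \<ge> 1}. copies (boundary xs) (cube xs) id id) \<union>
     (\<Union>x. copies (cube [x]) (double_transition x) (\<lambda>\<epsilon>. if \<epsilon> = [False] then 1 else 2) fst)"

text \<open>The maps \<open>p\<^sub>x\<close>.\<close>

definition p_maps :: "('u, 'l) ts_arrow set" where
  "p_maps = (\<Union>x. copies (ts_coprod (cube [x]) (cube [x])) (double_transition x)
     (case_sum (\<lambda>\<epsilon>. if \<epsilon> = [False] then 1 else 2) (\<lambda>\<epsilon>. if \<epsilon> = [False] then 3 else 4))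
     (case_sum fst fst))"

definition RTS_model :: "('u, 'l) ts_arrow model" where
  "RTS_model = left_determined TYPE('u) RTS gen_cofibrations"

definition L_Cub_RTS :: "('u, 'l) ts_arrow model" where
  "L_Cub_RTS = left_bousfield RTS RTS_model p_maps"

text \<open>The reflection onto the full subcategory of injective objects, on arrows.\<close>

definition L_S :: "('u, 'l) ts_arrow \<Rightarrow> ('u, 'l) ts_arrow" where
  "L_S f = reflection_map RTS {Z. injective_object RTS p_maps Z} f"

end

(*
  Every trivial fibration is bijective on states, surjective on actions and reflects
  transitions, and the cofibrations are the maps that are injective on actions. Hence the maps f
  such that Hom(f, Z) is bijective for every Z satisfying CSA1 (two parallel 1-transitions with
  the same label have the same action) form a localizer, which contains the weak equivalences of
  the left determined structure. In a fibrant object two actions labelling parallel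
  1-transitions with the same label are interchangeable, and locality with respect to the p_x
  makes all actions with the same label interchangeable. Therefore a function complex into a
  local object Z is weakly equivalent to the discrete set of maps into the quotient of Z that
  identifies actions with the same label, an S-injective object; conversely S-injective objects
  are local. So f is a local equivalence iff Hom(f, Z) is bijective for all S-injective Z, which
  means that the reflection of f is invertible.
*)

theory Submission
  imports Defs
begin

section \<open>Orthogonality in a category\<close>

text \<open>The weak equivalences of the left determined structure are an intersection of
  localizers, so they are approached from two sides: from above by one explicit localizer, given by
  orthogonality, and from below by maps lying in every localizer, namely trivial fibrations, their
  sections, and pushouts of such sections that are cofibrations. The predicate
  \<open>induces_weq\<close> asks for some resolution of the map. To establish it, an explicit
  resolution can be chosen: stage n has n + 1 interchangeable copies of each action, and a simplex
  of positive dimension is determined by its faces, so that only pi_0 carries information. To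
  exploit it, an arbitrary resolution has to be handled; what is known is that its augmentations are
  weak equivalences, hence orthogonal to every system satisfying CSA1. This is why a fibrant object
  is compared with its quotient by parallel actions, which satisfies CSA1 and is a retract of
  it.\<close>

locale category =
  fixes C :: "('o, 'm) cat"
  assumes Dom_in_Ob: "f \<in> Ar C \<Longrightarrow> Dom C f \<in> Ob C"
    and Cod_in_Ob: "f \<in> Ar C \<Longrightarrow> Cod C f \<in> Ob C"
    and Id_in_hom: "a \<in> Ob C \<Longrightarrow> Id C a \<in> hom C a a"
    and Comp_in_hom: "f \<in> hom C a b \<Longrightarrow> g \<in> hom C b c \<Longrightarrow> Comp C g f \<in> hom C a c"
    and Comp_assoc: "f \<in> hom C a b \<Longrightarrow> g \<in> hom C b c \<Longrightarrow> h \<in> hom C c d \<Longrightarrow>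
      Comp C (Comp C h g) f = Comp C h (Comp C g f)"
    and Comp_Id_left: "f \<in> hom C a b \<Longrightarrow> Comp C (Id C b) f = f"
    and Comp_Id_right: "f \<in> hom C a b \<Longrightarrow> Comp C f (Id C a) = f"

lemma hom_Ar: "f \<in> hom C a b \<Longrightarrow> f \<in> Ar C"
  and hom_Dom: "f \<in> hom C a b \<Longrightarrow> Dom C f = a"
  and hom_Cod: "f \<in> hom C a b \<Longrightarrow> Cod C f = b"
  and Ar_hom: "f \<in> Ar C \<Longrightarrow> f \<in> hom C (Dom C f) (Cod C f)"
  by (auto simp: hom_def)

text \<open>Bijectivity of precomposition with \<open>f\<close> on maps into \<open>Z\<close>. As a
  property of \<open>f\<close> it is stable under two-out-of-three, pushouts and transfinite
  composition, because Hom(-, Z) turns colimits into limits.\<close>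

definition orth :: "('o, 'm) cat \<Rightarrow> 'm \<Rightarrow> 'o \<Rightarrow> bool" where
  "orth C f Z \<longleftrightarrow> (\<forall>g \<in> hom C (Dom C f) Z. \<exists>!h. h \<in> hom C (Cod C f) Z \<and> Comp C h f = g)"

context category
begin

lemma orthI:
  assumes "f \<in> hom C a b"
    and "\<And>g. g \<in> hom C a Z \<Longrightarrow> \<exists>h. h \<in> hom C b Z \<and> Comp C h f = g"
    and "\<And>h h'. h \<in> hom C b Z \<Longrightarrow> h' \<in> hom C b Z \<Longrightarrow> Comp C h f = Comp C h' f \<Longrightarrow> h = h'"
  shows "orth C f Z"
  unfolding orth_def using assms(2,3) by (simp add: hom_Dom[OF assms(1)] hom_Cod[OF assms(1)]) metis

lemma orth_ex:
  assumes "orth C f Z" "f \<in> hom C a b" "g \<in> hom C a Z"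
  obtains h where "h \<in> hom C b Z" "Comp C h f = g"
proof -
  have "\<exists>!h. h \<in> hom C b Z \<and> Comp C h f = g"
    using assms unfolding orth_def by (simp add: hom_Dom[OF assms(2)] hom_Cod[OF assms(2)])
  then show ?thesis using that by blast
qed

lemma orth_unique:
  assumes "orth C f Z" "f \<in> hom C a b" "h \<in> hom C b Z" "h' \<in> hom C b Z" "Comp C h f = Comp C h' f"
  shows "h = h'"
proof -
  have "\<exists>!k. k \<in> hom C b Z \<and> Comp C k f = Comp C h f"
    using assms(1) Comp_in_hom[OF assms(2,3)] unfolding orth_def
    by (simp add: hom_Dom[OF assms(2)] hom_Cod[OF assms(2)])
  then show ?thesis using assms(3-5) by metis
qed

lemma orth_Id: "a \<in> Ob C \<Longrightarrow> orth C (Id C a) Z"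
  by (rule orthI[OF Id_in_hom]) (auto simp: Comp_Id_right)

lemma orth_Comp:
  assumes f: "f \<in> hom C a b" and g: "g \<in> hom C b c" and "orth C f Z" "orth C g Z"
  shows "orth C (Comp C g f) Z"
proof (rule orthI[OF Comp_in_hom[OF f g]])
  fix k assume k: "k \<in> hom C a Z"
  obtain h where h: "h \<in> hom C b Z" "Comp C h f = k" using orth_ex[OF assms(3) f k] .
  obtain h' where h': "h' \<in> hom C c Z" "Comp C h' g = h" using orth_ex[OF assms(4) g h(1)] .
  show "\<exists>h. h \<in> hom C c Z \<and> Comp C h (Comp C g f) = k"
    using h h' Comp_assoc[OF f g h'(1)] by auto
next
  fix h h' assume h: "h \<in> hom C c Z" "h' \<in> hom C c Z"
    and "Comp C h (Comp C g f) = Comp C h' (Comp C g f)"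
  then have "Comp C (Comp C h g) f = Comp C (Comp C h' g) f"
    by (simp add: Comp_assoc[OF f g])
  then have "Comp C h g = Comp C h' g"
    by (rule orth_unique[OF assms(3) f Comp_in_hom[OF g h(1)] Comp_in_hom[OF g h(2)]])
  then show "h = h'" by (rule orth_unique[OF assms(4) g h])
qed

lemma orth_cancel_right:
  assumes f: "f \<in> hom C a b" and g: "g \<in> hom C b c" and "orth C f Z" "orth C (Comp C g f) Z"
  shows "orth C g Z"
proof (rule orthI[OF g])
  fix k assume k: "k \<in> hom C b Z"
  obtain h where h: "h \<in> hom C c Z" "Comp C h (Comp C g f) = Comp C k f"
    using orth_ex[OF assms(4) Comp_in_hom[OF f g] Comp_in_hom[OF f k]] .
  have "Comp C h g = k"
    using h by (intro orth_unique[OF assms(3) f Comp_in_hom[OF g h(1)] k])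
      (simp add: Comp_assoc[OF f g])
  then show "\<exists>h. h \<in> hom C c Z \<and> Comp C h g = k" using h by blast
next
  fix h h' assume h: "h \<in> hom C c Z" "h' \<in> hom C c Z" and "Comp C h g = Comp C h' g"
  then show "h = h'"
    using Comp_assoc[OF f g h(1)] Comp_assoc[OF f g h(2)]
    by (intro orth_unique[OF assms(4) Comp_in_hom[OF f g] h]) simp
qed

lemma orth_cancel_left:
  assumes f: "f \<in> hom C a b" and g: "g \<in> hom C b c" and "orth C g Z" "orth C (Comp C g f) Z"
  shows "orth C f Z"
proof (rule orthI[OF f])
  fix k assume k: "k \<in> hom C a Z"
  obtain h where h: "h \<in> hom C c Z" "Comp C h (Comp C g f) = k"
    using orth_ex[OF assms(4) Comp_in_hom[OF f g] k] .
  then show "\<exists>h. h \<in> hom C b Z \<and> Comp C h f = k"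
    using Comp_in_hom[OF g h(1)] Comp_assoc[OF f g h(1)] by auto
next
  fix h h' assume h: "h \<in> hom C b Z" "h' \<in> hom C b Z" and eq: "Comp C h f = Comp C h' f"
  obtain k where k: "k \<in> hom C c Z" "Comp C k g = h" using orth_ex[OF assms(3) g h(1)] .
  obtain k' where k': "k' \<in> hom C c Z" "Comp C k' g = h'" using orth_ex[OF assms(3) g h(2)] .
  have "k = k'"
    using eq k k' Comp_assoc[OF f g k(1)] Comp_assoc[OF f g k'(1)]
    by (intro orth_unique[OF assms(4) Comp_in_hom[OF f g] k(1) k'(1)]) simp
  then show "h = h'" using k k' by simp
qed

section \<open>Stability under pushouts and transfinite composition\<close>

lemma is_pushoutD:
  assumes "is_pushout C i u i' u'"
  shows "i \<in> hom C (Dom C i) (Cod C i)" "u \<in> hom C (Dom C i) (Cod C u)"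
    "i' \<in> hom C (Cod C u) (Cod C i')" "u' \<in> hom C (Cod C i) (Cod C i')" "Comp C i' u = Comp C u' i"
    "\<And>Z v w. v \<in> hom C (Cod C u) Z \<Longrightarrow> w \<in> hom C (Cod C i) Z \<Longrightarrow> Comp C v u = Comp C w i \<Longrightarrow>
       \<exists>!h. h \<in> hom C (Cod C i') Z \<and> Comp C h i' = v \<and> Comp C h u' = w"
  using assms unfolding is_pushout_def by (auto simp: hom_def)

text \<open>Hom(-, Z) sends the pushout square to a pullback square of sets, and a bijection pulls
  back to a bijection.\<close>

lemma orth_pushout:
  assumes po: "is_pushout C i u i' u'" and o: "orth C i Z"
  shows "orth C i' Z"
proof -
  note p = is_pushoutD[OF po]
  show ?thesis
  proof (rule orthI[OF p(3)])
    fix g assume g: "g \<in> hom C (Cod C u) Z"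
    obtain w where w: "w \<in> hom C (Cod C i) Z" "Comp C w i = Comp C g u"
      using orth_ex[OF o p(1) Comp_in_hom[OF p(2) g]] .
    show "\<exists>h. h \<in> hom C (Cod C i') Z \<and> Comp C h i' = g"
      using p(6)[OF g w(1)] w(2) by auto
  next
    fix h h' assume h: "h \<in> hom C (Cod C i') Z" "h' \<in> hom C (Cod C i') Z" 
      and eq: "Comp C h i' = Comp C h' i'"
    \<comment> \<open>A map out of the pushout is determined by its two legs; the leg along
      \<open>u'\<close> is pinned down by orthogonality of \<open>i\<close>.\<close>
    have "Comp C h u' = Comp C h' u'"
    proof (rule orth_unique[OF o p(1) Comp_in_hom[OF p(4) h(1)] Comp_in_hom[OF p(4) h(2)]])
      show "Comp C (Comp C h u') i = Comp C (Comp C h' u') i"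
        using Comp_assoc[OF p(1,4) h(1)] Comp_assoc[OF p(1,4) h(2)]
          Comp_assoc[OF p(2,3) h(1)] Comp_assoc[OF p(2,3) h(2)] eq p(5) by metis
    qed
    moreover have "Comp C (Comp C h i') u = Comp C (Comp C h u') i"
      using Comp_assoc[OF p(1,4) h(1)] Comp_assoc[OF p(2,3) h(1)] p(5) by simp
    ultimately show "h = h'"
      using p(6)[OF Comp_in_hom[OF p(3) h(1)] Comp_in_hom[OF p(4) h(1)]] h eq by metis
  qed
qed

text \<open>The lift \<open>k\<close> against \<open>i\<close> and the given map \<open>a\<close>
  agree on the domain of \<open>i\<close>, so they glue to a map out of the pushout; that it lies
  over \<open>b\<close> is again tested on the two legs.\<close>

lemma llp_pushout:
  assumes po: "is_pushout C i u i' u'" and i: "i \<in> llp C K" and K: "K \<subseteq> Ar C"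
  shows "i' \<in> llp C K"
proof -
  note p = is_pushoutD[OF po]
  have "lifts C i' q" if "q \<in> K" for q
    unfolding lifts_def
  proof (intro ballI impI)
    fix a b
    assume "a \<in> hom C (Dom C i') (Dom C q)" and "b \<in> hom C (Cod C i') (Cod C q)"
      and eq: "Comp C q a = Comp C b i'"
    then have a: "a \<in> hom C (Cod C u) (Dom C q)" and b: "b \<in> hom C (Cod C i') (Cod C q)"
      using hom_Dom[OF p(3)] by auto
    have q: "q \<in> hom C (Dom C q) (Cod C q)" using that K by (intro Ar_hom) auto
    have "lifts C i q" using i that unfolding llp_def by auto
    moreover have "Comp C q (Comp C a u) = Comp C (Comp C b u') i"
      using Comp_assoc[OF p(2) a q] Comp_assoc[OF p(2,3) b] Comp_assoc[OF p(1,4) b] p(5) eq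
      by simp
    ultimately obtain k where k: "k \<in> hom C (Cod C i) (Dom C q)" "Comp C k i = Comp C a u"
      "Comp C q k = Comp C b u'"
      unfolding lifts_def using Comp_in_hom[OF p(2) a] Comp_in_hom[OF p(4) b] by blast
    obtain h where h: "h \<in> hom C (Cod C i') (Dom C q)" "Comp C h i' = a" "Comp C h u' = k"
      using p(6)[OF a k(1)] k(2) by auto
    have "Comp C q h = b"
    proof -
      have "Comp C (Comp C q h) i' = Comp C b i'" "Comp C (Comp C q h) u' = Comp C b u'"
        using Comp_assoc[OF p(3) h(1) q] Comp_assoc[OF p(4) h(1) q] h k eq by auto
      moreover have "Comp C (Comp C b i') u = Comp C (Comp C b u') i"
        using Comp_assoc[OF p(2,3) b] Comp_assoc[OF p(1,4) b] p(5) by simp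
      ultimately show ?thesis
        using p(6)[OF Comp_in_hom[OF p(3) b] Comp_in_hom[OF p(4) b]] b
          Comp_in_hom[OF h(1) q] by metis
    qed
    then show "\<exists>h\<in>hom C (Cod C i') (Dom C q). Comp C h i' = a \<and> Comp C q h = b"
      using h by blast
  qed
  then show ?thesis using p(3) unfolding llp_def by (auto simp: hom_def)
qed

text \<open>Transfinite induction on the upper end \<open>b\<close>, with \<open>a\<close> fixed.
  The colimit case speaks of an arbitrary subset \<open>A\<close> of the field rather than of the
  segment below a limit element, so that it has the shape of \<open>orth_chain_colimit\<close> and
  \<open>action_inj_chain_colimit\<close>, which also treat the colimit of the whole chain.\<close>

lemma transfinite_sequence_induct [consumes 3, case_names Id Comp cover colimit]:
  assumes wo: "Well_order r" and ts: "transfinite_sequence C r X D" and ab: "(a, b) \<in> r"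
    and Id: "\<And>x. x \<in> Ob C \<Longrightarrow> P (Id C x)"
    and Comp: "\<And>f g x y z. f \<in> hom C x y \<Longrightarrow> g \<in> hom C y z \<Longrightarrow> P f \<Longrightarrow> P g \<Longrightarrow> P (Comp C g f)"
    and cover: "\<And>c d. covers r c d \<Longrightarrow> P (D c d)"
    and colimit: "\<And>A L c a. A \<subseteq> Field r \<Longrightarrow> is_colimit C A X (chain_edges r D A) L c \<Longrightarrow>
      a \<in> A \<Longrightarrow> (\<And>b. b \<in> A \<Longrightarrow> (a, b) \<in> r \<Longrightarrow> P (D a b)) \<Longrightarrow> P (c a)"
  shows "P (D a b)"
proof -
  have wf: "wf (r - Relation.Id)" and refl: "Refl r"
    using wo unfolding well_order_on_def linear_order_on_def partial_order_on_def preorder_on_def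
    by auto
  note tsD = ts[unfolded transfinite_sequence_def]
  have "(a, b) \<in> r \<longrightarrow> P (D a b)"
  proof (induction b rule: wf_induct_rule[OF wf])
    case (1 b)
    show ?case
    proof
      assume ab: "(a, b) \<in> r"
      then have F: "a \<in> Field r" "b \<in> Field r" by (auto simp: Field_def)
      \<comment> \<open>Equal, successor or limit: an element strictly above \<open>a\<close> that
        covers nothing is a limit element.\<close>
      consider "a = b" | e where "a \<noteq> b" "covers r e b" | "a \<noteq> b" "\<And>e. \<not> covers r e b" by blast
      then show "P (D a b)"
      proof cases
        case 1
        then show ?thesis using tsD F Id by metis
      next
        case 2
        have "(e, b) \<in> r" "e \<noteq> b" using 2 unfolding covers_def by auto
        have "(a, e) \<in> r \<or> (e, a) \<in> r"
          using wo F \<open>(e, b) \<in> r\<close> refl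
          unfolding well_order_on_def linear_order_on_def total_on_def refl_on_def
          by (metis FieldI1)
        \<comment> \<open>Nothing lies strictly between \<open>e\<close> and \<open>b\<close>, and
          \<open>a\<close> differs from \<open>b\<close>; with totality this puts \<open>a\<close>
          at or below \<open>e\<close>.\<close>
        moreover have "(e, a) \<in> r \<Longrightarrow> a = e"
          using 2 ab unfolding covers_def by auto
        ultimately have ae: "(a, e) \<in> r" using F refl unfolding refl_on_def by auto
        have "P (D a e)" using 1 ae \<open>(e, b) \<in> r\<close> \<open>e \<noteq> b\<close> by auto
        moreover have "D a b = Comp C (D e b) (D a e)" using tsD ae \<open>(e, b) \<in> r\<close> by auto
        moreover have "D a e \<in> hom C (X a) (X e)" "D e b \<in> hom C (X e) (X b)"
          using tsD ae \<open>(e, b) \<in> r\<close> by auto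
        ultimately show ?thesis using Comp cover[OF 2(2)] by metis
      next
        case 3
        have "limit_elt r b"
          unfolding limit_elt_def
        proof (intro conjI ballI)
          show "b \<in> Field r" by (fact F)
          show "underS r b \<noteq> {}" using 3 ab unfolding underS_def by auto
          fix e assume "e \<in> underS r b"
          then have e: "(e, b) \<in> r" "e \<noteq> b" unfolding underS_def by auto
          with 3(2)[of e] obtain d where "(e, d) \<in> r" "(d, b) \<in> r" "d \<noteq> e" "d \<noteq> b"
            unfolding covers_def by auto
          then show "\<exists>d\<in>underS r b. (e, d) \<in> r \<and> e \<noteq> d" unfolding underS_def by auto
        qed
        then have "is_colimit C (underS r b) X (chain_edges r D (underS r b)) (X b) (\<lambda>a. D a b)"
          using tsD by blast
        then show ?thesis
          by (rule colimit[rotated])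
            (use 1 3 ab in \<open>auto simp: underS_def Field_def\<close>)
      qed
    qed
  qed
  then show ?thesis using ab by blast
qed

lemma chain_colimitD:
  assumes "is_colimit C A X (chain_edges r D A) L c"
  shows "a \<in> A \<Longrightarrow> c a \<in> hom C (X a) L"
    and "a \<in> A \<Longrightarrow> b \<in> A \<Longrightarrow> (a, b) \<in> r \<Longrightarrow> Comp C (c b) (D a b) = c a"
    and "L \<in> Ob C"
  using assms unfolding is_colimit_def is_cocone_def chain_edges_def by auto

text \<open>The stages above \<open>a\<close> are cofinal in \<open>A\<close>, and along them Hom(-,
  Z) is constant up to bijection, so a map out of \<open>X a\<close> extends uniquely to a cocone
  and hence to the colimit.\<close>

lemma orth_chain_colimit:
  assumes wo: "Well_order r" and ts: "transfinite_sequence C r X D" and A: "A \<subseteq> Field r"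
    and col: "is_colimit C A X (chain_edges r D A) L c" and a: "a \<in> A" and Z: "Z \<in> Ob C"
    and o: "\<And>b. b \<in> A \<Longrightarrow> (a, b) \<in> r \<Longrightarrow> orth C (D a b) Z"
  shows "orth C (c a) Z"
proof -
  note tsD = ts[unfolded transfinite_sequence_def]
  have refl: "Refl r" and trans: "trans r" and total: "Total r"
    using wo unfolding well_order_on_def linear_order_on_def partial_order_on_def preorder_on_def
    by auto
  have tot: "(b, b') \<in> r \<or> (b', b) \<in> r" if "b \<in> A" "b' \<in> A" for b b'
  proof -
    have "b \<in> Field r" "b' \<in> Field r" using that A by auto
    then show ?thesis
      using total[unfolded total_on_def] refl_onD[OF refl] by (cases "b = b'") auto
  qed
  have D: "D b b' \<in> hom C (X b) (X b')" if "(b, b') \<in> r" for b b' using tsD that by blast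
  have DD: "Comp C (D b' b'') (D b b') = D b b''" if "(b, b') \<in> r" "(b', b'') \<in> r" for b b' b''
    using tsD that by blast
  note colD = chain_colimitD[OF col]
  show ?thesis
  proof (rule orthI[OF colD(1)[OF a]])
    fix g assume g: "g \<in> hom C (X a) Z"
    \<comment> \<open>Above \<open>a\<close> the component is the unique extension of
      \<open>g\<close>; elsewhere, that is below \<open>a\<close>, it is the restriction of
      \<open>g\<close>.\<close>
    define c' where "c' b = (if (a, b) \<in> r then (SOME h. h \<in> hom C (X b) Z \<and> Comp C h (D a b) = g)
      else Comp C g (D b a))" for b
    have up: "c' b \<in> hom C (X b) Z" "Comp C (c' b) (D a b) = g"
      if b: "b \<in> A" "(a, b) \<in> r" for b
    proof -
      obtain h where "h \<in> hom C (X b) Z \<and> Comp C h (D a b) = g"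
        using orth_ex[OF o[OF b] D[OF b(2)] g] by blast
      then have "c' b \<in> hom C (X b) Z \<and> Comp C (c' b) (D a b) = g"
        unfolding c'_def using b by (auto intro: someI2)
      then show "c' b \<in> hom C (X b) Z" "Comp C (c' b) (D a b) = g" by auto
    qed
    have down: "c' b = Comp C g (D b a)" "(b, a) \<in> r" if "b \<in> A" "(a, b) \<notin> r" for b
      using that tot[OF a] by (auto simp: c'_def)
    have hom: "c' b \<in> hom C (X b) Z" if "b \<in> A" for b
      using up(1) down that Comp_in_hom[OF D g] by (cases "(a, b) \<in> r") auto
    have "is_cocone C A X (chain_edges r D A) Z c'"
      unfolding is_cocone_def chain_edges_def
    proof (safe intro!: Z hom)
      fix b b' assume b: "b \<in> A" "b' \<in> A" "(b, b') \<in> r"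
      \<comment> \<open>The remaining combination, \<open>(a, b)\<close> in \<open>r\<close> without
        \<open>(a, b')\<close>, is excluded by transitivity.\<close>
      consider "(a, b) \<in> r" "(a, b') \<in> r" | "(a, b) \<notin> r" "(a, b') \<in> r" | "(a, b) \<notin> r" "(a, b') \<notin> r"
        using b(3) trans by (meson transD)
      then show "Comp C (c' b') (D b b') = c' b"
      proof cases
        case 1
        have "Comp C (Comp C (c' b') (D b b')) (D a b) = Comp C (c' b) (D a b)"
          unfolding Comp_assoc[OF D[OF 1(1)] D[OF b(3)] hom[OF b(2)]] DD[OF 1(1) b(3)]
            up(2)[OF b(1) 1(1)] by (rule up(2)[OF b(2) 1(2)])
        then show ?thesis
          by (rule orth_unique[OF o[OF b(1) 1(1)] D[OF 1(1)] Comp_in_hom[OF D[OF b(3)] hom[OF b(2)]]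
                hom[OF b(1)]])
      next
        case 2
        note d = down[OF b(1) 2(1)]
        have "Comp C (c' b') (D b b') = Comp C (c' b') (Comp C (D a b') (D b a))"
          using DD[OF d(2) 2(2)] by simp
        also have "\<dots> = Comp C (Comp C (c' b') (D a b')) (D b a)"
          using Comp_assoc[OF D[OF d(2)] D[OF 2(2)] hom[OF b(2)]] by simp
        also have "\<dots> = c' b" using d up b 2 by simp
        finally show ?thesis .
      next
        case 3
        note d = down[OF b(1) 3(1)] down[OF b(2) 3(2)]
        then show ?thesis using Comp_assoc[OF D[OF b(3)] D[OF d(4)] g] DD[OF b(3) d(4)] by simp
      qed
    qed
    then obtain h where h: "h \<in> hom C L Z" "\<forall>b\<in>A. Comp C h (c b) = c' b"
      using col unfolding is_colimit_def by blast
    have aa: "(a, a) \<in> r" using a A refl unfolding refl_on_def by auto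
    have "c' a = g"
      using up(2)[OF a aa] up(1)[OF a aa] tsD a A Comp_Id_right by (metis subsetD)
    then show "\<exists>h. h \<in> hom C L Z \<and> Comp C h (c a) = g" using h a by auto
  next
    fix h h' assume h: "h \<in> hom C L Z" "h' \<in> hom C L Z" and eq: "Comp C h (c a) = Comp C h' (c a)"
    have agree: "Comp C h (c b) = Comp C h' (c b)" if b: "b \<in> A" for b
    proof (cases "(a, b) \<in> r")
      case True
      note cc = Comp_assoc[OF D[OF True] colD(1)[OF b]]
      have "Comp C (Comp C h (c b)) (D a b) = Comp C (Comp C h' (c b)) (D a b)"
        unfolding cc[OF h(1)] cc[OF h(2)] colD(2)[OF a b True] by (rule eq)
      then show ?thesis
        by (rule orth_unique[OF o[OF b True] D[OF True] Comp_in_hom[OF colD(1)[OF b] h(1)]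
              Comp_in_hom[OF colD(1)[OF b] h(2)]])
    next
      case False
      then have r: "(b, a) \<in> r" using tot[OF a b] by blast
      then show ?thesis
        using Comp_assoc[OF D[OF r] colD(1)[OF a] h(1)] Comp_assoc[OF D[OF r] colD(1)[OF a] h(2)]
          eq colD(2)[OF b a r] by simp
    qed
    have "is_cocone C A X (chain_edges r D A) Z (\<lambda>b. Comp C h (c b))"
      unfolding is_cocone_def chain_edges_def
      using Z Comp_in_hom[OF colD(1) h(1)] Comp_assoc[OF D colD(1) h(1)] colD(2) by auto
    then have "\<exists>!k. k \<in> hom C L Z \<and> (\<forall>b\<in>A. Comp C k (c b) = Comp C h (c b))"
      using col unfolding is_colimit_def by blast
    then show "h = h'" using h agree by metis
  qed
qed

lemma two_out_of_three_orth:
  "two_out_of_three C {f \<in> Ar C. \<forall>Z\<in>D. orth C f Z}"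
  unfolding two_out_of_three_def
proof (intro ballI impI)
  fix f g assume "f \<in> Ar C" "g \<in> Ar C" "Cod C f = Dom C g"
  then have f: "f \<in> hom C (Dom C f) (Dom C g)" and g: "g \<in> hom C (Dom C g) (Cod C g)"
    by (auto simp: hom_def)
  let ?W = "{f \<in> Ar C. \<forall>Z\<in>D. orth C f Z}"
  have W: "k \<in> ?W \<longleftrightarrow> (\<forall>Z\<in>D. orth C k Z)" if "k \<in> hom C a b" for k a b
    using hom_Ar[OF that] by simp
  show "(f \<in> ?W \<and> g \<in> ?W \<longrightarrow> Comp C g f \<in> ?W) \<and>
        (f \<in> ?W \<and> Comp C g f \<in> ?W \<longrightarrow> g \<in> ?W) \<and>
        (g \<in> ?W \<and> Comp C g f \<in> ?W \<longrightarrow> f \<in> ?W)"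
    unfolding W[OF f] W[OF g] W[OF Comp_in_hom[OF f g]]
    using orth_Comp[OF f g] orth_cancel_left[OF f g] orth_cancel_right[OF f g] by blast
qed

subsection \<open>Reflective subcategories\<close>

lemma is_reflection_orth:
  assumes "is_reflection C D X e"
  shows "e \<in> hom C X (Cod C e)" "Cod C e \<in> D" "Z \<in> D \<Longrightarrow> orth C e Z"
  using assms unfolding is_reflection_def orth_def by (auto simp: hom_def)

text \<open>Extending the identity of \<open>a\<close> along \<open>g\<close> gives a one-sided
  inverse; it is an inverse on the other side by uniqueness of extensions into
  \<open>b\<close>.\<close>

lemma is_iso_if_orth:
  assumes g: "g \<in> hom C a b" and "orth C g a" "orth C g b"
  shows "is_iso C g"
proof -
  have a: "a \<in> Ob C" and b: "b \<in> Ob C" using g Dom_in_Ob Cod_in_Ob by (auto simp: hom_def)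
  obtain h where h: "h \<in> hom C b a" "Comp C h g = Id C a"
    using orth_ex[OF assms(2) g Id_in_hom[OF a]] .
  have "Comp C g h = Id C b"
    using Comp_assoc[OF g h(1) g] h Comp_Id_left[OF g] Comp_Id_right[OF g]
    by (intro orth_unique[OF assms(3) g Comp_in_hom[OF h(1) g] Id_in_hom[OF b]]) simp
  then show ?thesis unfolding is_iso_def using g h by (auto simp: hom_def)
qed

lemma orth_if_is_iso:
  assumes iso: "is_iso C g" and g: "g \<in> hom C a b"
  shows "orth C g Z"
proof -
  obtain h where h: "h \<in> hom C b a" "Comp C h g = Id C a" "Comp C g h = Id C b"
    using iso unfolding is_iso_def hom_Dom[OF g] hom_Cod[OF g] by blast
  show ?thesis
  proof (rule orthI[OF g])
    fix k assume k: "k \<in> hom C a Z"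
    show "\<exists>l. l \<in> hom C b Z \<and> Comp C l g = k"
    proof (intro exI conjI)
      show "Comp C k h \<in> hom C b Z" by (rule Comp_in_hom[OF h(1) k])
      show "Comp C (Comp C k h) g = k"
        unfolding Comp_assoc[OF g h(1) k] h(2) by (rule Comp_Id_right[OF k])
    qed
  next
    fix k l assume k: "k \<in> hom C b Z" and l: "l \<in> hom C b Z" and eq: "Comp C k g = Comp C l g"
    have "Comp C k (Id C b) = Comp C l (Id C b)"
      unfolding h(3)[symmetric] Comp_assoc[OF h(1) g k, symmetric] Comp_assoc[OF h(1) g l,
        symmetric]
      by (simp only: eq)
    then show "k = l" by (simp only: Comp_Id_right[OF k] Comp_Id_right[OF l])
  qed
qed

text \<open>The square of the units relates \<open>f\<close> and its reflection \<open>g\<close>;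
  the units are orthogonal to \<open>D\<close>, so two-out-of-three transfers orthogonality between
  \<open>f\<close> and \<open>g\<close>. Both ends of \<open>g\<close> lie in \<open>D\<close>, so
  for \<open>g\<close> orthogonality to \<open>D\<close> amounts to invertibility.\<close>

lemma is_iso_reflection_map:
  assumes ex: "\<And>X. X \<in> Ob C \<Longrightarrow> \<exists>e. is_reflection C D X e" and f: "f \<in> hom C X Y"
  shows "is_iso C (reflection_map C D f) \<longleftrightarrow> (\<forall>Z\<in>D. orth C f Z)"
proof -
  have "X \<in> Ob C" "Y \<in> Ob C" using f Dom_in_Ob Cod_in_Ob by (auto simp: hom_def)
  then have "is_reflection C D X (reflection_unit C D X)" "is_reflection C D Y (reflection_unit C D
    Y)"
    unfolding reflection_unit_def using ex by (auto intro: someI_ex)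
  note X = is_reflection_orth[OF this(1)] and Y = is_reflection_orth[OF this(2)]
  define eX eY g where "eX = reflection_unit C D X" and "eY = reflection_unit C D Y"
    and "g = reflection_map C D f"
  note X = X[folded eX_def] and Y = Y[folded eY_def]
  have "\<exists>!g. g \<in> hom C (Cod C eX) (Cod C eY) \<and> Comp C g eX = Comp C eY f"
    using X(3)[OF Y(2)] Comp_in_hom[OF f Y(1)] hom_Dom[OF X(1)] unfolding orth_def by simp
  then have "g \<in> hom C (Cod C eX) (Cod C eY) \<and> Comp C g eX = Comp C eY f"
    unfolding g_def reflection_map_def eX_def eY_def hom_Dom[OF f] hom_Cod[OF f] by (rule theI')
  then have g: "g \<in> hom C (Cod C eX) (Cod C eY)" "Comp C g eX = Comp C eY f" by auto
  have "orth C g Z \<longleftrightarrow> orth C f Z" if "Z \<in> D" for Z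
    using orth_Comp[OF f Y(1)] orth_Comp[OF X(1) g(1)] orth_cancel_left[OF f Y(1)]
      orth_cancel_right[OF X(1) g(1)] X(3) Y(3) g(2) that by metis
  then show ?thesis
    using is_iso_if_orth[OF g(1)] orth_if_is_iso[OF _ g(1)] X(2) Y(2) unfolding g_def[symmetric]
    by blast
qed

end

section \<open>Regular transition systems\<close>

lemma weak_ts_trans:
  assumes "weak_ts X" "(\<alpha>, us, \<beta>) \<in> transitions X"
  shows "\<alpha> \<in> states X" "us \<noteq> []" "set us \<subseteq> actions X" "\<beta> \<in> states X"
proof -
  have "\<forall>(\<alpha>, us, \<beta>)\<in>transitions X. \<alpha> \<in> states X \<and> us \<noteq> [] \<and> set us \<subseteq> actions X \<and> \<beta> \<in> states X"
    using assms(1) unfolding weak_ts_def by (rule conjunct1)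
  from bspec[OF this assms(2)]
  show "\<alpha> \<in> states X" "us \<noteq> []" "set us \<subseteq> actions X" "\<beta> \<in> states X" by auto
qed

text \<open>The multiset axiom starts at n = 2, and rearranging a one-letter word is trivial, so
  permutations can be replaced throughout by equality of multisets.\<close>

lemma weak_ts_perm:
  assumes X: "weak_ts X" and t: "(\<alpha>, us, \<beta>) \<in> transitions X" and m: "mset vs = mset us"
  shows "(\<alpha>, vs, \<beta>) \<in> transitions X"
proof (cases "length us \<ge> 2")
  case True
  obtain \<sigma> where "\<sigma> permutes {..<length us}" "permute_list \<sigma> us = vs"
    using mset_eq_permutation[OF m] .
  then show ?thesis using X t True unfolding weak_ts_def by blast
next
  case False
  then obtain u where "us = [u]"
    using weak_ts_trans(2)[OF X t] by (cases us; cases "tl us") auto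
  then show ?thesis using m t by simp
qed

lemma weak_ts_compose:
  assumes "weak_ts X" "us \<noteq> []" "vs \<noteq> []" "ws \<noteq> []"
    "(\<alpha>, us @ vs @ ws, \<beta>) \<in> transitions X"
    "(\<alpha>, us, \<nu>1) \<in> transitions X" "(\<nu>1, vs @ ws, \<beta>) \<in> transitions X"
    "(\<alpha>, us @ vs, \<nu>2) \<in> transitions X" "(\<nu>2, ws, \<beta>) \<in> transitions X"
  shows "(\<nu>1, vs, \<nu>2) \<in> transitions X"
  using assms unfolding weak_ts_def by blast

lemma CSA2_ex:
  assumes "CSA2 X" "us \<noteq> []" "vs \<noteq> []" "(\<alpha>, us @ vs, \<beta>) \<in> transitions X"
  obtains \<nu> where "\<nu> \<in> states X" "(\<alpha>, us, \<nu>) \<in> transitions X" "(\<nu>, vs, \<beta>) \<in> transitions X"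
  using assms unfolding CSA2_def by blast

lemma CSA2_unique:
  assumes "CSA2 X" "weak_ts X" "us \<noteq> []" "vs \<noteq> []" "(\<alpha>, us @ vs, \<beta>) \<in> transitions X"
    and "(\<alpha>, us, \<nu>) \<in> transitions X" "(\<nu>, vs, \<beta>) \<in> transitions X"
    and "(\<alpha>, us, \<nu>') \<in> transitions X" "(\<nu>', vs, \<beta>) \<in> transitions X"
  shows "\<nu> = \<nu>'"
  using assms(1,3-) weak_ts_trans(4)[OF assms(2,6)] weak_ts_trans(4)[OF assms(2,8)]
  unfolding CSA2_def by blast

lemma regular_tsI:
  assumes trans: "\<And>\<alpha> us \<beta>. (\<alpha>, us, \<beta>) \<in> transitions X \<Longrightarrow>
      \<alpha> \<in> states X \<and> us \<noteq> [] \<and> set us \<subseteq> actions X \<and> \<beta> \<in> states X"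
    and perm: "\<And>\<alpha> us \<beta> vs. (\<alpha>, us, \<beta>) \<in> transitions X \<Longrightarrow> mset vs = mset us \<Longrightarrow>
      (\<alpha>, vs, \<beta>) \<in> transitions X"
    and comp: "\<And>\<alpha> \<beta> \<nu>1 \<nu>2 us vs ws. us \<noteq> [] \<Longrightarrow> vs \<noteq> [] \<Longrightarrow> ws \<noteq> [] \<Longrightarrow>
      (\<alpha>, us @ vs @ ws, \<beta>) \<in> transitions X \<Longrightarrow>
      (\<alpha>, us, \<nu>1) \<in> transitions X \<Longrightarrow> (\<nu>1, vs @ ws, \<beta>) \<in> transitions X \<Longrightarrow>
      (\<alpha>, us @ vs, \<nu>2) \<in> transitions X \<Longrightarrow> (\<nu>2, ws, \<beta>) \<in> transitions X \<Longrightarrow>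
      (\<nu>1, vs, \<nu>2) \<in> transitions X"
    and used: "\<And>u. u \<in> actions X \<Longrightarrow> \<exists>\<alpha> \<beta>. (\<alpha>, [u], \<beta>) \<in> transitions X"
    and ex: "\<And>\<alpha> us vs \<beta>. us \<noteq> [] \<Longrightarrow> vs \<noteq> [] \<Longrightarrow> (\<alpha>, us @ vs, \<beta>) \<in> transitions X \<Longrightarrow>
      \<exists>\<nu>. (\<alpha>, us, \<nu>) \<in> transitions X \<and> (\<nu>, vs, \<beta>) \<in> transitions X"
    and unique: "\<And>\<alpha> us vs \<beta> \<nu> \<nu>'. us \<noteq> [] \<Longrightarrow> vs \<noteq> [] \<Longrightarrow>
      (\<alpha>, us @ vs, \<beta>) \<in> transitions X \<Longrightarrow>
      (\<alpha>, us, \<nu>) \<in> transitions X \<Longrightarrow> (\<nu>, vs, \<beta>) \<in> transitions X \<Longrightarrow>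
      (\<alpha>, us, \<nu>') \<in> transitions X \<Longrightarrow> (\<nu>', vs, \<beta>) \<in> transitions X \<Longrightarrow> \<nu> = \<nu>'"
  shows "regular_ts X"
proof -
  have "weak_ts X"
    unfolding weak_ts_def
  proof (intro conjI allI impI)
    show "\<forall>(\<alpha>, us, \<beta>)\<in>transitions X. \<alpha> \<in> states X \<and> us \<noteq> [] \<and> set us \<subseteq> actions X \<and> \<beta> \<in> states X"
      using trans by auto
    fix \<alpha> us \<beta> \<sigma>
    assume "(\<alpha>, us, \<beta>) \<in> transitions X \<and> 2 \<le> length us \<and> \<sigma> permutes {..<length us}"
    then show "(\<alpha>, permute_list \<sigma> us, \<beta>) \<in> transitions X"
      using perm[of \<alpha> us \<beta> "permute_list \<sigma> us"] mset_permute_list[of \<sigma> us] by blast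
  next
    fix \<alpha> \<beta> \<nu>1 \<nu>2 us vs ws
    assume "us \<noteq> [] \<and> vs \<noteq> [] \<and> ws \<noteq> [] \<and> (\<alpha>, us @ vs @ ws, \<beta>) \<in> transitions X \<and>
      (\<alpha>, us, \<nu>1) \<in> transitions X \<and> (\<nu>1, vs @ ws, \<beta>) \<in> transitions X \<and>
      (\<alpha>, us @ vs, \<nu>2) \<in> transitions X \<and> (\<nu>2, ws, \<beta>) \<in> transitions X"
    then show "(\<nu>1, vs, \<nu>2) \<in> transitions X" using comp[of us vs ws \<alpha> \<beta> \<nu>1 \<nu>2] by blast
  qed
  moreover have "CSA2 X"
    unfolding CSA2_def
  proof (intro allI impI)
    fix \<alpha> us vs \<beta>
    assume a: "us \<noteq> [] \<and> vs \<noteq> [] \<and> (\<alpha>, us @ vs, \<beta>) \<in> transitions X"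
    then obtain \<nu> where "(\<alpha>, us, \<nu>) \<in> transitions X \<and> (\<nu>, vs, \<beta>) \<in> transitions X" using ex by blast
    then show "\<exists>!\<nu>. \<nu> \<in> states X \<and> (\<alpha>, us, \<nu>) \<in> transitions X \<and> (\<nu>, vs, \<beta>) \<in> transitions X"
      using a unique[of us vs \<alpha> \<beta>] trans by (intro ex1I[of _ \<nu>]) blast+
  qed
  ultimately show ?thesis using used unfolding regular_ts_def by blast
qed

lemma ts_mapI:
  assumes "\<And>\<alpha>. \<alpha> \<in> states X \<Longrightarrow> g \<alpha> \<in> states Y" "\<And>u. u \<in> actions X \<Longrightarrow> h u \<in> actions Y"
    "\<And>u. u \<in> actions X \<Longrightarrow> label Y (h u) = label X u"
    "\<And>\<alpha> us \<beta>. (\<alpha>, us, \<beta>) \<in> transitions X \<Longrightarrow> (g \<alpha>, map h us, g \<beta>) \<in> transitions Y"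
  shows "ts_map X Y g h"
  using assms unfolding ts_map_def by auto

lemma ts_mapD:
  assumes "ts_map X Y g h"
  shows "\<alpha> \<in> states X \<Longrightarrow> g \<alpha> \<in> states Y" "u \<in> actions X \<Longrightarrow> h u \<in> actions Y"
    "u \<in> actions X \<Longrightarrow> label Y (h u) = label X u"
    "(\<alpha>, us, \<beta>) \<in> transitions X \<Longrightarrow> (g \<alpha>, map h us, g \<beta>) \<in> transitions Y"
  using assms unfolding ts_map_def by auto

lemma ts_map_comp:
  assumes "ts_map X Y g h" "ts_map Y Z g' h'"
  shows "ts_map X Z (g' \<circ> g) (h' \<circ> h)"
proof (rule ts_mapI)
  fix \<alpha> us \<beta> assume "(\<alpha>, us, \<beta>) \<in> transitions X"
  then show "((g' \<circ> g) \<alpha>, map (h' \<circ> h) us, (g' \<circ> g) \<beta>) \<in> transitions Z"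
    using ts_mapD(4)[OF assms(2) ts_mapD(4)[OF assms(1)]] by simp
qed (use ts_mapD[OF assms(1)] ts_mapD[OF assms(2)] in auto)

lemma ts_map_cong:
  assumes X: "weak_ts X" and f: "ts_map X Y g h"
    and g: "\<And>\<alpha>. \<alpha> \<in> states X \<Longrightarrow> g' \<alpha> = g \<alpha>" and h: "\<And>u. u \<in> actions X \<Longrightarrow> h' u = h u"
  shows "ts_map X Y g' h'"
proof (rule ts_mapI)
  fix \<alpha> us \<beta> assume t: "(\<alpha>, us, \<beta>) \<in> transitions X"
  have "map h' us = map h us" using weak_ts_trans(3)[OF X t] h by (intro map_cong) auto
  then show "(g' \<alpha>, map h' us, g' \<beta>) \<in> transitions Y"
    unfolding \<open>map h' us = map h us\<close> using ts_mapD(4)[OF f t] weak_ts_trans(1,4)[OF X t] g by simp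
qed (use ts_mapD[OF f] g h in auto)

section \<open>The category RTS and its arrows\<close>

lemma RTS_simps [simp]:
  "Ob RTS = RTS_ob" "Ar RTS = RTS_ar" "Dom RTS = src" "Cod RTS = tgt"
  by (simp_all add: RTS_def)

lemma RTS_ob_weak: "X \<in> RTS_ob \<Longrightarrow> weak_ts X"
  and RTS_ob_CSA2: "X \<in> RTS_ob \<Longrightarrow> CSA2 X"
  and RTS_ob_regular: "X \<in> RTS_ob \<Longrightarrow> regular_ts X"
  and RTS_ob_small: "X \<in> RTS_ob \<Longrightarrow> states X \<prec> (UNIV :: 'u set)" "X \<in> RTS_ob \<Longrightarrow>
    actions X \<prec> (UNIV :: 'u set)"
  for X :: "('u, 'u, 'l) ts"
  by (auto simp: RTS_ob_def regular_ts_def)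

lemmas RTS_trans = weak_ts_trans[OF RTS_ob_weak]
  and RTS_perm = weak_ts_perm[OF RTS_ob_weak]
  and RTS_compose = weak_ts_compose[OF RTS_ob_weak]
  and RTS_split = CSA2_ex[OF RTS_ob_CSA2]
  and RTS_split_unique = CSA2_unique[OF RTS_ob_CSA2 RTS_ob_weak]

lemma RTS_used:
  assumes "X \<in> RTS_ob" "u \<in> actions X"
  obtains \<alpha> \<beta> where "(\<alpha>, [u], \<beta>) \<in> transitions X" "\<alpha> \<in> states X" "\<beta> \<in> states X"
  using assms RTS_trans[OF assms(1)] unfolding RTS_ob_def regular_ts_def by blast

lemma hom_RTS:
  "f \<in> hom RTS X Y \<longleftrightarrow> src f = X \<and> tgt f = Y \<and> X \<in> RTS_ob \<and> Y \<in> RTS_ob \<and>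
    ts_map X Y (on_states f) (on_actions f) \<and>
    on_states f \<in> extensional (states X) \<and> on_actions f \<in> extensional (actions X)"
  unfolding hom_def by (auto simp: RTS_ar_def)

lemma hom_RTSD:
  assumes "f \<in> hom RTS X Y"
  shows "src f = X" "tgt f = Y" "X \<in> RTS_ob" "Y \<in> RTS_ob"
    "ts_map X Y (on_states f) (on_actions f)"
    "\<alpha> \<in> states X \<Longrightarrow> on_states f \<alpha> \<in> states Y" "u \<in> actions X \<Longrightarrow> on_actions f u \<in> actions Y"
    "u \<in> actions X \<Longrightarrow> label Y (on_actions f u) = label X u"
    "(\<alpha>, us, \<beta>) \<in> transitions X \<Longrightarrow>
      (on_states f \<alpha>, map (on_actions f) us, on_states f \<beta>) \<in> transitions Y"
  using assms ts_mapD[of X Y "on_states f" "on_actions f"] unfolding hom_RTS by auto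

lemma hom_RTS_eqI:
  assumes "f \<in> hom RTS X Y" "g \<in> hom RTS X Y"
    and "\<And>\<alpha>. \<alpha> \<in> states X \<Longrightarrow> on_states f \<alpha> = on_states g \<alpha>"
    and "\<And>u. u \<in> actions X \<Longrightarrow> on_actions f u = on_actions g u"
  shows "f = g"
proof (rule ts_arrow.equality)
  show "on_states f = on_states g" "on_actions f = on_actions g"
    using assms unfolding hom_RTS by (auto intro: extensionalityI)
qed (use assms(1,2) in \<open>auto simp: hom_RTS\<close>)

lemma RTS_Comp_simps [simp]:
  "src (Comp RTS g f) = src f" "tgt (Comp RTS g f) = tgt g"
  "\<alpha> \<in> states (src f) \<Longrightarrow> on_states (Comp RTS g f) \<alpha> = on_states g (on_states f \<alpha>)"
  "u \<in> actions (src f) \<Longrightarrow> on_actions (Comp RTS g f) u = on_actions g (on_actions f u)"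
  by (simp_all add: RTS_def compose_def)

lemma RTS_Id_simps [simp]:
  "src (Id RTS X) = X" "tgt (Id RTS X) = X"
  "\<alpha> \<in> states X \<Longrightarrow> on_states (Id RTS X) \<alpha> = \<alpha>"
  "u \<in> actions X \<Longrightarrow> on_actions (Id RTS X) u = u"
  by (simp_all add: RTS_def)

text \<open>Restricting the components makes the arrow extensional, so that any pair of total
  functions that is a map on the carriers can be used.\<close>

definition arr ::
  "('u, 'u, 'l) ts \<Rightarrow> ('u, 'u, 'l) ts \<Rightarrow> ('u \<Rightarrow> 'u) \<Rightarrow> ('u \<Rightarrow> 'u) \<Rightarrow> ('u, 'l) ts_arrow" where
  "arr X Y g h = \<lparr>src = X, tgt = Y, on_states = restrict g (states X),
    on_actions = restrict h (actions X)\<rparr>"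

lemma arr_simps [simp]:
  "src (arr X Y g h) = X" "tgt (arr X Y g h) = Y"
  "\<alpha> \<in> states X \<Longrightarrow> on_states (arr X Y g h) \<alpha> = g \<alpha>"
  "u \<in> actions X \<Longrightarrow> on_actions (arr X Y g h) u = h u"
  by (simp_all add: arr_def)

lemma arr_in_hom [intro]:
  assumes "X \<in> RTS_ob" "Y \<in> RTS_ob" "ts_map X Y g h"
  shows "arr X Y g h \<in> hom RTS X Y"
proof -
  have "ts_map X Y (restrict g (states X)) (restrict h (actions X))"
    by (rule ts_map_cong[OF RTS_ob_weak[OF assms(1)] assms(3)]) auto
  then show ?thesis using assms by (simp add: hom_RTS arr_def)
qed

lemma RTS_Id_in_hom: "X \<in> RTS_ob \<Longrightarrow> Id RTS X \<in> hom RTS X X"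
proof -
  assume X: "X \<in> RTS_ob"
  have "ts_map X X (\<lambda>x. x) (\<lambda>x. x)" by (rule ts_mapI) auto
  then show "Id RTS X \<in> hom RTS X X"
    using arr_in_hom[of X X "\<lambda>x. x" "\<lambda>x. x"] X by (simp add: arr_def RTS_def)
qed

lemma RTS_Comp_in_hom:
  assumes f: "f \<in> hom RTS X Y" and g: "g \<in> hom RTS Y Z"
  shows "Comp RTS g f \<in> hom RTS X Z"
proof -
  have "Comp RTS g f = arr X Z (on_states g \<circ> on_states f) (on_actions g \<circ> on_actions f)"
    using hom_RTSD(1)[OF f] hom_RTSD(2)[OF g]
    by (simp add: arr_def RTS_def compose_def restrict_def o_def)
  then show ?thesis
    using arr_in_hom[OF _ _ ts_map_comp[OF hom_RTSD(5)[OF f] hom_RTSD(5)[OF g]]]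
      hom_RTSD(3)[OF f] hom_RTSD(4)[OF g] by simp
qed

interpretation RTS: category RTS
proof
  fix f g h :: "('u, 'l) ts_arrow" and a b c d
  assume f: "f \<in> hom RTS a b" and g: "g \<in> hom RTS b c" and h: "h \<in> hom RTS c d"
  show "Comp RTS (Comp RTS h g) f = Comp RTS h (Comp RTS g f)"
    by (rule hom_RTS_eqI[OF RTS_Comp_in_hom[OF f RTS_Comp_in_hom[OF g h]]
          RTS_Comp_in_hom[OF RTS_Comp_in_hom[OF f g] h]])
      (use hom_RTSD[OF f] hom_RTSD[OF g] in auto)
next
  fix f :: "('u, 'l) ts_arrow" and a b assume f: "f \<in> hom RTS a b"
  show "Comp RTS (Id RTS b) f = f"
    by (rule hom_RTS_eqI[OF RTS_Comp_in_hom[OF f RTS_Id_in_hom] f])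
      (use hom_RTSD[OF f] in auto)
  show "Comp RTS f (Id RTS a) = f"
    by (rule hom_RTS_eqI[OF RTS_Comp_in_hom[OF RTS_Id_in_hom f] f])
      (use hom_RTSD[OF f] in auto)
qed (auto simp: RTS_ar_def intro: RTS_Id_in_hom RTS_Comp_in_hom)

subsection \<open>Smallness\<close>

text \<open>Numbered copies of the states or actions of a system have to live in the same type
  \<open>'u\<close>. The choice is an injection because \<open>'u\<close> is infinite, see
  \<open>inj_tag\<close>.\<close>

definition tag :: "'u \<times> nat \<Rightarrow> 'u" where
  "tag = (SOME e. inj e)"

definition untag :: "'u \<Rightarrow> 'u \<times> nat" where
  "untag = inv tag"

definition label_code :: "'l \<Rightarrow> 'u" where
  "label_code = (SOME e. inj e)"

text \<open>The labels form a set of the universe: some auxiliary systems, such as the terminal one,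
  have an action for each label.\<close>

locale small_labels =
  fixes U :: "'u itself" and La :: "'l itself"
  assumes universe: "universe TYPE('u)"
    and labels_small: "(UNIV :: 'l set) \<prec> (UNIV :: 'u set)"
begin

lemma infinite_UNIV: "infinite (UNIV :: 'u set)"
  using universe[unfolded universe_def] by (metis uncountable_infinite)

lemma small_finite: "finite A \<Longrightarrow> A \<prec> (UNIV :: 'u set)"
  using finite_lesspoll_infinite infinite_UNIV by blast

lemma small_image: "A \<prec> (UNIV :: 'u set) \<Longrightarrow> f ` A \<prec> (UNIV :: 'u set)"
  using image_lepoll lesspoll_trans1 by blast

lemma small_subset: "A \<subseteq> B \<Longrightarrow> B \<prec> (UNIV :: 'u set) \<Longrightarrow> A \<prec> (UNIV :: 'u set)"
  using subset_imp_lepoll lesspoll_trans1 by blast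

lemma small_Union:
  fixes F :: "'u set set"
  assumes "F \<prec> (UNIV :: 'u set)" "\<forall>A\<in>F. A \<prec> (UNIV :: 'u set)"
  shows "\<Union>F \<prec> (UNIV :: 'u set)"
proof -
  have "\<forall>F :: 'u set set. F \<prec> (UNIV :: 'u set) \<and> (\<forall>A\<in>F. A \<prec> (UNIV :: 'u set)) \<longrightarrow>
    \<Union>F \<prec> (UNIV :: 'u set)"
    using universe unfolding universe_def by (elim conjE)
  from this[rule_format, of F] show ?thesis using assms by simp
qed

lemma small_UN:
  fixes A :: "'i \<Rightarrow> 'u set"
  assumes "finite I" "\<And>i. i \<in> I \<Longrightarrow> A i \<prec> (UNIV :: 'u set)"
  shows "(\<Union>i\<in>I. A i) \<prec> (UNIV :: 'u set)"
proof -
  have "A ` I \<prec> (UNIV :: 'u set)"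
    by (rule finite_lesspoll_infinite[OF infinite_UNIV finite_imageI[OF assms(1)]])
  moreover have "\<forall>B\<in>A ` I. B \<prec> (UNIV :: 'u set)" using assms(2) by blast
  ultimately show ?thesis by (rule small_Union)
qed

text \<open>An infinite set is equipotent to its product with the naturals.\<close>

lemma inj_tag: "inj (tag :: 'u \<times> nat \<Rightarrow> 'u)"
proof -
  have "(UNIV :: ('u \<times> nat) set) \<lesssim> (UNIV :: 'u set)"
  proof -
    have "ordLeq3 (card_of (UNIV :: nat set)) (card_of (UNIV :: 'u set))"
      using infinite_UNIV infinite_iff_card_of_nat by blast
    then have "ordIso2 (card_of ((UNIV :: 'u set) \<times> (UNIV :: nat set))) (card_of (UNIV :: 'u set))"
      using card_of_Times_infinite[OF infinite_UNIV] by blast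
    then have "(UNIV :: 'u set) \<times> (UNIV :: nat set) \<approx> (UNIV :: 'u set)"
      unfolding eqpoll_iff_card_of_ordIso .
    then show ?thesis using eqpoll_imp_lepoll by (simp add: UNIV_Times_UNIV[symmetric] del:
      UNIV_Times_UNIV)
  qed
  then have "\<exists>e :: 'u \<times> nat \<Rightarrow> 'u. inj e" unfolding lepoll_def by blast
  then show ?thesis unfolding tag_def by (rule someI_ex)
qed

lemma untag_tag [simp]: "untag (tag p :: 'u) = p"
  unfolding untag_def using inj_tag by simp

lemma tag_eq_iff [simp]: "(tag p :: 'u) = tag q \<longleftrightarrow> p = q"
  using inj_tag by (auto dest: injD)

lemma small_tag:
  fixes A :: "'u set"
  assumes A: "A \<prec> (UNIV :: 'u set)" and N: "finite (N :: nat set)"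
  shows "tag ` (A \<times> N) \<prec> (UNIV :: 'u set)"
proof -
  have "tag ` (A \<times> N) = (\<Union>i\<in>N. (\<lambda>a. tag (a, i)) ` A)" by auto
  then show ?thesis using small_UN[OF N, of "\<lambda>i. (\<lambda>a. tag (a, i)) ` A"] small_image[OF A] by metis
qed

lemma inj_label_code: "inj (label_code :: 'l \<Rightarrow> 'u)"
proof -
  have "\<exists>e :: 'l \<Rightarrow> 'u. inj e"
    using lesspoll_imp_lepoll[OF labels_small] unfolding lepoll_def by blast
  then show ?thesis unfolding label_code_def by (rule someI_ex)
qed

lemma small_label_code: "range (label_code :: 'l \<Rightarrow> 'u) \<prec> (UNIV :: 'u set)"
  using labels_small image_lepoll lesspoll_trans1 by blast

lemma inv_label_code [simp]: "inv label_code (label_code x :: 'u) = (x :: 'l)"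
  using inj_label_code by simp

lemma small_Un:
  fixes A B :: "'u set"
  assumes "A \<prec> (UNIV :: 'u set)" "B \<prec> (UNIV :: 'u set)"
  shows "A \<union> B \<prec> (UNIV :: 'u set)"
proof -
  have "(\<Union>b\<in>{True, False}. if b then A else B) \<prec> (UNIV :: 'u set)"
    by (rule small_UN) (use assms in auto)
  then show ?thesis by (simp add: Un_commute)
qed

lemma small_insert: "A \<prec> (UNIV :: 'u set) \<Longrightarrow> insert a A \<prec> (UNIV :: 'u set)" for A :: "'u set"
  using small_Un[of "{a}" A] small_finite[of "{a}"] by simp

lemma fresh: "A \<prec> (UNIV :: 'u set) \<Longrightarrow> \<exists>a. a \<notin> (A :: 'u set)"
  by (metis UNIV_eq_I lesspoll_not_refl)

end

subsection \<open>Pulling back along maps of actions\<close>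

text \<open>Base change along a map of actions. If \<open>\<pi>\<close> is onto, the projection to
  \<open>X\<close> is a trivial fibration (\<open>trivfib_pull\<close>), and up to renaming states
  every trivial fibration is of this form; if \<open>\<pi>\<close> is an inclusion, the result is
  the subsystem on the actions in \<open>B\<close>.\<close>

definition pull :: "('s, 'a, 'l) ts \<Rightarrow> 'b set \<Rightarrow> ('b \<Rightarrow> 'a) \<Rightarrow> ('s, 'b, 'l) ts" where
  "pull X B \<pi> = \<lparr>states = states X, actions = B, label = (\<lambda>b \<in> B. label X (\<pi> b)),
     transitions = {(\<alpha>, us, \<beta>). set us \<subseteq> B \<and> (\<alpha>, map \<pi> us, \<beta>) \<in> transitions X}\<rparr>"

lemma pull_simps [simp]:
  "states (pull X B \<pi>) = states X" "actions (pull X B \<pi>) = B"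
  "label (pull X B \<pi>) = (\<lambda>b \<in> B. label X (\<pi> b))"
  "(\<alpha>, us, \<beta>) \<in> transitions (pull X B \<pi>) \<longleftrightarrow> set us \<subseteq> B \<and> (\<alpha>, map \<pi> us, \<beta>) \<in> transitions X"
  by (simp_all add: pull_def)

lemma regular_pull:
  assumes X: "regular_ts X" and \<pi>: "\<pi> ` B \<subseteq> actions X"
  shows "regular_ts (pull X B \<pi>)"
proof -
  have wk: "weak_ts X" and csa: "CSA2 X" using X unfolding regular_ts_def by auto
  note tr = weak_ts_trans[OF wk]
  show ?thesis
  proof (rule regular_tsI)
    fix \<alpha> us \<beta> assume "(\<alpha>, us, \<beta>) \<in> transitions (pull X B \<pi>)"
    then show "\<alpha> \<in> states (pull X B \<pi>) \<and> us \<noteq> [] \<and> set us \<subseteq> actions (pull X B \<pi>) \<and>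
      \<beta> \<in> states (pull X B \<pi>)"
      using tr[of \<alpha> "map \<pi> us" \<beta>] by auto
  next
    fix \<alpha> us \<beta> vs assume "(\<alpha>, us, \<beta>) \<in> transitions (pull X B \<pi>)" and m: "mset vs = mset us"
    then have "set us \<subseteq> B" "(\<alpha>, map \<pi> us, \<beta>) \<in> transitions X" by auto
    then show "(\<alpha>, vs, \<beta>) \<in> transitions (pull X B \<pi>)"
      using weak_ts_perm[OF wk, of \<alpha> "map \<pi> us" \<beta> "map \<pi> vs"] m mset_eq_setD[OF m] by simp
  next
    fix \<alpha> \<beta> \<nu>1 \<nu>2 us vs ws
    assume "us \<noteq> []" "vs \<noteq> []" "ws \<noteq> []" "(\<alpha>, us @ vs @ ws, \<beta>) \<in> transitions (pull X B \<pi>)"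
      "(\<alpha>, us, \<nu>1) \<in> transitions (pull X B \<pi>)" "(\<nu>1, vs @ ws, \<beta>) \<in> transitions (pull X B \<pi>)"
      "(\<alpha>, us @ vs, \<nu>2) \<in> transitions (pull X B \<pi>)" "(\<nu>2, ws, \<beta>) \<in> transitions (pull X B \<pi>)"
    then show "(\<nu>1, vs, \<nu>2) \<in> transitions (pull X B \<pi>)"
      using weak_ts_compose[OF wk, of "map \<pi> us" "map \<pi> vs" "map \<pi> ws" \<alpha> \<beta> \<nu>1 \<nu>2] by simp
  next
    fix u assume "u \<in> actions (pull X B \<pi>)"
    then have "u \<in> B" "\<pi> u \<in> actions X" using \<pi> by auto
    then show "\<exists>\<alpha> \<beta>. (\<alpha>, [u], \<beta>) \<in> transitions (pull X B \<pi>)"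
      using X unfolding regular_ts_def by auto
  next
    fix \<alpha> us vs \<beta>
    assume "us \<noteq> []" "vs \<noteq> []" and t: "(\<alpha>, us @ vs, \<beta>) \<in> transitions (pull X B \<pi>)"
    then obtain \<nu> where "(\<alpha>, map \<pi> us, \<nu>) \<in> transitions X" "(\<nu>, map \<pi> vs, \<beta>) \<in> transitions X"
      using CSA2_ex[OF csa, of "map \<pi> us" "map \<pi> vs" \<alpha> \<beta>] by (metis map_append map_is_Nil_conv
        pull_simps(4))
    then show "\<exists>\<nu>. (\<alpha>, us, \<nu>) \<in> transitions (pull X B \<pi>) \<and> (\<nu>, vs, \<beta>) \<in> transitions (pull X B \<pi>)"
      using t by auto
  next
    fix \<alpha> us vs \<beta> \<nu> \<nu>'
    assume "us \<noteq> []" "vs \<noteq> []" "(\<alpha>, us @ vs, \<beta>) \<in> transitions (pull X B \<pi>)"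
      "(\<alpha>, us, \<nu>) \<in> transitions (pull X B \<pi>)" "(\<nu>, vs, \<beta>) \<in> transitions (pull X B \<pi>)"
      "(\<alpha>, us, \<nu>') \<in> transitions (pull X B \<pi>)" "(\<nu>', vs, \<beta>) \<in> transitions (pull X B \<pi>)"
    then show "\<nu> = \<nu>'"
      using CSA2_unique[OF csa wk, of "map \<pi> us" "map \<pi> vs" \<alpha> \<beta> \<nu> \<nu>'] by simp
  qed
qed

lemma pull_RTS_ob:
  assumes "X \<in> RTS_ob" "\<pi> ` B \<subseteq> actions X" "B \<prec> (UNIV :: 'u set)"
  shows "pull X B \<pi> \<in> (RTS_ob :: ('u, 'u, 'l) ts set)"
  using assms regular_pull[of X \<pi> B] unfolding RTS_ob_def by auto

lemma pull_proj_in_hom: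
  assumes X: "X \<in> (RTS_ob :: ('u, 'u, 'l) ts set)" and \<pi>: "\<pi> ` B \<subseteq> actions X"
    and B: "B \<prec> (UNIV :: 'u set)"
  shows "arr (pull X B \<pi>) X id \<pi> \<in> hom RTS (pull X B \<pi>) X"
  by (rule arr_in_hom[OF pull_RTS_ob[OF X \<pi> B] X], rule ts_mapI) (use \<pi> in auto)

subsection \<open>Trivial fibrations and descent\<close>

text \<open>The explicit form of the maps with the right lifting property with respect to the
  generating cofibrations, as \<open>rlp_gen_cofibrations\<close> shows.\<close>

definition trivfib :: "('u, 'l) ts_arrow \<Rightarrow> bool" where
  "trivfib p \<longleftrightarrow> p \<in> RTS_ar \<and> bij_betw (on_states p) (states (src p)) (states (tgt p)) \<and>
     on_actions p ` actions (src p) = actions (tgt p) \<and>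
     (\<forall>\<alpha> us \<beta>. \<alpha> \<in> states (src p) \<and> set us \<subseteq> actions (src p) \<and> \<beta> \<in> states (src p) \<and>
        (on_states p \<alpha>, map (on_actions p) us, on_states p \<beta>) \<in> transitions (tgt p) \<longrightarrow>
        (\<alpha>, us, \<beta>) \<in> transitions (src p))"

lemma trivfibD:
  assumes "trivfib p" "p \<in> hom RTS X Y"
  shows "bij_betw (on_states p) (states X) (states Y)" "on_actions p ` actions X = actions Y"
    "\<alpha> \<in> states X \<Longrightarrow> set us \<subseteq> actions X \<Longrightarrow> \<beta> \<in> states X \<Longrightarrow>
      (on_states p \<alpha>, map (on_actions p) us, on_states p \<beta>) \<in> transitions Y \<Longrightarrow>
      (\<alpha>, us, \<beta>) \<in> transitions X"
  using assms hom_RTSD(1,2)[OF assms(2)] unfolding trivfib_def by auto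

lemma trivfibI:
  assumes "p \<in> hom RTS X Y" "bij_betw (on_states p) (states X) (states Y)"
    "on_actions p ` actions X = actions Y"
    "\<And>\<alpha> us \<beta>. \<alpha> \<in> states X \<Longrightarrow> set us \<subseteq> actions X \<Longrightarrow> \<beta> \<in> states X \<Longrightarrow>
      (on_states p \<alpha>, map (on_actions p) us, on_states p \<beta>) \<in> transitions Y \<Longrightarrow>
      (\<alpha>, us, \<beta>) \<in> transitions X"
  shows "trivfib p"
  using assms hom_RTSD(1,2)[OF assms(1)] hom_Ar[OF assms(1)] unfolding trivfib_def by auto

lemma trivfib_pull:
  assumes X: "X \<in> (RTS_ob :: ('u, 'u, 'l) ts set)" and \<pi>: "\<pi> ` B = actions X"
    and B: "B \<prec> (UNIV :: 'u set)"
  shows "trivfib (arr (pull X B \<pi>) X id \<pi>)"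
proof (rule trivfibI[OF pull_proj_in_hom[OF X _ B]])
  fix \<alpha> us \<beta> assume us: "set us \<subseteq> actions (pull X B \<pi>)"
    and "\<alpha> \<in> states (pull X B \<pi>)" "\<beta> \<in> states (pull X B \<pi>)"
    and "(on_states (arr (pull X B \<pi>) X id \<pi>) \<alpha>, map (on_actions (arr (pull X B \<pi>) X id \<pi>)) us,
      on_states (arr (pull X B \<pi>) X id \<pi>) \<beta>) \<in> transitions X"
  moreover have "map (on_actions (arr (pull X B \<pi>) X id \<pi>)) us = map \<pi> us"
    using us by (intro map_cong) auto
  ultimately show "(\<alpha>, us, \<beta>) \<in> transitions (pull X B \<pi>)" by simp
qed (use \<pi> in \<open>auto simp: bij_betw_def inj_on_def\<close>)

lemma trivfib_Id:
  assumes "X \<in> RTS_ob" shows "trivfib (Id RTS X)"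
proof (rule trivfibI[OF RTS_Id_in_hom[OF assms]])
  fix \<alpha> us \<beta> assume us: "set us \<subseteq> actions X" and "\<alpha> \<in> states X" "\<beta> \<in> states X"
    and "(on_states (Id RTS X) \<alpha>, map (on_actions (Id RTS X)) us, on_states (Id RTS X) \<beta>) \<in>
      transitions X"
  moreover have "map (on_actions (Id RTS X)) us = us"
    using us by (intro map_idI) auto
  ultimately show "(\<alpha>, us, \<beta>) \<in> transitions X" by simp
qed (auto simp: bij_betw_def inj_on_def)

text \<open>Among the arrows of RTS these are the cofibrations, see
  \<open>cofibrations\<close>.\<close>

definition action_inj :: "('u, 'l) ts_arrow \<Rightarrow> bool" where
  "action_inj i \<longleftrightarrow> inj_on (on_actions i) (actions (src i))"

text \<open>The lift is forced on states, where \<open>p\<close> is bijective, and on the actions in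
  the image of \<open>i\<close>, where injectivity makes it well defined; on the other actions any
  preimage under \<open>p\<close> will do, since \<open>p\<close> reflects transitions.\<close>

lemma lifts_action_inj_trivfib:
  assumes i: "i \<in> RTS_ar" and inj: "action_inj i" and p: "trivfib p"
  shows "lifts RTS i p"
  unfolding lifts_def RTS_simps
proof (intro ballI impI)
  fix a b assume a: "a \<in> hom RTS (src i) (src p)" and b: "b \<in> hom RTS (tgt i) (tgt p)"
    and eq: "Comp RTS p a = Comp RTS b i"
  have ih: "i \<in> hom RTS (src i) (tgt i)" and ph: "p \<in> hom RTS (src p) (tgt p)"
    using i p by (auto simp: hom_def trivfib_def)
  have eqs: "on_states p (on_states a \<alpha>) = on_states b (on_states i \<alpha>)" if "\<alpha> \<in> states (src i)"
    for \<alpha>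
    using arg_cong[OF eq, of "\<lambda>k. on_states k \<alpha>"] that hom_RTSD(1)[OF a] by simp
  have eqa: "on_actions p (on_actions a u) = on_actions b (on_actions i u)" if "u \<in> actions (src i)"
    for u
    using arg_cong[OF eq, of "\<lambda>k. on_actions k u"] that hom_RTSD(1)[OF a] by simp
  note tp = trivfibD[OF p ph]
  define g where "g \<beta> = inv_into (states (src p)) (on_states p) (on_states b \<beta>)" for \<beta>
  define h where "h v = (if v \<in> on_actions i ` actions (src i)
    then on_actions a (inv_into (actions (src i)) (on_actions i) v)
    else inv_into (actions (src p)) (on_actions p) (on_actions b v))" for v
  have hi: "h (on_actions i u) = on_actions a u" if "u \<in> actions (src i)" for u
    using that inj unfolding h_def action_inj_def by simp
  have ims: "on_states b \<beta> \<in> on_states p ` states (src p)" if "\<beta> \<in> states (tgt i)" for \<beta>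
    using tp(1) hom_RTSD(6)[OF b that] unfolding bij_betw_def by simp
  have g: "g \<beta> \<in> states (src p)" "on_states p (g \<beta>) = on_states b \<beta>" if "\<beta> \<in> states (tgt i)" for \<beta>
    using ims[OF that] inv_into_into[OF ims[OF that]] f_inv_into_f[OF ims[OF that]]
    unfolding g_def by auto
  have ima: "on_actions b v \<in> on_actions p ` actions (src p)" if "v \<in> actions (tgt i)" for v
    using tp(2) hom_RTSD(7)[OF b that] by simp
  have h: "h v \<in> actions (src p) \<and> on_actions p (h v) = on_actions b v" if "v \<in> actions (tgt i)"
    for v
  proof (cases "v \<in> on_actions i ` actions (src i)")
    case True
    then obtain u where "u \<in> actions (src i)" "v = on_actions i u" by blast
    then show ?thesis using hi eqa hom_RTSD(7)[OF a] by simp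
  next
    case False
    then show ?thesis
      using inv_into_into[OF ima[OF that]] f_inv_into_f[OF ima[OF that]] unfolding h_def by simp
  qed
  have "ts_map (tgt i) (src p) g h"
  proof (rule ts_mapI)
    fix u assume u: "u \<in> actions (tgt i)"
    have "label (src p) (h u) = label (tgt p) (on_actions p (h u))"
      using hom_RTSD(8)[OF ph, of "h u"] h[OF u] by simp
    then show "label (src p) (h u) = label (tgt i) u" using hom_RTSD(8)[OF b u] h[OF u] by simp
  next
    fix \<alpha> us \<beta> assume t: "(\<alpha>, us, \<beta>) \<in> transitions (tgt i)"
    note us = RTS_trans[OF hom_RTSD(4)[OF ih] t]
    have eq: "map (on_actions p) (map h us) = map (on_actions b) us"
      using us(3) h by auto
    have "set (map h us) \<subseteq> actions (src p)" using us(3) h by auto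
    then show "(g \<alpha>, map h us, g \<beta>) \<in> transitions (src p)"
      by (rule tp(3)[OF g(1)[OF us(1)] _ g(1)[OF us(4)]])
        (unfold eq g(2)[OF us(1)] g(2)[OF us(4)], rule hom_RTSD(9)[OF b t])
  qed (use g h in auto)
  then have k: "arr (tgt i) (src p) g h \<in> hom RTS (tgt i) (src p)" (is "?k \<in> _")
    using hom_RTSD(4)[OF ih] hom_RTSD(3)[OF ph] by (rule arr_in_hom[rotated 2])
  have "Comp RTS ?k i = a"
  proof (rule hom_RTS_eqI[OF RTS_Comp_in_hom[OF ih k] a])
    fix \<alpha> assume \<alpha>: "\<alpha> \<in> states (src i)"
    have "g (on_states i \<alpha>) = on_states a \<alpha>"
      using g[OF hom_RTSD(6)[OF ih \<alpha>]] eqs[OF \<alpha>] tp(1) hom_RTSD(6)[OF a \<alpha>]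
      unfolding bij_betw_def inj_on_def by metis
    then show "on_states (Comp RTS ?k i) \<alpha> = on_states a \<alpha>"
      using \<alpha> hom_RTSD(6)[OF ih \<alpha>] by simp
  qed (use hi hom_RTSD(7)[OF ih] in auto)
  moreover have "Comp RTS p ?k = b"
    by (rule hom_RTS_eqI[OF RTS_Comp_in_hom[OF k ph] b]) (use g h in auto)
  ultimately show "\<exists>h\<in>hom RTS (tgt i) (src p). Comp RTS h i = a \<and> Comp RTS p h = b" using k by blast
qed

text \<open>A map that lifts against the duplication \<open>pull B (actions B \<times> {0,1}) \<rightarrow> B\<close> cannot
  identify two actions, since their lifts may be chosen in different copies.\<close>

lemma (in small_labels) action_inj_if_lifts:
  fixes i :: "('u, 'l) ts_arrow"
  assumes i: "i \<in> RTS_ar" and l: "\<And>p :: ('u, 'l) ts_arrow. trivfib p \<Longrightarrow> lifts RTS i p"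
  shows "action_inj i"
  unfolding action_inj_def
proof (rule inj_onI, rule ccontr)
  fix u v assume u: "u \<in> actions (src i)" and v: "v \<in> actions (src i)"
    and eq: "on_actions i u = on_actions i v" and ne: "u \<noteq> v"
  have ih: "i \<in> hom RTS (src i) (tgt i)" using i by (simp add: hom_def)
  note ihD = hom_RTSD[OF ih]
  define B where "B = tag ` (actions (tgt i) \<times> {..1})"
  define \<pi> where "\<pi> b = fst (untag b)" for b :: 'u
  have \<pi>: "\<pi> ` B = actions (tgt i)" unfolding B_def \<pi>_def by force
  have B: "B \<prec> (UNIV :: 'u set)" unfolding B_def by (rule small_tag[OF RTS_ob_small(2)[OF ihD(4)]])
    simp
  define P where "P = pull (tgt i) B \<pi>"
  have P: "P \<in> RTS_ob" unfolding P_def by (rule pull_RTS_ob[OF ihD(4) _ B]) (simp add: \<pi>)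
  define p where "p = arr P (tgt i) id \<pi>"
  have p: "trivfib p" unfolding p_def P_def by (rule trivfib_pull[OF ihD(4) \<pi> B])
  have ph: "p \<in> hom RTS P (tgt i)"
    unfolding p_def P_def by (rule pull_proj_in_hom[OF ihD(4) _ B]) (simp add: \<pi>)
  define h where "h w = (tag (on_actions i w, if w = u then 1 else 0) :: 'u)" for w
  have h: "h w \<in> B" "\<pi> (h w) = on_actions i w" if "w \<in> actions (src i)" for w
    using ihD(7)[OF that] unfolding h_def B_def \<pi>_def by auto
  have "ts_map (src i) P (on_states i) h"
  proof (rule ts_mapI)
    fix \<alpha> us \<beta> assume t: "(\<alpha>, us, \<beta>) \<in> transitions (src i)"
    note us = RTS_trans(3)[OF ihD(3) t]
    have eq: "map \<pi> (map h us) = map (on_actions i) us" using us h by auto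
    show "(on_states i \<alpha>, map h us, on_states i \<beta>) \<in> transitions P"
      unfolding P_def pull_simps eq using ihD(9)[OF t] us h(1) by auto
  qed (use ihD h in \<open>auto simp: P_def\<close>)
  then have a: "arr (src i) P (on_states i) h \<in> hom RTS (src i) P" (is "?a \<in> _")
    using ihD(3) P by (rule arr_in_hom[rotated 2])
  have "Comp RTS p ?a = Comp RTS (Id RTS (tgt i)) i"
    by (rule hom_RTS_eqI[OF RTS_Comp_in_hom[OF a ph] RTS_Comp_in_hom[OF ih RTS_Id_in_hom[OF
      ihD(4)]]])
      (use ihD h in \<open>auto simp: p_def P_def\<close>)
  then obtain k where "Comp RTS k i = ?a"
    using l[OF p] a RTS_Id_in_hom[OF ihD(4)] unfolding lifts_def by (auto simp: p_def)
  then have "on_actions k (on_actions i w) = h w" if "w \<in> actions (src i)" for w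
    using RTS_Comp_simps(4)[of w i k] that by simp
  from this[OF u] this[OF v] show False using eq ne unfolding h_def by simp
qed

text \<open>The common feature of trivial fibrations and of the maps p_x: up to a bijection of
  states, the target arises from the source by identifying actions, and all its transitions are
  images.\<close>

definition descent_map :: "('u, 'l) ts_arrow \<Rightarrow> bool" where
  "descent_map s \<longleftrightarrow> s \<in> RTS_ar \<and> bij_betw (on_states s) (states (src s)) (states (tgt s)) \<and>
     on_actions s ` actions (src s) = actions (tgt s) \<and>
     (\<forall>(\<alpha>', us', \<beta>') \<in> transitions (tgt s). \<exists>(\<alpha>, us, \<beta>) \<in> transitions (src s).
        \<alpha>' = on_states s \<alpha> \<and> us' = map (on_actions s) us \<and> \<beta>' = on_states s \<beta>)"

text \<open>The factorization is well defined on actions because \<open>g\<close> respects the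
  identifications made by \<open>s\<close>, and it preserves transitions because each transition of
  \<open>B\<close> comes from one of \<open>A\<close>.\<close>

lemma descent_map_ex1:
  assumes s: "descent_map s" and sh: "s \<in> hom RTS A B" and g: "g \<in> hom RTS A Z"
    and id: "\<And>u v. u \<in> actions A \<Longrightarrow> v \<in> actions A \<Longrightarrow> on_actions s u = on_actions s v \<Longrightarrow>
      on_actions g u = on_actions g v"
  shows "\<exists>!h. h \<in> hom RTS B Z \<and> Comp RTS h s = g"
proof (rule ex_ex1I)
  note sD = hom_RTSD[OF sh] and gD = hom_RTSD[OF g]
  have bij: "bij_betw (on_states s) (states A) (states B)" and surj: "on_actions s ` actions A =
    actions B"
    using s sD(1,2) unfolding descent_map_def by auto
  define k where "k \<beta> = on_states g (inv_into (states A) (on_states s) \<beta>)" for \<beta>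
  define l where "l v = on_actions g (inv_into (actions A) (on_actions s) v)" for v
  have ks: "k (on_states s \<alpha>) = on_states g \<alpha>" if "\<alpha> \<in> states A" for \<alpha>
    using bij that unfolding k_def bij_betw_def by simp
  have ls: "l (on_actions s u) = on_actions g u" if "u \<in> actions A" for u
  proof -
    have m: "on_actions s u \<in> on_actions s ` actions A" using that by blast
    show ?thesis
      unfolding l_def by (rule id[OF inv_into_into[OF m] that f_inv_into_f[OF m]])
  qed
  have "ts_map B Z k l"
  proof (rule ts_mapI)
    fix \<alpha> assume "\<alpha> \<in> states B"
    then obtain \<beta> where "\<beta> \<in> states A" "\<alpha> = on_states s \<beta>" using bij unfolding bij_betw_def by blast
    then show "k \<alpha> \<in> states Z" using ks gD(6) by simp
  next
    fix v assume "v \<in> actions B"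
    then obtain u where u: "u \<in> actions A" "v = on_actions s u" using surj by blast
    then show "l v \<in> actions Z" using ls gD(7) by simp
    show "label Z (l v) = label B v" using u ls gD(8) sD(8) by simp
  next
    fix \<alpha>' us' \<beta>' assume "(\<alpha>', us', \<beta>') \<in> transitions B"
    then obtain \<alpha> us \<beta> where t: "(\<alpha>, us, \<beta>) \<in> transitions A" "\<alpha>' = on_states s \<alpha>"
      "us' = map (on_actions s) us" "\<beta>' = on_states s \<beta>"
      using s sD(1,2) unfolding descent_map_def by fastforce
    note tr = RTS_trans[OF sD(3) t(1)]
    have eq: "map l us' = map (on_actions g) us" using t(3) tr(3) ls by auto
    show "(k \<alpha>', map l us', k \<beta>') \<in> transitions Z"
      unfolding eq t(2,4) ks[OF tr(1)] ks[OF tr(4)] by (rule gD(9)[OF t(1)])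
  qed
  then have kl: "arr B Z k l \<in> hom RTS B Z" using sD(4) gD(4) by (rule arr_in_hom[rotated 2])
  moreover have "Comp RTS (arr B Z k l) s = g"
    by (rule hom_RTS_eqI[OF RTS_Comp_in_hom[OF sh kl] g]) (use ks ls sD in auto)
  ultimately show "\<exists>h. h \<in> hom RTS B Z \<and> Comp RTS h s = g" by blast
next
  note sD = hom_RTSD[OF sh]
  fix h h' assume h: "h \<in> hom RTS B Z \<and> Comp RTS h s = g" and h': "h' \<in> hom RTS B Z \<and>
    Comp RTS h' s = g"
  have bij: "bij_betw (on_states s) (states A) (states B)" and surj: "on_actions s ` actions A =
    actions B"
    using s sD(1,2) unfolding descent_map_def by auto
  show "h = h'"
  proof (rule hom_RTS_eqI)
    fix \<alpha> assume "\<alpha> \<in> states B"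
    then obtain \<beta> where "\<beta> \<in> states A" "\<alpha> = on_states s \<beta>" using bij unfolding bij_betw_def by blast
    then show "on_states h \<alpha> = on_states h' \<alpha>"
      using h h' sD(1) RTS_Comp_simps(3)[of \<beta> s h] RTS_Comp_simps(3)[of \<beta> s h'] by simp
  next
    fix v assume "v \<in> actions B"
    then obtain u where u: "u \<in> actions A" "v = on_actions s u" using surj by blast
    then show "on_actions h v = on_actions h' v"
      using h h' sD(1) RTS_Comp_simps(4)[of u s h] RTS_Comp_simps(4)[of u s h'] by simp
  qed (use h h' in auto)
qed

lemma trivfib_descent_map:
  assumes p: "trivfib p"
  shows "descent_map p"
proof -
  have ph: "p \<in> hom RTS (src p) (tgt p)" using p by (simp add: hom_def trivfib_def)
  note pD = trivfibD[OF p ph]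
  have "\<exists>(\<alpha>, us, \<beta>) \<in> transitions (src p).
      \<alpha>' = on_states p \<alpha> \<and> us' = map (on_actions p) us \<and> \<beta>' = on_states p \<beta>"
    if t: "(\<alpha>', us', \<beta>') \<in> transitions (tgt p)" for \<alpha>' us' \<beta>'
  proof -
    note tr = RTS_trans[OF hom_RTSD(4)[OF ph] t]
    obtain \<alpha> \<beta> where a: "\<alpha> \<in> states (src p)" "\<alpha>' = on_states p \<alpha>"
      and b: "\<beta> \<in> states (src p)" "\<beta>' = on_states p \<beta>"
      using tr pD(1) unfolding bij_betw_def by blast
    have "us' \<in> lists (on_actions p ` actions (src p))" using tr(3) pD(2) by auto
    then obtain us where us: "us \<in> lists (actions (src p))" "us' = map (on_actions p) us"
      unfolding lists_image by blast
    then have "(\<alpha>, us, \<beta>) \<in> transitions (src p)"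
      using pD(3)[of \<alpha> us \<beta>] a b t by auto
    then show ?thesis using a b us by blast
  qed
  then show ?thesis using p pD unfolding descent_map_def trivfib_def by auto
qed

definition CSA1 :: "('s, 'a, 'l) ts \<Rightarrow> bool" where
  "CSA1 X \<longleftrightarrow> (\<forall>\<alpha> \<beta> u v. (\<alpha>, [u], \<beta>) \<in> transitions X \<and> (\<alpha>, [v], \<beta>) \<in> transitions X \<and>
     label X u = label X v \<longrightarrow> u = v)"

lemma CSA1_if_inj_label:
  assumes "weak_ts Z" "inj_on (label Z) (actions Z)" shows "CSA1 Z"
  unfolding CSA1_def using inj_onD[OF assms(2)] weak_ts_trans(3)[OF assms(1)] by fastforce

text \<open>If \<open>p\<close> identifies two actions \<open>u\<close> and \<open>v\<close>, then a
  1-transition by \<open>u\<close> is also one by \<open>v\<close>, because \<open>p\<close>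
  reflects transitions. Their images under \<open>g\<close> are parallel with equal labels, so CSA1
  identifies them and \<open>g\<close> descends along \<open>p\<close>.\<close>

lemma orth_trivfib_CSA1:
  assumes p: "trivfib p" and Z: "CSA1 Z"
  shows "orth RTS p Z"
  unfolding orth_def
proof
  fix g assume "g \<in> hom RTS (Dom RTS p) Z"
  then have g: "g \<in> hom RTS (src p) Z" by simp
  have ph: "p \<in> hom RTS (src p) (tgt p)" using p by (simp add: hom_def trivfib_def)
  have "\<exists>!h. h \<in> hom RTS (tgt p) Z \<and> Comp RTS h p = g"
  proof (rule descent_map_ex1[OF trivfib_descent_map[OF p] ph g])
    fix u v assume u: "u \<in> actions (src p)" and v: "v \<in> actions (src p)"
      and eq: "on_actions p u = on_actions p v"
    obtain \<alpha> \<beta> where t: "(\<alpha>, [u], \<beta>) \<in> transitions (src p)" "\<alpha> \<in> states (src p)"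
      "\<beta> \<in> states (src p)"
      using RTS_used[OF hom_RTSD(3)[OF g] u] .
    have "(\<alpha>, [v], \<beta>) \<in> transitions (src p)"
      using trivfibD(3)[OF p ph t(2) _ t(3), of "[v]"] v eq hom_RTSD(9)[OF ph t(1)] by simp
    from hom_RTSD(9)[OF g t(1)] hom_RTSD(9)[OF g this]
    show "on_actions g u = on_actions g v"
      using Z hom_RTSD(8)[OF g u] hom_RTSD(8)[OF g v] hom_RTSD(8)[OF ph u] hom_RTSD(8)[OF ph v] eq
      unfolding CSA1_def by simp
  qed
  then show "\<exists>!h. h \<in> hom RTS (Cod RTS p) Z \<and> Comp RTS h p = g" by simp
qed

subsection \<open>Systems with one state\<close>

text \<open>Since all nonempty words are transitions, a map into this system is no more than a
  label-preserving map of actions; \<open>undefined\<close> merely serves as the single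
  state.\<close>

definition one_state :: "'u set \<Rightarrow> ('u \<Rightarrow> 'l) \<Rightarrow> ('u, 'u, 'l) ts" where
  "one_state B lab = \<lparr>states = {undefined}, actions = B, label = restrict lab B,
     transitions = {(undefined, us, undefined) | us. us \<noteq> [] \<and> set us \<subseteq> B}\<rparr>"

lemma (in small_labels) one_state_RTS_ob:
  assumes "B \<prec> (UNIV :: 'u set)"
  shows "one_state B lab \<in> (RTS_ob :: ('u, 'u, 'l) ts set)"
proof -
  have "regular_ts (one_state B lab)"
    by (rule regular_tsI) (auto simp: one_state_def dest: mset_eq_setD)
  then show ?thesis
    using assms small_finite[of "{undefined :: 'u}"] by (simp add: RTS_ob_def one_state_def)
qed

lemma one_state_hom:
  assumes X: "X \<in> RTS_ob" and Y: "one_state B lab \<in> RTS_ob"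
    and h: "\<And>u. u \<in> actions X \<Longrightarrow> h u \<in> B" "\<And>u. u \<in> actions X \<Longrightarrow> lab (h u) = label X u"
  shows "arr X (one_state B lab) (\<lambda>_. undefined) h \<in> hom RTS X (one_state B lab)"
proof (rule arr_in_hom[OF X Y], rule ts_mapI)
  fix \<alpha> us \<beta> assume "(\<alpha>, us, \<beta>) \<in> transitions X"
  from RTS_trans[OF X this] show "(undefined, map h us, undefined) \<in> transitions (one_state B lab)"
    using h(1) by (auto simp: one_state_def)
qed (use h in \<open>auto simp: one_state_def\<close>)

text \<open>A one-state system with one action for each label is terminal: the value of a map at an
  action is forced by its label.\<close>

lemma (in small_labels) ex_terminal: "\<exists>t :: ('u, 'u, 'l) ts. is_terminal RTS t"
proof -
  define T :: "('u, 'u, 'l) ts" where "T = one_state (range (label_code :: 'l \<Rightarrow> 'u)) (inv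
    label_code)"
  have T: "T \<in> RTS_ob" unfolding T_def by (rule one_state_RTS_ob[OF small_label_code])
  have "\<exists>!f. f \<in> hom RTS X T" if X: "X \<in> RTS_ob" for X :: "('u, 'u, 'l) ts"
  proof (rule ex_ex1I)
    show "\<exists>f. f \<in> hom RTS X T"
      using one_state_hom[OF X T[unfolded T_def], of "\<lambda>u. label_code (label X u)"]
      unfolding T_def by auto
  next
    fix f g assume f: "f \<in> hom RTS X T" and g: "g \<in> hom RTS X T"
    show "f = g"
    proof (rule hom_RTS_eqI[OF f g])
      fix \<alpha> assume "\<alpha> \<in> states X"
      from hom_RTSD(6)[OF f this] hom_RTSD(6)[OF g this] show "on_states f \<alpha> = on_states g \<alpha>"
        by (simp add: T_def one_state_def)
    next
      fix u assume u: "u \<in> actions X"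
      from hom_RTSD(7,8)[OF f u] hom_RTSD(7,8)[OF g u] show "on_actions f u = on_actions g u"
        by (auto simp: T_def one_state_def)
    qed
  qed
  then have "is_terminal RTS T" using T unfolding is_terminal_def RTS_simps by blast
  then show ?thesis ..
qed

section \<open>Cubes and the generating cofibrations\<close>

subsection \<open>Copies of finite systems\<close>

text \<open>The counterpart of \<open>pull\<close> for states, used along a bijection to move a
  system to another carrier type.\<close>

definition pull_states :: "('s, 'a, 'l) ts \<Rightarrow> 't set \<Rightarrow> ('t \<Rightarrow> 's) \<Rightarrow> ('t, 'a, 'l) ts" where
  "pull_states X S \<gamma> = \<lparr>states = S, actions = actions X, label = label X,
     transitions = {(\<alpha>, us, \<beta>). \<alpha> \<in> S \<and> \<beta> \<in> S \<and> (\<gamma> \<alpha>, us, \<gamma> \<beta>) \<in> transitions X}\<rparr>"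

lemma pull_states_simps [simp]:
  "states (pull_states X S \<gamma>) = S" "actions (pull_states X S \<gamma>) = actions X"
  "label (pull_states X S \<gamma>) = label X"
  "(\<alpha>, us, \<beta>) \<in> transitions (pull_states X S \<gamma>) \<longleftrightarrow>
    \<alpha> \<in> S \<and> \<beta> \<in> S \<and> (\<gamma> \<alpha>, us, \<gamma> \<beta>) \<in> transitions X"
  by (simp_all add: pull_states_def)

lemma regular_pull_states:
  assumes X: "regular_ts X" and \<gamma>: "bij_betw \<gamma> S (states X)"
  shows "regular_ts (pull_states X S \<gamma>)"
proof -
  have wk: "weak_ts X" and csa: "CSA2 X" using X unfolding regular_ts_def by auto
  note tr = weak_ts_trans[OF wk]
  have inj: "inj_on \<gamma> S" and surj: "\<gamma> ` S = states X" using \<gamma> unfolding bij_betw_def by auto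
  show ?thesis
  proof (rule regular_tsI)
    fix \<alpha> us \<beta> assume "(\<alpha>, us, \<beta>) \<in> transitions (pull_states X S \<gamma>)"
    then show "\<alpha> \<in> states (pull_states X S \<gamma>) \<and> us \<noteq> [] \<and> set us \<subseteq> actions (pull_states X S \<gamma>) \<and>
      \<beta> \<in> states (pull_states X S \<gamma>)"
      using tr[of "\<gamma> \<alpha>" us "\<gamma> \<beta>"] by auto
  next
    fix \<alpha> us \<beta> vs assume "(\<alpha>, us, \<beta>) \<in> transitions (pull_states X S \<gamma>)" and m: "mset vs = mset us"
    then show "(\<alpha>, vs, \<beta>) \<in> transitions (pull_states X S \<gamma>)"
      using weak_ts_perm[OF wk, of "\<gamma> \<alpha>" us "\<gamma> \<beta>" vs] by simp
  next
    fix \<alpha> \<beta> \<nu>1 \<nu>2 us vs ws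
    assume "us \<noteq> []" "vs \<noteq> []" "ws \<noteq> []" "(\<alpha>, us @ vs @ ws, \<beta>) \<in> transitions (pull_states X S \<gamma>)"
      "(\<alpha>, us, \<nu>1) \<in> transitions (pull_states X S \<gamma>)" "(\<nu>1, vs @ ws, \<beta>) \<in> transitions (pull_states X
        S \<gamma>)"
      "(\<alpha>, us @ vs, \<nu>2) \<in> transitions (pull_states X S \<gamma>)" "(\<nu>2, ws, \<beta>) \<in> transitions (pull_states X
        S \<gamma>)"
    then show "(\<nu>1, vs, \<nu>2) \<in> transitions (pull_states X S \<gamma>)"
      using weak_ts_compose[OF wk, of us vs ws "\<gamma> \<alpha>" "\<gamma> \<beta>" "\<gamma> \<nu>1" "\<gamma> \<nu>2"] by simp
  next
    fix u assume "u \<in> actions (pull_states X S \<gamma>)"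
    then obtain \<alpha> \<beta> where t: "(\<alpha>, [u], \<beta>) \<in> transitions X" using X unfolding regular_ts_def by auto
    then obtain \<alpha>' \<beta>' where "\<alpha>' \<in> S" "\<beta>' \<in> S" "\<gamma> \<alpha>' = \<alpha>" "\<gamma> \<beta>' = \<beta>"
      using tr[OF t] surj by (metis imageE)
    then show "\<exists>\<alpha> \<beta>. (\<alpha>, [u], \<beta>) \<in> transitions (pull_states X S \<gamma>)" using t by auto
  next
    fix \<alpha> us vs \<beta>
    assume ne: "us \<noteq> []" "vs \<noteq> []" and t: "(\<alpha>, us @ vs, \<beta>) \<in> transitions (pull_states X S \<gamma>)"
    then have "(\<gamma> \<alpha>, us @ vs, \<gamma> \<beta>) \<in> transitions X" by simp
    from CSA2_ex[OF csa ne this] obtain \<nu> where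
      \<nu>: "\<nu> \<in> states X" "(\<gamma> \<alpha>, us, \<nu>) \<in> transitions X" "(\<nu>, vs, \<gamma> \<beta>) \<in> transitions X" .
    then obtain \<nu>' where "\<nu>' \<in> S" "\<nu> = \<gamma> \<nu>'" using surj by blast
    then show "\<exists>\<nu>. (\<alpha>, us, \<nu>) \<in> transitions (pull_states X S \<gamma>) \<and>
      (\<nu>, vs, \<beta>) \<in> transitions (pull_states X S \<gamma>)"
      using t \<nu> by auto
  next
    fix \<alpha> us vs \<beta> \<nu> \<nu>'
    assume "us \<noteq> []" "vs \<noteq> []" "(\<alpha>, us @ vs, \<beta>) \<in> transitions (pull_states X S \<gamma>)"
      "(\<alpha>, us, \<nu>) \<in> transitions (pull_states X S \<gamma>)" "(\<nu>, vs, \<beta>) \<in> transitions (pull_states X S \<gamma>)"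
      "(\<alpha>, us, \<nu>') \<in> transitions (pull_states X S \<gamma>)" "(\<nu>', vs, \<beta>) \<in> transitions (pull_states X S
        \<gamma>)"
    then show "\<nu> = \<nu>'"
      using CSA2_unique[OF csa wk, of us vs "\<gamma> \<alpha>" "\<gamma> \<beta>" "\<gamma> \<nu>" "\<gamma> \<nu>'"] inj_onD[OF inj, of \<nu> \<nu>']
        by simp
  qed
qed

lemma ts_isoI:
  assumes "ts_map X Y g h" "ts_map Y X g' h'"
    and "\<And>\<alpha>. \<alpha> \<in> states X \<Longrightarrow> g' (g \<alpha>) = \<alpha>" "\<And>u. u \<in> actions X \<Longrightarrow> h' (h u) = u"
    and "\<And>\<beta>. \<beta> \<in> states Y \<Longrightarrow> g (g' \<beta>) = \<beta>" "\<And>v. v \<in> actions Y \<Longrightarrow> h (h' v) = v"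
  shows "ts_iso X Y g h"
  using assms unfolding ts_iso_def by blast

context small_labels
begin

text \<open>A finite carrier of any type injects into the infinite type \<open>'u\<close>; states
  and actions are transported separately.\<close>

lemma ex_copy:
  fixes A :: "('s, 'a, 'l) ts"
  assumes A: "regular_ts A" and fin: "finite (states A)" "finite (actions A)"
  shows "\<exists>A' :: ('u, 'u, 'l) ts. A' \<in> RTS_ob \<and> (\<exists>g h. ts_iso A A' g h)"
proof -
  have wk: "weak_ts A" using A unfolding regular_ts_def by blast
  obtain e :: "'s \<Rightarrow> 'u" where e: "inj_on e (states A)"
    using finite_lepoll_infinite[OF infinite_UNIV fin(1)] unfolding lepoll_def by blast
  obtain d :: "'a \<Rightarrow> 'u" where d: "inj_on d (actions A)"
    using finite_lepoll_infinite[OF infinite_UNIV fin(2)] unfolding lepoll_def by blast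
  define \<gamma> \<pi> where "\<gamma> = inv_into (states A) e" and "\<pi> = inv_into (actions A) d"
  define A1 where "A1 = pull_states A (e ` states A) \<gamma>"
  define A' where "A' = pull A1 (d ` actions A) \<pi>"
  have \<gamma>: "\<gamma> (e \<alpha>) = \<alpha>" if "\<alpha> \<in> states A" for \<alpha> using e that unfolding \<gamma>_def by simp
  have \<pi>: "\<pi> (d u) = u" if "u \<in> actions A" for u using d that unfolding \<pi>_def by simp
  have "regular_ts A1" unfolding A1_def
    by (rule regular_pull_states[OF A]) (auto simp: bij_betw_def \<gamma> inj_on_def image_image)
  then have "regular_ts A'" unfolding A'_def by (rule regular_pull) (auto simp: A1_def \<pi>)
  then have "A' \<in> RTS_ob"
    using fin small_finite unfolding RTS_ob_def by (auto simp: A'_def A1_def)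
  moreover have "ts_iso A A' e d"
  proof (rule ts_isoI)
    show "ts_map A A' e d"
    proof (rule ts_mapI)
      fix \<alpha> us \<beta> assume t: "(\<alpha>, us, \<beta>) \<in> transitions A"
      note tr = weak_ts_trans[OF wk t]
      have "map \<pi> (map d us) = us" using tr(3) \<pi> by (simp add: map_idI subset_iff)
      then show "(e \<alpha>, map d us, e \<beta>) \<in> transitions A'"
        using t tr \<gamma> unfolding A'_def A1_def by auto
    qed (auto simp: A'_def A1_def \<pi>)
    show "ts_map A' A \<gamma> \<pi>"
      by (rule ts_mapI) (auto simp: A'_def A1_def \<pi> \<gamma>)
  qed (auto simp: \<gamma> \<pi> A'_def A1_def)
  ultimately show ?thesis by blast
qed

lemma ex_copies:
  fixes A :: "('s, 'a, 'l) ts" and B :: "('t, 'b, 'l) ts"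
  assumes A: "regular_ts A" "finite (states A)" "finite (actions A)"
    and B: "regular_ts B" "finite (states B)" "finite (actions B)" and gh: "ts_map A B g h"
  obtains f :: "('u, 'l) ts_arrow" where "f \<in> copies A B g h"
proof -
  obtain A' :: "('u, 'u, 'l) ts" and gA hA where A': "A' \<in> RTS_ob" "ts_iso A A' gA hA"
    using ex_copy[OF A] by blast
  obtain B' :: "('u, 'u, 'l) ts" and gB hB where B': "B' \<in> RTS_ob" "ts_iso B B' gB hB"
    using ex_copy[OF B] by blast
  obtain gA' hA' where A'': "ts_map A A' gA hA" "ts_map A' A gA' hA'"
    "\<forall>\<alpha>\<in>states A. gA' (gA \<alpha>) = \<alpha>" "\<forall>u\<in>actions A. hA' (hA u) = u"
    using A'(2) unfolding ts_iso_def by blast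
  have B'': "ts_map B B' gB hB" using B'(2) unfolding ts_iso_def by blast
  define f where "f = arr A' B' (gB \<circ> g \<circ> gA') (hB \<circ> h \<circ> hA')"
  have "f \<in> hom RTS A' B'"
    unfolding f_def using ts_map_comp[OF A''(2) ts_map_comp[OF gh B'']] A'(1) B'(1)
    by (intro arr_in_hom) (auto simp: o_assoc)
  then have "f \<in> copies A B g h"
    unfolding copies_def using A' B' A'' ts_mapD[OF A''(1)] hom_Ar[of f RTS]
    by (auto simp: f_def intro!: exI[of _ gA] exI[of _ hA] exI[of _ gB] exI[of _ hB])
  then show ?thesis by (rule that)
qed

text \<open>Moves extension problems between RTS and the concrete systems \<open>A\<close> and
  \<open>B\<close>, which live in types of their own: the map out of \<open>A\<close> becomes
  \<open>a'\<close>, and an extension of \<open>a'\<close> along \<open>f\<close> yields one along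
  \<open>(g, h)\<close>.\<close>

lemma extend_along_copies:
  fixes A :: "('s, 'a, 'l) ts" and B :: "('t, 'b, 'l) ts" and f :: "('u, 'l) ts_arrow"
  assumes A: "weak_ts A" and B: "weak_ts B" and f: "f \<in> copies A B g h"
    and X: "X \<in> RTS_ob" and a: "ts_map A X a1 a2"
  obtains a' where "a' \<in> hom RTS (src f) X"
    and "\<And>k. k \<in> hom RTS (tgt f) X \<Longrightarrow> Comp RTS k f = a' \<Longrightarrow>
      \<exists>k1 k2. ts_map B X k1 k2 \<and> (\<forall>\<alpha>\<in>states A. k1 (g \<alpha>) = a1 \<alpha>) \<and> (\<forall>u\<in>actions A. k2 (h u) = a2 u)"
proof -
  obtain gA hA gA' hA' gB hB where
    A': "ts_map A (src f) gA hA" "ts_map (src f) A gA' hA'"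
    "\<forall>\<alpha>\<in>states A. gA' (gA \<alpha>) = \<alpha>" "\<forall>u\<in>actions A. hA' (hA u) = u"
    and B': "ts_map B (tgt f) gB hB"
    and eq: "\<forall>\<alpha>\<in>states A. on_states f (gA \<alpha>) = gB (g \<alpha>)"
      "\<forall>u\<in>actions A. on_actions f (hA u) = hB (h u)" and "f \<in> RTS_ar"
    using f unfolding copies_def ts_iso_def by auto
  then have fh: "f \<in> hom RTS (src f) (tgt f)" by (simp add: hom_def)
  define a' where "a' = arr (src f) X (a1 \<circ> gA') (a2 \<circ> hA')"
  show ?thesis
  proof (rule that)
    show "a' \<in> hom RTS (src f) X"
      unfolding a'_def by (rule arr_in_hom[OF hom_RTSD(3)[OF fh] X ts_map_comp[OF A'(2) a]])
    fix k assume k: "k \<in> hom RTS (tgt f) X" "Comp RTS k f = a'"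
    have "on_states k (gB (g \<alpha>)) = a1 \<alpha>" if "\<alpha> \<in> states A" for \<alpha>
      using RTS_Comp_simps(3)[of "gA \<alpha>" f k] ts_mapD(1)[OF A'(1) that] k(2) eq(1) that A'(3)
      by (simp add: a'_def)
    moreover have "on_actions k (hB (h u)) = a2 u" if "u \<in> actions A" for u
      using RTS_Comp_simps(4)[of "hA u" f k] ts_mapD(2)[OF A'(1) that] k(2) eq(2) that A'(4)
      by (simp add: a'_def)
    ultimately show "\<exists>k1 k2. ts_map B X k1 k2 \<and> (\<forall>\<alpha>\<in>states A. k1 (g \<alpha>) = a1 \<alpha>) \<and>
        (\<forall>u\<in>actions A. k2 (h u) = a2 u)"
      using ts_map_comp[OF B' hom_RTSD(5)[OF k(1)]] by (intro exI conjI ballI) auto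
  qed
qed

text \<open>For finite systems the class \<open>copies A B g h\<close> is inhabited by
  \<open>ex_copies\<close>, so lifting against its members yields lifting against
  \<open>(g, h)\<close> itself. All generating cofibrations are tested in this form.\<close>

lemma lift_against_copies:
  fixes A :: "('s, 'a, 'l) ts" and B :: "('t, 'b, 'l) ts" and p :: "('u, 'l) ts_arrow"
  assumes A: "regular_ts A" "finite (states A)" "finite (actions A)"
    and B: "regular_ts B" "finite (states B)" "finite (actions B)" and gh: "ts_map A B g h"
    and p: "p \<in> hom RTS X Y" "\<And>i. i \<in> copies A B g h \<Longrightarrow> lifts RTS i p"
    and a: "ts_map A X a1 a2" and b: "ts_map B Y b1 b2"
    and eq1: "\<And>\<alpha>. \<alpha> \<in> states A \<Longrightarrow> on_states p (a1 \<alpha>) = b1 (g \<alpha>)"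
    and eq2: "\<And>u. u \<in> actions A \<Longrightarrow> on_actions p (a2 u) = b2 (h u)"
  obtains k1 k2 where "ts_map B X k1 k2"
    "\<And>\<alpha>. \<alpha> \<in> states A \<Longrightarrow> k1 (g \<alpha>) = a1 \<alpha>" "\<And>u. u \<in> actions A \<Longrightarrow> k2 (h u) = a2 u"
    "\<And>\<beta>. \<beta> \<in> states B \<Longrightarrow> on_states p (k1 \<beta>) = b1 \<beta>"
    "\<And>v. v \<in> actions B \<Longrightarrow> on_actions p (k2 v) = b2 v"
proof -
  obtain f :: "('u, 'l) ts_arrow" where f: "f \<in> copies A B g h" using ex_copies[OF A B gh] .
  obtain gA hA gA' hA' gB hB gB' hB' where
    A': "ts_map A (src f) gA hA" "ts_map (src f) A gA' hA'"
    "\<forall>\<alpha>\<in>states A. gA' (gA \<alpha>) = \<alpha>" "\<forall>u\<in>actions A. hA' (hA u) = u"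
    "\<forall>\<alpha>\<in>states (src f). gA (gA' \<alpha>) = \<alpha>" "\<forall>u\<in>actions (src f). hA (hA' u) = u"
    and B': "ts_map B (tgt f) gB hB" "ts_map (tgt f) B gB' hB'"
    "\<forall>\<alpha>\<in>states B. gB' (gB \<alpha>) = \<alpha>" "\<forall>u\<in>actions B. hB' (hB u) = u"
    and eq: "\<forall>\<alpha>\<in>states A. on_states f (gA \<alpha>) = gB (g \<alpha>)"
      "\<forall>u\<in>actions A. on_actions f (hA u) = hB (h u)" and "f \<in> RTS_ar"
    using f unfolding copies_def ts_iso_def by auto
  then have fh: "f \<in> hom RTS (src f) (tgt f)" by (simp add: hom_def)
  define a' where "a' = arr (src f) X (a1 \<circ> gA') (a2 \<circ> hA')"
  define b' where "b' = arr (tgt f) Y (b1 \<circ> gB') (b2 \<circ> hB')"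
  have a': "a' \<in> hom RTS (src f) X"
    unfolding a'_def by (rule arr_in_hom[OF hom_RTSD(3)[OF fh] hom_RTSD(3)[OF p(1)] ts_map_comp[OF
      A'(2) a]])
  have b': "b' \<in> hom RTS (tgt f) Y"
    unfolding b'_def by (rule arr_in_hom[OF hom_RTSD(4)[OF fh] hom_RTSD(4)[OF p(1)] ts_map_comp[OF
      B'(2) b]])
  have "Comp RTS p a' = Comp RTS b' f"
  proof (rule hom_RTS_eqI[OF RTS_Comp_in_hom[OF a' p(1)] RTS_Comp_in_hom[OF fh b']])
    fix \<alpha> assume \<alpha>: "\<alpha> \<in> states (src f)"
    define \<alpha>' where "\<alpha>' = gA' \<alpha>"
    have "\<alpha> = gA \<alpha>'" "\<alpha>' \<in> states A" using \<alpha> A' ts_mapD(1)[OF A'(2)] unfolding \<alpha>'_def by auto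
    then show "on_states (Comp RTS p a') \<alpha> = on_states (Comp RTS b' f) \<alpha>"
      using \<alpha> eq1 eq A' B' hom_RTSD(6)[OF fh \<alpha>] ts_mapD(1)[OF gh] hom_RTSD(1)[OF a']
      by (simp add: a'_def b'_def)
  next
    fix u assume u: "u \<in> actions (src f)"
    define u' where "u' = hA' u"
    have "u = hA u'" "u' \<in> actions A" using u A' ts_mapD(2)[OF A'(2)] unfolding u'_def by auto
    then show "on_actions (Comp RTS p a') u = on_actions (Comp RTS b' f) u"
      using u eq2 eq A' B' hom_RTSD(7)[OF fh u] ts_mapD(2)[OF gh] hom_RTSD(1)[OF a']
      by (simp add: a'_def b'_def)
  qed
  then obtain k where k: "k \<in> hom RTS (tgt f) X" "Comp RTS k f = a'" "Comp RTS p k = b'"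
    using p(2)[OF f] a' b' hom_RTSD(1,2)[OF p(1)] unfolding lifts_def by auto
  show ?thesis
  proof (rule that)
    show "ts_map B X (on_states k \<circ> gB) (on_actions k \<circ> hB)"
      by (rule ts_map_comp[OF B'(1) hom_RTSD(5)[OF k(1)]])
    show "(on_states k \<circ> gB) (g \<alpha>) = a1 \<alpha>" if "\<alpha> \<in> states A" for \<alpha>
      using RTS_Comp_simps(3)[of "gA \<alpha>" f k] ts_mapD(1)[OF A'(1) that] k(2) eq(1) that A'(3)
      by (simp add: a'_def)
    show "(on_actions k \<circ> hB) (h u) = a2 u" if "u \<in> actions A" for u
      using RTS_Comp_simps(4)[of "hA u" f k] ts_mapD(2)[OF A'(1) that] k(2) eq(2) that A'(4)
      by (simp add: a'_def)
    show "on_states p ((on_states k \<circ> gB) \<beta>) = b1 \<beta>" if "\<beta> \<in> states B" for \<beta>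
      using RTS_Comp_simps(3)[of "gB \<beta>" k p] ts_mapD(1)[OF B'(1) that] k(3) that B'(3)
        hom_RTSD(1)[OF k(1)] by (simp add: b'_def)
    show "on_actions p ((on_actions k \<circ> hB) v) = b2 v" if "v \<in> actions B" for v
      using RTS_Comp_simps(4)[of "hB v" k p] ts_mapD(2)[OF B'(1) that] k(3) that B'(4)
        hom_RTSD(1)[OF k(1)] by (simp add: b'_def)
  qed
qed

end

subsection \<open>Cubes\<close>

text \<open>Switches the coordinates in \<open>js\<close> from false to true. Compared with the
  definition of the cube, the target is written as a function of the source and \<open>js\<close>,
  from which uniqueness of intermediate states follows at once.\<close>

definition cube_step :: "nat \<Rightarrow> bool list \<Rightarrow> nat list \<Rightarrow> bool list \<Rightarrow> bool" where
  "cube_step n \<epsilon> js \<epsilon>' \<longleftrightarrow> length \<epsilon> = n \<and> length \<epsilon>' = n \<and> js \<noteq> [] \<and> distinct js \<and> set js \<subseteq> {..<n} \<and>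
     (\<forall>i < n. \<epsilon>' ! i \<longleftrightarrow> \<epsilon> ! i \<or> i \<in> set js) \<and> (\<forall>i \<in> set js. \<not> \<epsilon> ! i)"

lemma cube_transitions:
  "(\<epsilon>, us, \<epsilon>') \<in> transitions (cube xs) \<longleftrightarrow>
    us = map (\<lambda>i. (xs ! i, i)) (map snd us) \<and> cube_step (length xs) \<epsilon> (map snd us) \<epsilon>'"
proof
  assume "(\<epsilon>, us, \<epsilon>') \<in> transitions (cube xs)"
  then obtain js where js: "us = map (\<lambda>i. (xs ! i, i)) js" "length \<epsilon> = length xs"
    "length \<epsilon>' = length xs"
    "js \<noteq> []" "distinct js" "\<forall>i < length xs. \<epsilon> ! i \<le> \<epsilon>' ! i" "set js = {i. i < length xs \<and>
      \<epsilon> ! i \<noteq> \<epsilon>' ! i}"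
    unfolding cube_def by auto
  then have "map snd us = js" by (simp add: o_def)
  then show "us = map (\<lambda>i. (xs ! i, i)) (map snd us) \<and> cube_step (length xs) \<epsilon> (map snd us) \<epsilon>'"
    using js by (simp add: cube_step_def) auto
next
  assume a: "us = map (\<lambda>i. (xs ! i, i)) (map snd us) \<and> cube_step (length xs) \<epsilon> (map snd us) \<epsilon>'"
  define js where "js = map snd us"
  have "us = map (\<lambda>i. (xs ! i, i)) js" "cube_step (length xs) \<epsilon> js \<epsilon>'" using a unfolding js_def
    by auto
  then show "(\<epsilon>, us, \<epsilon>') \<in> transitions (cube xs)"
    unfolding cube_def cube_step_def by (auto intro!: exI[of _ js])
qed

lemma cube_step_compose:
  assumes "cube_step n \<epsilon> (is @ js @ ks) \<epsilon>'" "cube_step n \<epsilon> is \<nu>1" "cube_step n \<epsilon> (is @ js) \<nu>2"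
    "js \<noteq> []"
  shows "cube_step n \<nu>1 js \<nu>2"
  using assms unfolding cube_step_def by auto

lemma cube_step_split:
  assumes "cube_step n \<epsilon> (is @ js) \<epsilon>'" "is \<noteq> []" "js \<noteq> []"
  shows "\<exists>\<nu>. cube_step n \<epsilon> is \<nu> \<and> cube_step n \<nu> js \<epsilon>'"
  using assms unfolding cube_step_def
  by (intro exI[of _ "map (\<lambda>i. \<epsilon> ! i \<or> i \<in> set is) [0..<n]"]) (auto simp: subset_iff)

lemma cube_step_unique:
  assumes "cube_step n \<epsilon> is \<nu>" "cube_step n \<epsilon> is \<nu>'"
  shows "\<nu> = \<nu>'"
  using assms unfolding cube_step_def by (intro nth_equalityI) auto

lemma cube_simps [simp]:
  "states (cube xs) = {\<epsilon>. length \<epsilon> = length xs}" "actions (cube xs) = {(xs ! i, i) | i. i < length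
    xs}"
  "label (cube xs) = fst"
  by (simp_all add: cube_def)

text \<open>With m the dimension n this is the cube, with m = n - 1 its boundary. For m = 0, the
  boundary of a 1-cube, the action is dropped because it would occur in no transition.\<close>

lemma regular_truncated_cube:
  assumes T: "transitions X = {(\<epsilon>, us, \<epsilon>') \<in> transitions (cube xs). length us \<le> m}"
    and S: "states X = states (cube xs)" and L: "actions X = (if m = 0 then {} else actions (cube
      xs))"
  shows "regular_ts X"
proof -
  have tr: "(\<epsilon>, us, \<epsilon>') \<in> transitions X \<longleftrightarrow> us = map (\<lambda>i. (xs ! i, i)) (map snd us) \<and>
    cube_step (length xs) \<epsilon> (map snd us) \<epsilon>' \<and> length us \<le> m" for \<epsilon> us \<epsilon>'
    unfolding T mem_Collect_eq prod.case cube_transitions by blast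
  show ?thesis
  proof (rule regular_tsI)
    fix \<alpha> us \<beta> assume t: "(\<alpha>, us, \<beta>) \<in> transitions X"
    then have c: "us = map (\<lambda>i. (xs ! i, i)) (map snd us)" "cube_step (length xs) \<alpha> (map snd us) \<beta>"
      "length us \<le> m"
      unfolding tr by auto
    then have "us \<noteq> []" "set (map snd us) \<subseteq> {..<length xs}" unfolding cube_step_def by auto
    moreover from this have "m \<noteq> 0" using c(3) by auto
    moreover have "set us \<subseteq> actions (cube xs)"
      using calculation(2) by (subst c(1)) (auto simp del: map_map)
    ultimately show "\<alpha> \<in> states X \<and> us \<noteq> [] \<and> set us \<subseteq> actions X \<and> \<beta> \<in> states X"
      using c(2) unfolding S L cube_step_def by auto
  next
    fix \<alpha> us \<beta> vs assume t: "(\<alpha>, us, \<beta>) \<in> transitions X" and m: "mset vs = mset us"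
    have "\<forall>p\<in>set us. p = (xs ! snd p, snd p)" using t unfolding tr
      by (metis (no_types, lifting) in_set_conv_nth length_map nth_map)
    then have "vs = map (\<lambda>i. (xs ! i, i)) (map snd vs)"
      using mset_eq_setD[OF m] by (simp only: map_map o_def) (metis (no_types, lifting) map_idI)
    moreover have "mset (map snd vs) = mset (map snd us)" using m by simp
    then have "set (map snd vs) = set (map snd us)" "distinct (map snd vs) = distinct (map snd us)"
      by (metis mset_eq_setD, metis mset_eq_imp_distinct_iff)
    ultimately show "(\<alpha>, vs, \<beta>) \<in> transitions X"
      using t m mset_eq_length[OF m] unfolding tr cube_step_def by auto
  next
    fix \<alpha> \<beta> \<nu>1 \<nu>2 us vs ws
    assume "us \<noteq> []" "vs \<noteq> []" "ws \<noteq> []" "(\<alpha>, us @ vs @ ws, \<beta>) \<in> transitions X"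
      "(\<alpha>, us, \<nu>1) \<in> transitions X" "(\<nu>1, vs @ ws, \<beta>) \<in> transitions X"
      "(\<alpha>, us @ vs, \<nu>2) \<in> transitions X" "(\<nu>2, ws, \<beta>) \<in> transitions X"
    then show "(\<nu>1, vs, \<nu>2) \<in> transitions X"
      using cube_step_compose[of "length xs" \<alpha> "map snd us" "map snd vs" "map snd ws" \<beta> \<nu>1 \<nu>2]
      unfolding tr by auto
  next
    fix u assume "u \<in> actions X"
    then obtain i where i: "u = (xs ! i, i)" "i < length xs" "m \<noteq> 0" unfolding L
      by (auto split: if_splits)
    have "cube_step (length xs) (replicate (length xs) False) [i] ((replicate (length xs) False)[i
      := True])"
      using i unfolding cube_step_def by (auto simp: nth_list_update)
    then show "\<exists>\<alpha> \<beta>. (\<alpha>, [u], \<beta>) \<in> transitions X" using i unfolding tr by auto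
  next
    fix \<alpha> us vs \<beta>
    assume "us \<noteq> []" "vs \<noteq> []" "(\<alpha>, us @ vs, \<beta>) \<in> transitions X"
    then show "\<exists>\<nu>. (\<alpha>, us, \<nu>) \<in> transitions X \<and> (\<nu>, vs, \<beta>) \<in> transitions X"
      using cube_step_split[of "length xs" \<alpha> "map snd us" "map snd vs" \<beta>] unfolding tr by auto
  next
    fix \<alpha> us vs \<beta> \<nu> \<nu>'
    assume "(\<alpha>, us, \<nu>) \<in> transitions X" "(\<alpha>, us, \<nu>') \<in> transitions X"
    then show "\<nu> = \<nu>'" using cube_step_unique unfolding tr by blast
  qed
qed

lemma cube_length_le: "(\<epsilon>, us, \<epsilon>') \<in> transitions (cube xs) \<Longrightarrow> length us \<le> length xs"
proof -
  assume "(\<epsilon>, us, \<epsilon>') \<in> transitions (cube xs)"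
  then have "distinct (map snd us)" "set (map snd us) \<subseteq> {..<length xs}"
    unfolding cube_transitions cube_step_def by auto
  then show ?thesis
    using card_mono[of "{..<length xs}" "set (map snd us)"] distinct_card[of "map snd us"] by simp
qed

lemma regular_cube: "xs \<noteq> [] \<Longrightarrow> regular_ts (cube xs)"
  by (rule regular_truncated_cube[of _ xs "length xs"]) (auto dest: cube_length_le)

lemma regular_boundary: "xs \<noteq> [] \<Longrightarrow> regular_ts (boundary xs)"
proof (rule regular_truncated_cube[of _ xs "length xs - 1"])
  assume "xs \<noteq> []"
  then have "l \<noteq> length xs \<longleftrightarrow> l \<le> length xs - 1" if "l \<le> length xs" for l using that
    by (cases xs) auto
  then show "transitions (boundary xs) = {(\<epsilon>, us, \<epsilon>') \<in> transitions (cube xs). length us \<le> length xs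
    - 1}"
    using cube_length_le unfolding boundary_def by fastforce
qed (auto simp: boundary_def split: if_splits)

lemma finite_cube: "finite (states (cube xs))" "finite (actions (cube xs))"
  using finite_lists_length_eq[of "UNIV :: bool set" "length xs"] by simp_all

lemma finite_boundary: "finite (states (boundary xs))" "finite (actions (boundary xs))"
  using finite_cube[of xs] by (simp_all add: boundary_def)

lemma boundary_map: "ts_map (boundary xs) (cube xs) id id"
  by (rule ts_mapI) (auto simp: boundary_def split: if_splits)

lemma cube1 [simp]:
  "states (cube [x]) = {[False], [True]}" "actions (cube [x]) = {(x, 0)}"
  "transitions (cube [x]) = {([False], [(x, 0)], [True])}"
proof -
  show "states (cube [x]) = {[False], [True]}" by (auto simp: length_Suc_conv)
  show "actions (cube [x]) = {(x, 0)}" by auto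
  have 1: "(\<epsilon>, us, \<epsilon>') = ([False], [(x, 0)], [True])"
    if t: "(\<epsilon>, us, \<epsilon>') \<in> transitions (cube [x])" for \<epsilon> us \<epsilon>'
  proof -
    from t have us: "us = map (\<lambda>i. ([x] ! i, i)) (map snd us)" "cube_step 1 \<epsilon> (map snd us) \<epsilon>'"
      unfolding cube_transitions by auto
    have "length us = 1" using cube_length_le[OF t] us(2) unfolding cube_step_def
      by (cases us) auto
    then obtain u where u: "us = [u]" by (auto simp: length_Suc_conv)
    then have "us = [(x, 0)]" using us unfolding cube_step_def by auto
    then show ?thesis
      using us(2) unfolding cube_step_def by (auto simp: length_Suc_conv)
  qed
  have 2: "([False], [(x, 0)], [True]) \<in> transitions (cube [x])"
    unfolding cube_transitions by (simp add: cube_step_def)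
  show "transitions (cube [x]) = {([False], [(x, 0)], [True])}"
  proof (intro set_eqI iffI)
    fix t assume "t \<in> transitions (cube [x])"
    then show "t \<in> {([False], [(x, 0)], [True])}" using 1 by (cases t) simp
  qed (use 2 in simp)
qed

lemma cube1_map:
  assumes "weak_ts Y" "(a, [v], b) \<in> transitions Y"
  shows "ts_map (cube [label Y v]) Y (\<lambda>\<epsilon>. if \<epsilon> = [False] then a else b) (\<lambda>_. v)"
  using weak_ts_trans[OF assms] assms(2) by (intro ts_mapI) auto

lemma regular_discrete: "regular_ts (discrete_ts A)"
  by (rule regular_tsI) (auto simp: discrete_ts_def)

lemma double_simps [simp]:
  "states (double_transition x) = {1, 2, 3, 4}" "actions (double_transition x) = {x}"
  "label (double_transition x) = id"
  "transitions (double_transition x) = {(1, [x], 2), (3, [x], 4)}"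
  by (simp_all add: double_transition_def)

lemma regular_double: "regular_ts (double_transition x)"
  by (rule regular_tsI) (auto simp: append_eq_Cons_conv)

lemma double_map:
  assumes "weak_ts Y" "(a, [v], b) \<in> transitions Y" "(c, [v], d) \<in> transitions Y"
  shows "ts_map (double_transition (label Y v)) Y
    (\<lambda>n. if n = 1 then a else if n = 2 then b else if n = 3 then c else d) (\<lambda>_. v)"
  using weak_ts_trans[OF assms(1,2)] weak_ts_trans[OF assms(1,3)] assms(2,3) by (intro ts_mapI) auto

text \<open>Allowing empty paths removes the boundary cases from the axioms.\<close>

definition path :: "('s, 'a, 'l) ts \<Rightarrow> 's \<Rightarrow> 'a list \<Rightarrow> 's \<Rightarrow> bool" where
  "path X \<alpha> us \<beta> \<longleftrightarrow> (us = [] \<and> \<alpha> = \<beta>) \<or> (\<alpha>, us, \<beta>) \<in> transitions X"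

lemma path_Nil: "weak_ts X \<Longrightarrow> path X \<alpha> [] \<beta> \<longleftrightarrow> \<alpha> = \<beta>"
  using weak_ts_trans(2)[of X \<alpha> "[]" \<beta>] unfolding path_def by auto

lemma path_perm:
  assumes "weak_ts X" "path X \<alpha> us \<beta>" "mset vs = mset us"
  shows "path X \<alpha> vs \<beta>"
  using assms weak_ts_perm[OF assms(1) _ assms(3)] unfolding path_def by auto

lemma path_split:
  assumes X: "weak_ts X" "CSA2 X" and p: "path X \<alpha> (us @ vs) \<beta>"
  shows "\<exists>!\<nu>. path X \<alpha> us \<nu> \<and> path X \<nu> vs \<beta>"
proof (cases "us = [] \<or> vs = []")
  case True
  then show ?thesis using p path_Nil[OF X(1)] by auto
next
  case False
  then have t: "us \<noteq> []" "vs \<noteq> []" "(\<alpha>, us @ vs, \<beta>) \<in> transitions X" using p unfolding path_def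
    by auto
  obtain \<nu> where \<nu>: "(\<alpha>, us, \<nu>) \<in> transitions X" "(\<nu>, vs, \<beta>) \<in> transitions X"
    using CSA2_ex[OF X(2) t] by blast
  show ?thesis
  proof (rule ex1I[of _ \<nu>])
    show "path X \<alpha> us \<nu> \<and> path X \<nu> vs \<beta>" using \<nu> unfolding path_def by blast
    fix \<nu>' assume "path X \<alpha> us \<nu>' \<and> path X \<nu>' vs \<beta>"
    then show "\<nu>' = \<nu>" using CSA2_unique[OF X(2,1) t _ _ \<nu>] t(1,2) unfolding path_def by blast
  qed
qed

lemma path_compose:
  assumes X: "weak_ts X" "CSA2 X" and p: "path X \<alpha> (us @ vs @ ws) \<beta>"
    and 1: "path X \<alpha> us \<nu>1" "path X \<nu>1 (vs @ ws) \<beta>" and 2: "path X \<alpha> (us @ vs) \<nu>2" "path X \<nu>2 ws \<beta>"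
  shows "path X \<nu>1 vs \<nu>2"
proof -
  consider "us = []" | "vs = []" | "ws = []" | "us \<noteq> []" "vs \<noteq> []" "ws \<noteq> []" by blast
  then show ?thesis
  proof cases
    case 1
    then show ?thesis using assms path_Nil[OF X(1)] by auto
  next
    case 2
    then show ?thesis using path_split[OF X, of \<alpha> us ws \<beta>] assms path_Nil[OF X(1)] by auto
  next
    case 3
    then show ?thesis using assms path_Nil[OF X(1)] by auto
  next
    case 4
    then show ?thesis using weak_ts_compose[OF X(1) 4] assms unfolding path_def by auto
  qed
qed

text \<open>Every transition is the image of the top transition of a cube. The vertex \<epsilon>
  goes to the state reached from \<open>a\<close> after the actions whose coordinates are set in
  \<epsilon>: CSA2 makes this state exist uniquely, the multiset axiom makes it independent of the
  order, and the composition axiom gives the transitions between two vertices.\<close>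

lemma ex_cube_map:
  assumes Y: "regular_ts Y" and t: "(a, us, b) \<in> transitions Y"
  obtains g where "ts_map (cube (map (label Y) us)) Y g (\<lambda>(x, i). us ! i)"
    "g (replicate (length us) False) = a" "g (replicate (length us) True) = b"
proof -
  have wk: "weak_ts Y" and csa: "CSA2 Y" using Y unfolding regular_ts_def by auto
  define n where "n = length us"
  note tr = weak_ts_trans[OF wk t]
  \<comment> \<open>The coordinates already performed at \<epsilon>; \<open>ls\<close> lists those
    still to come.\<close>
  define ks where "ks \<epsilon> = filter (\<lambda>i. \<epsilon> ! i) [0..<n]" for \<epsilon>
  define ls where "ls \<epsilon> = filter (\<lambda>i. \<not> \<epsilon> ! i) [0..<n]" for \<epsilon>
  have p: "path Y a (map ((!) us) is) b" if "mset is = mset [0..<n]" for "is"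
  proof (rule path_perm[OF wk])
    show "path Y a us b" using t unfolding path_def by blast
    have "mset (map ((!) us) is) = mset (map ((!) us) [0..<n])" using that by simp
    then show "mset (map ((!) us) is) = mset us" by (simp add: n_def map_nth)
  qed
  define g where "g \<epsilon> = (THE \<nu>. path Y a (map ((!) us) (ks \<epsilon>)) \<nu> \<and> path Y \<nu> (map ((!) us) (ls \<epsilon>))
    b)" for \<epsilon>
  have g: "path Y a (map ((!) us) (ks \<epsilon>)) (g \<epsilon>) \<and> path Y (g \<epsilon>) (map ((!) us) (ls \<epsilon>)) b" for \<epsilon>
    unfolding g_def
  proof (rule theI', rule path_split[OF wk csa])
    have "mset (ks \<epsilon> @ ls \<epsilon>) = mset [0..<n]" 
      unfolding ks_def ls_def mset_append mset_filter by (rule multiset_partition[symmetric])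
    from p[OF this] show "path Y a (map ((!) us) (ks \<epsilon>) @ map ((!) us) (ls \<epsilon>)) b" by simp
  qed
  have g1: "path Y a (map ((!) us) is) (g \<epsilon>)" if "mset is = mset (ks \<epsilon>)" for "is" \<epsilon>
    by (rule path_perm[OF wk conjunct1[OF g]]) (simp add: that)
  have g2: "path Y (g \<epsilon>) (map ((!) us) is) b" if "mset is = mset (ls \<epsilon>)" for "is" \<epsilon>
    by (rule path_perm[OF wk conjunct2[OF g]]) (simp add: that)
  have "g (replicate n False) = a"
  proof -
    have "ks (replicate n False) = []" unfolding ks_def by (auto simp: filter_empty_conv)
    then show ?thesis using g1[of "[]" "replicate n False"] path_Nil[OF wk] by simp
  qed
  moreover have "g (replicate n True) = b"
  proof -
    have "ls (replicate n True) = []" unfolding ls_def by (auto simp: filter_empty_conv)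
    then show ?thesis using g2[of "[]" "replicate n True"] path_Nil[OF wk] by simp
  qed
  moreover have "ts_map (cube (map (label Y) us)) Y g (\<lambda>(x, i). us ! i)"
  proof (rule ts_mapI)
    fix \<epsilon>
    show "g \<epsilon> \<in> states Y"
      using g[of \<epsilon>] weak_ts_trans(1,4)[OF wk] tr unfolding path_def by auto
  next
    fix \<epsilon> vs \<epsilon>' assume "(\<epsilon>, vs, \<epsilon>') \<in> transitions (cube (map (label Y) us))"
    then have vs: "vs = map (\<lambda>i. (map (label Y) us ! i, i)) (map snd vs)" and
      step: "cube_step n \<epsilon> (map snd vs) \<epsilon>'"
      unfolding cube_transitions n_def by auto
    define js where "js = map snd vs"
    have js: "cube_step n \<epsilon> js \<epsilon>'" using step unfolding js_def .
    have eq: "map (\<lambda>(x, i). us ! i) vs = map ((!) us) js"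
      unfolding js_def by auto
    have d: "distinct (ks \<epsilon>)" "distinct (ls \<epsilon>)" "distinct js" for \<epsilon>
      using js unfolding ks_def ls_def cube_step_def by auto
    \<comment> \<open>The step from \<epsilon> to \<epsilon>' moves exactly the coordinates in
      \<open>js\<close> from the remaining ones to those performed.\<close>
    have m1: "mset (ks \<epsilon> @ js) = mset (ks \<epsilon>')"
      using d js unfolding cube_step_def
      by (subst set_eq_iff_mset_eq_distinct[symmetric]) (auto simp: ks_def)
    have m2: "mset (js @ ls \<epsilon>') = mset (ls \<epsilon>)"
      using d js unfolding cube_step_def
      by (subst set_eq_iff_mset_eq_distinct[symmetric]) (auto simp: ls_def)
    have m3: "mset (ks \<epsilon> @ js @ ls \<epsilon>') = mset [0..<n]"
    proof -
      have "mset (ks \<epsilon> @ js @ ls \<epsilon>') = mset (ks \<epsilon>') + mset (ls \<epsilon>')" using m1 by simp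
      also have "\<dots> = mset [0..<n]"
        unfolding ks_def ls_def mset_filter by (rule multiset_partition[symmetric])
      finally show ?thesis .
    qed
    have "path Y (g \<epsilon>) (map ((!) us) js) (g \<epsilon>')"
      using path_compose[OF wk csa, of a "map ((!) us) (ks \<epsilon>)" "map ((!) us) js"
        "map ((!) us) (ls \<epsilon>')" b "g \<epsilon>" "g \<epsilon>'"]
        p[OF m3] g1[OF refl, of \<epsilon>] g2[OF m2] g1[OF m1] g2[OF refl, of \<epsilon>'] by simp
    then show "(g \<epsilon>, map (\<lambda>(x, i). us ! i) vs, g \<epsilon>') \<in> transitions Y"
      using js unfolding eq path_def cube_step_def by auto
  qed (use tr(3) in auto)
  ultimately show ?thesis using that unfolding n_def by blast
qed

subsection \<open>Cofibrations and trivial fibrations\<close>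

lemma copies_action_inj:
  assumes f: "f \<in> copies A B g h" and h: "inj_on h (actions A)" "h ` actions A \<subseteq> actions B"
  shows "f \<in> RTS_ar" "action_inj f"
proof -
  obtain gA hA gA' hA' gB hB gB' hB' where
    A': "ts_map (src f) A gA' hA'" "\<forall>u\<in>actions (src f). hA (hA' u) = u"
    and B': "\<forall>u\<in>actions B. hB' (hB u) = u"
    and eq: "\<forall>u\<in>actions A. on_actions f (hA u) = hB (h u)" and f: "f \<in> RTS_ar"
    using f unfolding copies_def ts_iso_def by auto
  show "f \<in> RTS_ar" by (fact f)
  show "action_inj f"
    unfolding action_inj_def
  proof (rule inj_onI)
    fix u v assume u: "u \<in> actions (src f)" and v: "v \<in> actions (src f)"
      and e: "on_actions f u = on_actions f v"
    have u': "hA' u \<in> actions A" and v': "hA' v \<in> actions A" using ts_mapD(2)[OF A'(1)] u v by auto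
    have "hB (h (hA' u)) = hB (h (hA' v))" using eq u' v' A'(2) u v e by metis
    then have "h (hA' u) = h (hA' v)" using B' u' v' h(2) by (metis imageI subsetD)
    then have "hA' u = hA' v" using h(1) u' v' by (auto dest: inj_onD)
    then show "u = v" using A'(2) u v by metis
  qed
qed

lemma gen_cofibrations_action_inj:
  assumes "i \<in> gen_cofibrations"
  shows "i \<in> RTS_ar" "action_inj i"
proof -
  have "i \<in> RTS_ar \<and> action_inj i"
    using assms unfolding gen_cofibrations_def
    by (elim UnE UN_E; intro conjI)
      (erule copies_action_inj; auto simp: discrete_ts_def boundary_def inj_on_def split:
        if_splits)+
  then show "i \<in> RTS_ar" "action_inj i" by auto
qed

context small_labels
begin

text \<open>Injectivity comes from lifting against the map from {0, 1} to {0}, surjectivity from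
  lifting against the inclusion of the empty set into {0}.\<close>

lemma rlp_gen_states:
  fixes p :: "('u, 'l) ts_arrow"
  assumes p: "p \<in> rlp RTS gen_cofibrations" and ph: "p \<in> hom RTS X Y"
  shows "bij_betw (on_states p) (states X) (states Y)"
  unfolding bij_betw_def
proof
  have l: "lifts RTS i p" if "i \<in> gen_cofibrations" for i using p that unfolding rlp_def by blast
  show "inj_on (on_states p) (states X)"
  proof (rule inj_onI)
    fix \<alpha> \<beta> assume a: "\<alpha> \<in> states X" "\<beta> \<in> states X" "on_states p \<alpha> = on_states p \<beta>"
    show "\<alpha> = \<beta>"
    proof (rule lift_against_copies[OF regular_discrete _ _ regular_discrete _ _ _ ph])
      show "lifts RTS i p" if "i \<in> copies (discrete_ts {0, 1 :: nat}) (discrete_ts {0 :: nat}) (\<lambda>_.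
        0) id" for i
        using that by (intro l) (auto simp: gen_cofibrations_def)
      show "ts_map (discrete_ts {0, 1 :: nat}) X (\<lambda>n. if n = 0 then \<alpha> else \<beta>) undefined"
        "ts_map (discrete_ts {0 :: nat}) Y (\<lambda>n. on_states p \<alpha>) undefined"
        "ts_map (discrete_ts {0, 1 :: nat}) (discrete_ts {0 :: nat}) (\<lambda>_. 0) id"
        using a hom_RTSD(6)[OF ph] by (auto intro!: ts_mapI simp: discrete_ts_def)
      fix k1 :: "nat \<Rightarrow> 'u"
      assume "\<And>n. n \<in> states (discrete_ts {0, 1 :: nat}) \<Longrightarrow> k1 0 = (if n = 0 then \<alpha> else \<beta>)"
      from this[of 0] this[of 1] show "\<alpha> = \<beta>" by (simp add: discrete_ts_def)
    qed (use a in \<open>auto simp: discrete_ts_def\<close>)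
  qed
  show "on_states p ` states X = states Y"
  proof
    show "on_states p ` states X \<subseteq> states Y" using hom_RTSD(6)[OF ph] by auto
    show "states Y \<subseteq> on_states p ` states X"
    proof
      fix \<beta> assume b: "\<beta> \<in> states Y"
      show "\<beta> \<in> on_states p ` states X"
      proof (rule lift_against_copies[OF regular_discrete _ _ regular_discrete _ _ _ ph])
        show "lifts RTS i p" if "i \<in> copies (discrete_ts ({} :: nat set)) (discrete_ts {0 :: nat})
          id id" for i
          using that by (intro l) (auto simp: gen_cofibrations_def)
        show "ts_map (discrete_ts ({} :: nat set)) X undefined undefined"
          "ts_map (discrete_ts {0 :: nat}) Y (\<lambda>n. \<beta>) undefined"
          "ts_map (discrete_ts ({} :: nat set)) (discrete_ts {0 :: nat}) id id"
          using b by (auto intro!: ts_mapI simp: discrete_ts_def)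
        fix k1 k2
        assume "ts_map (discrete_ts {0 :: nat}) X k1 k2"
          and "\<And>n. n \<in> states (discrete_ts {0 :: nat}) \<Longrightarrow> on_states p (k1 n) = \<beta>"
        from ts_mapD(1)[OF this(1), of 0] this(2)[of 0]
        show "\<beta> \<in> on_states p ` states X" by (auto simp: discrete_ts_def)
      qed (auto simp: discrete_ts_def)
    qed
  qed
qed

text \<open>Lifting against the boundary inclusion of the 1-cube: both end points are prescribed,
  while the action is controlled only through its image.\<close>

lemma rlp_gen_transition:
  fixes p :: "('u, 'l) ts_arrow"
  assumes p: "p \<in> rlp RTS gen_cofibrations" and ph: "p \<in> hom RTS X Y"
    and a: "\<alpha> \<in> states X" "\<beta> \<in> states X" and t: "(on_states p \<alpha>, [v], on_states p \<beta>) \<in> transitions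
      Y"
  obtains u where "u \<in> actions X" "on_actions p u = v" "(\<alpha>, [u], \<beta>) \<in> transitions X"
proof -
  note wk = RTS_ob_weak[OF hom_RTSD(3)[OF ph]] RTS_ob_weak[OF hom_RTSD(4)[OF ph]]
  let ?x = "label Y v"
  show ?thesis
  proof (rule lift_against_copies[OF regular_boundary finite_boundary regular_cube finite_cube
    boundary_map ph])
    show "lifts RTS i p" if "i \<in> copies (boundary [?x]) (cube [?x]) id id" for i
      using p that unfolding rlp_def gen_cofibrations_def by fastforce
    show "ts_map (boundary [?x]) X (\<lambda>\<epsilon>. if \<epsilon> = [False] then \<alpha> else \<beta>) undefined"
      by (rule ts_mapI) (use a in \<open>auto simp: boundary_def\<close>)
    show "ts_map (cube [?x]) Y (\<lambda>\<epsilon>. if \<epsilon> = [False] then on_states p \<alpha> else on_states p \<beta>) (\<lambda>_. v)"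
      by (rule cube1_map[OF wk(2) t])
    fix k1 k2 assume k: "ts_map (cube [?x]) X k1 k2"
      "\<And>\<epsilon>. \<epsilon> \<in> states (boundary [?x]) \<Longrightarrow> k1 (id \<epsilon>) = (if \<epsilon> = [False] then \<alpha> else \<beta>)"
      "\<And>w. w \<in> actions (cube [?x]) \<Longrightarrow> on_actions p (k2 w) = v"
    have "(k1 [False], map k2 [(?x, 0)], k1 [True]) \<in> transitions X"
      by (rule ts_mapD(4)[OF k(1)]) simp
    then have "(\<alpha>, [k2 (?x, 0)], \<beta>) \<in> transitions X"
      using k(2)[of "[False]"] k(2)[of "[True]"] by (simp add: boundary_def)
    moreover have "on_actions p (k2 (?x, 0)) = v" using k(3)[of "(?x, 0)"] by simp
    ultimately show thesis using that weak_ts_trans(3)[OF wk(1)] by fastforce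
  qed (auto simp: boundary_def)
qed

text \<open>In contrast to \<open>rlp_gen_transition\<close> the action \<open>u\<close> is
  prescribed. By regularity it occurs in some transition of \<open>X\<close>, and lifting against
  the map from C_1[x] to the double transition carries it over to \<alpha> and \<beta>.\<close>

lemma rlp_gen_transition1:
  fixes p :: "('u, 'l) ts_arrow"
  assumes p: "p \<in> rlp RTS gen_cofibrations" and ph: "p \<in> hom RTS X Y"
    and a: "\<alpha> \<in> states X" "\<beta> \<in> states X" "u \<in> actions X"
    and t: "(on_states p \<alpha>, [on_actions p u], on_states p \<beta>) \<in> transitions Y"
  shows "(\<alpha>, [u], \<beta>) \<in> transitions X"
proof -
  have X: "X \<in> RTS_ob" and Y: "Y \<in> RTS_ob" using hom_RTSD[OF ph] by auto
  note wk = RTS_ob_weak[OF X] RTS_ob_weak[OF Y]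
  obtain \<gamma> \<delta> where s: "(\<gamma>, [u], \<delta>) \<in> transitions X" using RTS_used[OF X a(3)] by blast
  have ps: "(on_states p \<gamma>, [on_actions p u], on_states p \<delta>) \<in> transitions Y"
    using hom_RTSD(9)[OF ph s] by simp
  let ?x = "label X u"
  have lab: "label Y (on_actions p u) = ?x" using hom_RTSD(8)[OF ph a(3)] .
  show ?thesis
  proof (rule lift_against_copies[OF regular_cube finite_cube regular_double _ _ _ ph])
    show "lifts RTS i p" if "i \<in> copies (cube [?x]) (double_transition ?x) (\<lambda>\<epsilon>. if \<epsilon> = [False] then
      1 else 2) fst" for i
      using p that unfolding rlp_def gen_cofibrations_def by fastforce
    show "ts_map (cube [?x]) X (\<lambda>\<epsilon>. if \<epsilon> = [False] then \<gamma> else \<delta>) (\<lambda>_. u)"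
      by (rule cube1_map[OF wk(1) s])
    show "ts_map (double_transition ?x) Y (\<lambda>n. if n = 1 then on_states p \<gamma> else if n =
      2 then on_states p \<delta>
      else if n = 3 then on_states p \<alpha> else on_states p \<beta>) (\<lambda>_. on_actions p u)"
      using double_map[OF wk(2) ps t] unfolding lab .
    show "ts_map (cube [?x]) (double_transition ?x) (\<lambda>\<epsilon>. if \<epsilon> = [False] then 1 else 2) fst"
      by (rule ts_mapI) auto
    fix k1 k2 assume k: "ts_map (double_transition ?x) X k1 k2"
      "\<And>w. w \<in> actions (cube [?x]) \<Longrightarrow> k2 (fst w) = u"
      "\<And>n. n \<in> states (double_transition ?x) \<Longrightarrow> on_states p (k1 n) = (if n = 1 then on_states p \<gamma>
        else if n = 2 then on_states p \<delta> else if n = 3 then on_states p \<alpha> else on_states p \<beta>)"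
    have t: "(k1 3, map k2 [?x], k1 4) \<in> transitions X"
      by (rule ts_mapD(4)[OF k(1)]) simp
    \<comment> \<open>The lift only prescribes the images of these states under \<open>p\<close>,
      but \<open>p\<close> is injective on states.\<close>
    have "k1 3 = \<alpha>" "k1 4 = \<beta>"
      using inj_onD[OF bij_betw_imp_inj_on[OF rlp_gen_states[OF p ph]]] k(3)[of 3] k(3)[of 4]
        weak_ts_trans[OF wk(1) t] a by auto
    then show "(\<alpha>, [u], \<beta>) \<in> transitions X" using t k(2)[of "(?x, 0)"] by simp
  qed auto
qed

text \<open>Induction on the dimension n. For n at least 2 the transition of \<open>Y\<close> is the
  top of a cube; the boundary of this cube lifts to \<open>X\<close> because shorter transitions are
  already known to be reflected, and lifting against the boundary inclusion supplies the top
  transition.\<close>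

lemma rlp_gen_transitions:
  fixes p :: "('u, 'l) ts_arrow"
  assumes p: "p \<in> rlp RTS gen_cofibrations" and ph: "p \<in> hom RTS X Y"
  shows "\<alpha> \<in> states X \<Longrightarrow> \<beta> \<in> states X \<Longrightarrow> set us \<subseteq> actions X \<Longrightarrow>
    (on_states p \<alpha>, map (on_actions p) us, on_states p \<beta>) \<in> transitions Y \<Longrightarrow> (\<alpha>, us, \<beta>) \<in> transitions
      X"
proof (induction "length us" arbitrary: us \<alpha> \<beta> rule: less_induct)
  case less
  have X: "X \<in> RTS_ob" and Y: "Y \<in> RTS_ob" using hom_RTSD[OF ph] by auto
  note wk = RTS_ob_weak[OF X] RTS_ob_weak[OF Y]
  note t = less.prems(4)
  have ne: "us \<noteq> []" using weak_ts_trans(2)[OF wk(2) t] by simp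
  show ?case
  proof (cases "length us = 1")
    case True
    then obtain u where "us = [u]" by (auto simp: length_Suc_conv)
    then show ?thesis using rlp_gen_transition1[OF p ph less.prems(1,2), of u] less.prems by simp
  next
    case False
    define xs where "xs = map (label X) us"
    have xs: "map (label Y) (map (on_actions p) us) = xs" "xs \<noteq> []" "length xs = length us"
      using less.prems(3) hom_RTSD(8)[OF ph] ne unfolding xs_def by auto
    obtain g where g: "ts_map (cube xs) Y g (\<lambda>(x, i). map (on_actions p) us ! i)"
      "g (replicate (length us) False) = on_states p \<alpha>" "g (replicate (length us) True) =
        on_states p \<beta>"
      using ex_cube_map[OF RTS_ob_regular[OF Y] t] unfolding xs(1) by auto
    note bij = rlp_gen_states[OF p ph]
    define a1 where "a1 \<epsilon> = inv_into (states X) (on_states p) (g \<epsilon>)" for \<epsilon>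
    have a1: "a1 \<epsilon> \<in> states X" "on_states p (a1 \<epsilon>) = g \<epsilon>" if "length \<epsilon> = length us" for \<epsilon>
    proof -
      have "g \<epsilon> \<in> on_states p ` states X"
        using bij ts_mapD(1)[OF g(1), of \<epsilon>] that xs(3) unfolding bij_betw_def by simp
      from inv_into_into[OF this] f_inv_into_f[OF this]
      show "a1 \<epsilon> \<in> states X" "on_states p (a1 \<epsilon>) = g \<epsilon>" unfolding a1_def by auto
    qed
    have act: "us ! i \<in> actions X" if "i < length us" for i using less.prems(3) that by auto
    show ?thesis
    proof (rule lift_against_copies[OF regular_boundary finite_boundary regular_cube finite_cube
      boundary_map ph])
      show "lifts RTS i p" if "i \<in> copies (boundary xs) (cube xs) id id" for i
      proof -
        have "length xs \<ge> 1" using xs(2) by (cases xs) auto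
        then show ?thesis using p that unfolding rlp_def gen_cofibrations_def by blast
      qed
      show "ts_map (cube xs) Y g (\<lambda>(x, i). map (on_actions p) us ! i)" by (fact g(1))
      show "ts_map (boundary xs) X a1 (\<lambda>(x, i). us ! i)"
      proof (rule ts_mapI)
        fix \<epsilon> vs \<epsilon>' assume "(\<epsilon>, vs, \<epsilon>') \<in> transitions (boundary xs)"
        then have v: "(\<epsilon>, vs, \<epsilon>') \<in> transitions (cube xs)" "length vs \<noteq> length us"
          using xs(3) unfolding boundary_def by auto
        note c = weak_ts_trans[OF regular_cube[OF xs(2), unfolded regular_ts_def, THEN conjunct1]
          v(1)]
        have len: "length \<epsilon> = length us" "length \<epsilon>' = length us" using c xs(3) by auto
        have "map (on_actions p) (map (\<lambda>(x, i). us ! i) vs) = map (\<lambda>(x, i). map (on_actions p) us !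
          i) vs"
          using c(3) xs(3) by auto
        then show "(a1 \<epsilon>, map (\<lambda>(x, i). us ! i) vs, a1 \<epsilon>') \<in> transitions X"
          using ts_mapD(4)[OF g(1) v(1)] a1[OF len(1)] a1[OF len(2)] v(2) cube_length_le[OF v(1)]
            xs(3)
            act c(3) by (intro less.hyps) (auto simp del: map_map)
      qed (use a1 xs act in \<open>auto simp: boundary_def xs_def split: if_splits\<close>)
      fix k1 k2 assume k: "ts_map (cube xs) X k1 k2"
        "\<And>\<epsilon>. \<epsilon> \<in> states (boundary xs) \<Longrightarrow> k1 (id \<epsilon>) = a1 \<epsilon>"
        "\<And>w. w \<in> actions (boundary xs) \<Longrightarrow> k2 (id w) = (case w of (x, i) \<Rightarrow> us ! i)"
      let ?n = "length us"
      let ?us = "map (\<lambda>i. (xs ! i, i)) [0..<?n]"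
      have "(replicate ?n False, ?us, replicate ?n True) \<in> transitions (cube xs)"
        unfolding cube_transitions using ne xs(3) by (auto simp: cube_step_def o_def)
      then have "(k1 (replicate ?n False), map k2 ?us, k1 (replicate ?n True)) \<in> transitions X"
        by (rule ts_mapD(4)[OF k(1)])
      moreover have "map k2 ?us = us"
      proof (rule nth_equalityI)
        fix i assume "i < length (map k2 ?us)"
        then have i: "i < ?n" by simp
        \<comment> \<open>For n at least 2 the boundary has all actions of the cube, so the lift is
          prescribed on every action.\<close>
        then have "(xs ! i, i) \<in> actions (boundary xs)" using False xs(3)
          by (simp add: boundary_def)
        from k(3)[OF this] show "map k2 ?us ! i = us ! i" using i by simp
      qed simp
      moreover have "k1 (replicate ?n False) = \<alpha>" "k1 (replicate ?n True) = \<beta>"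
        using k(2)[of "replicate ?n False"] k(2)[of "replicate ?n True"] xs(3)
          a1[of "replicate ?n False"] a1[of "replicate ?n True"] g(2,3) less.prems(1,2)
          inj_onD[OF bij_betw_imp_inj_on[OF bij]]
        by (auto simp: boundary_def)
      ultimately show "(\<alpha>, us, \<beta>) \<in> transitions X" by simp
    next
      fix \<epsilon> assume "\<epsilon> \<in> states (boundary xs)"
      then show "on_states p (a1 \<epsilon>) = g (id \<epsilon>)" using a1 xs(3) by (simp add: boundary_def)
    next
      fix w assume "w \<in> actions (boundary xs)"
      then show "on_actions p (case w of (x, i) \<Rightarrow> us ! i) = (case id w of (x, i) \<Rightarrow> map (on_actions
        p) us ! i)"
        using xs(3) by (auto simp: boundary_def split: if_splits)
    qed (fact xs(2))+
  qed
qed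

text \<open>Surjectivity on actions rests on regularity: each action of the target occurs in a
  1-transition, and 1-transitions lift.\<close>

lemma rlp_gen_cofibrations:
  "rlp RTS gen_cofibrations = {p :: ('u, 'l) ts_arrow. trivfib p}"
proof (intro set_eqI iffI; simp only: mem_Collect_eq)
  fix p :: "('u, 'l) ts_arrow" assume p: "p \<in> rlp RTS gen_cofibrations"
  then have ph: "p \<in> hom RTS (src p) (tgt p)" by (simp add: hom_def rlp_def)
  note pD = hom_RTSD[OF ph]
  note bij = rlp_gen_states[OF p ph]
  show "trivfib p"
  proof (rule trivfibI[OF ph bij])
    show "on_actions p ` actions (src p) = actions (tgt p)"
    proof
      show "on_actions p ` actions (src p) \<subseteq> actions (tgt p)" using pD(7) by auto
      show "actions (tgt p) \<subseteq> on_actions p ` actions (src p)"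
      proof
        fix v assume v: "v \<in> actions (tgt p)"
        obtain \<gamma> \<delta> where t: "(\<gamma>, [v], \<delta>) \<in> transitions (tgt p)" "\<gamma> \<in> states (tgt p)"
          "\<delta> \<in> states (tgt p)"
          using RTS_used[OF pD(4) v] .
        then obtain \<alpha> \<beta> where "\<alpha> \<in> states (src p)" "\<beta> \<in> states (src p)" "\<gamma> = on_states p \<alpha>"
          "\<delta> = on_states p \<beta>"
          using bij unfolding bij_betw_def by blast
        then show "v \<in> on_actions p ` actions (src p)"
          using rlp_gen_transition[OF p ph] t(1) by blast
      qed
    qed
  qed (use rlp_gen_transitions[OF p ph] in blast)
next
  fix p :: "('u, 'l) ts_arrow" assume p: "trivfib p"
  then show "p \<in> rlp RTS gen_cofibrations"
    using lifts_action_inj_trivfib gen_cofibrations_action_inj unfolding rlp_def trivfib_def by auto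
qed

lemma cofibrations:
  "llp RTS (rlp RTS gen_cofibrations) = {i :: ('u, 'l) ts_arrow. i \<in> RTS_ar \<and> action_inj i}"
  unfolding rlp_gen_cofibrations llp_def
  using action_inj_if_lifts lifts_action_inj_trivfib by auto

lemma rlp_cofibrations:
  "rlp RTS {i :: ('u, 'l) ts_arrow. i \<in> RTS_ar \<and> action_inj i} = {p. trivfib p}"
proof -
  have "rlp RTS {i :: ('u, 'l) ts_arrow. i \<in> RTS_ar \<and> action_inj i} \<subseteq> rlp RTS gen_cofibrations"
    using gen_cofibrations_action_inj unfolding rlp_def by blast
  moreover have "{p. trivfib p} \<subseteq> rlp RTS {i :: ('u, 'l) ts_arrow. i \<in> RTS_ar \<and> action_inj i}"
    using lifts_action_inj_trivfib unfolding rlp_def trivfib_def by auto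
  ultimately show ?thesis unfolding rlp_gen_cofibrations by blast
qed

subsection \<open>The localizer of maps orthogonal to the systems satisfying CSA1\<close>

text \<open>Injectivity on actions is detected by maps to a one-state system with two copies of each
  label. For \<open>u \<in> actions (X a)\<close>, an action \<open>w\<close> of \<open>X b\<close> is sent to the second copy iff
  \<open>w\<close> and \<open>u\<close> eventually have the same image.\<close>

lemma action_inj_chain_colimit:
  fixes X :: "'i \<Rightarrow> ('u, 'u, 'l) ts"
  assumes wo: "Well_order r" and ts: "transfinite_sequence RTS r X D" and A: "A \<subseteq> Field r"
    and col: "is_colimit RTS A X (chain_edges r D A) L c" and a: "a \<in> A"
    and inj: "\<And>b. b \<in> A \<Longrightarrow> (a, b) \<in> r \<Longrightarrow> action_inj (D a b)"
  shows "action_inj (c a)"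
  unfolding action_inj_def
proof (rule inj_onI, rule ccontr)
  note tsD = ts[unfolded transfinite_sequence_def]
  have refl: "Refl r" and trans: "trans r" and total: "Total r"
    using wo unfolding well_order_on_def linear_order_on_def partial_order_on_def preorder_on_def
    by auto
  have rr: "(b, b) \<in> r" if "b \<in> A" for b using refl_onD[OF refl] that A by auto
  have tot: "(b, b') \<in> r \<or> (b', b) \<in> r" if "b \<in> A" "b' \<in> A" for b b'
  proof -
    have "b \<in> Field r" "b' \<in> Field r" using that A by auto
    then show ?thesis using total[unfolded total_on_def] refl_onD[OF refl] by (cases "b = b'") auto
  qed
  have D: "D b b' \<in> hom RTS (X b) (X b')" if "(b, b') \<in> r" for b b' using tsD that by blast
  have DD: "on_actions (D b' b'') (on_actions (D b b') w) = on_actions (D b b'') w"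
    if "(b, b') \<in> r" "(b', b'') \<in> r" "w \<in> actions (X b)" for b b' b'' w
  proof -
    have "Comp RTS (D b' b'') (D b b') = D b b''" using tsD that by blast
    then show ?thesis using RTS_Comp_simps(4)[of w "D b b'" "D b' b''"] that(3) hom_RTSD(1)[OF D[OF
      that(1)]] by simp
  qed
  note colD = RTS.chain_colimitD[OF col]
  note caD = hom_RTSD[OF colD(1)[OF a]]
  fix u v assume u: "u \<in> actions (src (c a))" and v: "v \<in> actions (src (c a))"
    and eq: "on_actions (c a) u = on_actions (c a) v" and ne: "u \<noteq> v"
  have u: "u \<in> actions (X a)" and v: "v \<in> actions (X a)" using u v caD(1) by auto
  define P where "P b w \<longleftrightarrow> (\<exists>d\<in>A. (b, d) \<in> r \<and> (a, d) \<in> r \<and> on_actions (D b d) w = on_actions (D a d)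
    u)" for b w
  \<comment> \<open>Invariance along the chain is what makes the maps \<open>c'\<close> into the
    two-copy system a cocone.\<close>
  have P: "P b' (on_actions (D b b') w) \<longleftrightarrow> P b w"
    if b: "b \<in> A" "b' \<in> A" "(b, b') \<in> r" and w: "w \<in> actions (X b)" for b b' w
  proof
    assume "P b' (on_actions (D b b') w)"
    then obtain d where "d \<in> A" "(b', d) \<in> r" "(a, d) \<in> r"
      "on_actions (D b' d) (on_actions (D b b') w) = on_actions (D a d) u"
      unfolding P_def by blast
    then show "P b w" using DD[OF b(3) _ w] transD[OF trans b(3)] unfolding P_def by auto
  next
    assume "P b w"
    then obtain d where d: "d \<in> A" "(b, d) \<in> r" "(a, d) \<in> r"
      "on_actions (D b d) w = on_actions (D a d) u"
      unfolding P_def by blast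
    show "P b' (on_actions (D b b') w)"
    proof (cases "(b', d) \<in> r")
      case True
      then show ?thesis using d DD[OF b(3) True w] unfolding P_def by auto
    next
      case False
      then have db: "(d, b') \<in> r" using tot b d by blast
      have "on_actions (D b' b') (on_actions (D b b') w) = on_actions (D b b') w"
        using DD[OF b(3) rr[OF b(2)] w] .
      also have "\<dots> = on_actions (D d b') (on_actions (D b d) w)" using DD[OF d(2) db w] by simp
      also have "\<dots> = on_actions (D a b') u" using DD[OF d(3) db u] d(4) by simp
      finally show ?thesis using b(2) rr[OF b(2)] transD[OF trans d(3) db] unfolding P_def by auto
    qed
  qed
  define B where "B = tag ` (range (label_code :: 'l \<Rightarrow> 'u) \<times> {..1})"
  define K :: "('u, 'u, 'l) ts" where "K = one_state B (inv label_code \<circ> fst \<circ> untag)"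
  have K: "K \<in> RTS_ob" unfolding K_def B_def by (intro one_state_RTS_ob small_tag small_label_code)
    simp
  define \<kappa> where "\<kappa> b w = (tag (label_code (label (X b) w), if P b w then 1 else 0) :: 'u)" for b w
  define c' where "c' b = arr (X b) K (\<lambda>_. undefined) (\<kappa> b)" for b
  have Xob: "X b \<in> RTS_ob" if "b \<in> A" for b using tsD that A by auto
  have c': "c' b \<in> hom RTS (X b) K" if "b \<in> A" for b
    unfolding c'_def K_def
    by (rule one_state_hom[OF Xob[OF that] K[unfolded K_def]]) (auto simp: B_def \<kappa>_def)
  have "is_cocone RTS A X (chain_edges r D A) K c'"
    unfolding is_cocone_def chain_edges_def
  proof (safe intro!: c')
    show "K \<in> Ob RTS" using K by simp
    fix b b' assume b: "b \<in> A" "b' \<in> A" "(b, b') \<in> r"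
    note Db = hom_RTSD[OF D[OF b(3)]]
    show "Comp RTS (c' b') (D b b') = c' b"
      by (rule hom_RTS_eqI[OF RTS_Comp_in_hom[OF D[OF b(3)] c'[OF b(2)]] c'[OF b(1)]])
        (use Db P[OF b] in \<open>auto simp: c'_def \<kappa>_def\<close>)
  qed
  then obtain h where "\<forall>b\<in>A. Comp RTS h (c b) = c' b"
    using col unfolding is_colimit_def by blast
  then have "Comp RTS h (c a) = c' a" using a by blast
  then have "on_actions h (on_actions (c a) w) = \<kappa> a w" if "w \<in> actions (X a)" for w
    using RTS_Comp_simps(4)[of w "c a" h] that caD(1) by (simp add: c'_def)
  from this[OF u] this[OF v] have "\<kappa> a u = \<kappa> a v" unfolding eq by (rule HOL.trans[OF sym])
  then have "P a u \<longleftrightarrow> P a v" unfolding \<kappa>_def by (auto split: if_splits)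
  moreover have "P a u" unfolding P_def using a rr[OF a] by auto
  moreover have "\<not> P a v"
  proof
    assume "P a v"
    then obtain d where "d \<in> A" "(a, d) \<in> r" "on_actions (D a d) v = on_actions (D a d) u"
      unfolding P_def by blast
    then show False
      using inj_onD[OF inj[unfolded action_inj_def], of d v u] u v hom_RTSD(1)[OF D] ne by auto
  qed
  ultimately show False by blast
qed

text \<open>Trivial fibrations belong to the class by \<open>orth_trivfib_CSA1\<close>. In the
  closure properties the cofibrations have to be preserved as well: for pushouts this holds for any
  class defined by left lifting, for transfinite compositions it comes from the description by
  injectivity on actions.\<close>

lemma grothendieck_localizer_CSA1:
  fixes Cf :: "('u, 'l) ts_arrow set"
  assumes Cf: "Cf = llp RTS (rlp RTS gen_cofibrations)"
  shows "grothendieck_localizer TYPE('u) RTS Cf {f \<in> Ar RTS. \<forall>Z\<in>{Z \<in> RTS_ob. CSA1 Z}. orth RTS f Z}"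
    (is "grothendieck_localizer _ _ _ ?W")
proof -
  have Cf': "Cf = {i. i \<in> RTS_ar \<and> action_inj i}" unfolding Cf cofibrations ..
  have "rlp RTS Cf \<subseteq> ?W"
    unfolding Cf' rlp_cofibrations
  proof (intro subsetI CollectI conjI ballI; elim CollectE)
    fix p :: "('u, 'l) ts_arrow" assume p: "trivfib p"
    then show "p \<in> Ar RTS" by (simp add: trivfib_def)
    fix Z :: "('u, 'u, 'l) ts" assume "Z \<in> RTS_ob \<and> CSA1 Z"
    then show "orth RTS p Z" using orth_trivfib_CSA1[OF p] by blast
  qed
  moreover have "closed_under_pushouts RTS (?W \<inter> Cf)"
    unfolding closed_under_pushouts_def
  proof (intro allI impI, elim conjE)
    fix i u i' u' :: "('u, 'l) ts_arrow" assume i: "i \<in> ?W \<inter> Cf" and po: "is_pushout RTS i u i' u'"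
    have "i' \<in> Cf" using RTS.llp_pushout[OF po] i unfolding Cf by (auto simp: rlp_def)
    then show "i' \<in> ?W \<inter> Cf" using RTS.orth_pushout[OF po] i unfolding Cf' by auto
  qed
  moreover have "closed_under_transfinite_composition TYPE('u) RTS (?W \<inter> Cf)"
    unfolding closed_under_transfinite_composition_def
  proof (intro allI impI, elim conjE)
    fix r :: "'u rel" and X :: "'u \<Rightarrow> ('u, 'u, 'l) ts" and D L c z
    assume wo: "Well_order r" and z: "z \<in> Field r" "\<forall>a\<in>Field r. (z, a) \<in> r"
      and ts: "transfinite_sequence RTS r X D" and cov: "\<forall>a b. covers r a b \<longrightarrow> D a b \<in> ?W \<inter> Cf"
      and col: "is_colimit RTS (Field r) X (chain_edges r D (Field r)) L c"
    \<comment> \<open>All connecting maps of the chain come before its colimit, since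
      \<open>orth_chain_colimit\<close> asks for orthogonality of every map out of the chosen
      stage.\<close>
    have orth: "orth RTS (D a b) Z" if "(a, b) \<in> r" and Z: "Z \<in> RTS_ob" "CSA1 Z" for a b Z
      using wo ts that(1)
    proof (induction rule: RTS.transfinite_sequence_induct)
      case (Comp f g x y z) then show ?case by (rule RTS.orth_Comp)
    next
      case (colimit A L c a)
      then show ?case using RTS.orth_chain_colimit[OF wo ts, of A L c a Z] Z by simp
    qed (use RTS.orth_Id cov Z in auto)
    have inj: "action_inj (D a b)" if "(a, b) \<in> r" for a b
      using wo ts that
    proof (induction rule: RTS.transfinite_sequence_induct)
      case (Comp f g x y z)
      note f = hom_RTSD[OF Comp(1)] and g = hom_RTSD[OF Comp(2)]
      have "inj_on (on_actions f) (actions x)" "inj_on (on_actions g) (actions y)"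
        using Comp(3,4) f(1) g(1) unfolding action_inj_def by auto
      then show ?case
        using f(7) f(1) unfolding action_inj_def inj_on_def by auto
    next
      case (colimit A L c a)
      then show ?case using action_inj_chain_colimit[OF wo ts, of A L c a] by simp
    qed (use cov Cf' in \<open>auto simp: action_inj_def inj_on_def\<close>)
    have "c z \<in> RTS_ar" using RTS.chain_colimitD(1)[OF col z(1)] by (simp add: hom_def)
    moreover have "action_inj (c z)"
      using z inj by (intro action_inj_chain_colimit[OF wo ts subset_refl col]) auto
    moreover have "orth RTS (c z) Z" if "Z \<in> RTS_ob" "CSA1 Z" for Z
      using z orth that by (intro RTS.orth_chain_colimit[OF wo ts subset_refl col]) auto
    ultimately show "c z \<in> ?W \<inter> Cf" unfolding Cf' by auto
  qed
  ultimately show ?thesis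
    using RTS.two_out_of_three_orth[of "{Z \<in> RTS_ob. CSA1 Z}"]
    unfolding grothendieck_localizer_def by blast
qed

section \<open>Upper and lower bounds for the weak equivalences\<close>

lemma RTS_model_simps:
  "cof RTS_model = {i :: ('u, 'l) ts_arrow. i \<in> RTS_ar \<and> action_inj i}"
  "weq RTS_model = smallest_localizer TYPE('u) RTS {i :: ('u, 'l) ts_arrow. i \<in> RTS_ar \<and>
    action_inj i}"
  "fib RTS_model = rlp RTS (weq RTS_model \<inter> {i :: ('u, 'l) ts_arrow. i \<in> RTS_ar \<and> action_inj i})"
  unfolding RTS_model_def left_determined_def Let_def cofibrations by simp_all

text \<open>The upper bound: the smallest localizer is contained in the one of maps orthogonal to
  the systems satisfying CSA1.\<close>

lemma weq_RTS_orth: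
  fixes f :: "('u, 'l) ts_arrow"
  assumes "f \<in> weq RTS_model" "Z \<in> RTS_ob" "CSA1 Z"
  shows "f \<in> RTS_ar" "orth RTS f Z"
proof -
  have "f \<in> {f \<in> Ar RTS. \<forall>Z\<in>{Z \<in> RTS_ob. CSA1 Z}. orth RTS f Z}"
    using assms(1) grothendieck_localizer_CSA1[OF refl]
    unfolding RTS_model_simps cofibrations[symmetric] smallest_localizer_def by blast
  then show "f \<in> RTS_ar" "orth RTS f Z" using assms by auto
qed

lemma trivfib_weq: "trivfib p \<Longrightarrow> p \<in> weq RTS_model" for p :: "('u, 'l) ts_arrow"
  unfolding RTS_model_simps smallest_localizer_def grothendieck_localizer_def rlp_cofibrations
    by blast

end

section \<open>Cosimplicial resolutions\<close>

text \<open>\<open>tens X n\<close> plays the role of the tensor of \<open>X\<close> with the \<open>n\<close>-simplex: it has \<open>n + 1\<close>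
  interchangeable copies of each action of \<open>X\<close>.\<close>

definition tens :: "('u, 'u, 'l) ts \<Rightarrow> nat \<Rightarrow> ('u, 'u, 'l) ts" where
  "tens X n = pull X (tag ` (actions X \<times> {..n})) (fst \<circ> untag)"

definition tmap :: "('u \<Rightarrow> 'u) \<Rightarrow> (nat \<Rightarrow> nat) \<Rightarrow> 'u \<Rightarrow> 'u" where
  "tmap h \<theta> w = tag (h (fst (untag w)), \<theta> (snd (untag w)))"

definition tens_cosimp :: "('u, 'u, 'l) ts \<Rightarrow> (('u, 'u, 'l) ts, ('u, 'l) ts_arrow) cosimp" where
  "tens_cosimp X = \<lparr>cobj = tens X, coact = (\<lambda>m n \<theta>. arr (tens X m) (tens X n) id (tmap id \<theta>))\<rparr>"

lemma tens_cosimp_simps [simp]: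
  "cobj (tens_cosimp X) = tens X"
  "coact (tens_cosimp X) m n \<theta> = arr (tens X m) (tens X n) id (tmap id \<theta>)"
  by (simp_all add: tens_cosimp_def)

definition tens_proj :: "('u, 'u, 'l) ts \<Rightarrow> nat \<Rightarrow> ('u, 'l) ts_arrow" where
  "tens_proj X n = arr (tens X n) X id (fst \<circ> untag)"

definition tens_map :: "('u, 'l) ts_arrow \<Rightarrow> nat \<Rightarrow> ('u, 'l) ts_arrow" where
  "tens_map f n = arr (tens (src f) n) (tens (tgt f) n) (on_states f) (tmap (on_actions f) id)"

lemma tens_simps [simp]:
  "states (tens X n) = states X" "actions (tens X n) = tag ` (actions X \<times> {..n})"
  "(\<alpha>, us, \<beta>) \<in> transitions (tens X n) \<longleftrightarrow>
    set us \<subseteq> tag ` (actions X \<times> {..n}) \<and> (\<alpha>, map (fst \<circ> untag) us, \<beta>) \<in> transitions X"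
  by (simp_all add: tens_def)

text \<open>The vertices in a proper nonempty face of the \<open>n\<close>-simplex lie in one component of its
  boundary, and \<open>latch_comp n i\<close> is a representative of the component of \<open>i\<close>.\<close>

definition latch_comp :: "nat \<Rightarrow> nat \<Rightarrow> nat" where
  "latch_comp n i = (if n = 1 then i else 0)"

text \<open>A nonempty proper subset of {0, 1} is a single point; for n other than 1 the function
  \<open>latch_comp n\<close> is constant.\<close>

lemma latch_comp_const:
  assumes "J \<subseteq> {..n}" "J \<noteq> {..n}" "i \<in> J" "j \<in> J"
  shows "latch_comp n i = latch_comp n j"
proof (cases "n = 1")
  case True
  then have "J = {0} \<or> J = {1}" using assms by (auto simp: atMost_Suc le_Suc_eq)
  then show ?thesis using assms by auto
qed (simp add: latch_comp_def)

text \<open>The n-th latching object of \<open>tens_cosimp X\<close>, a tensor of \<open>X\<close>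
  with the boundary of the n-simplex. A transition uses copies from one proper face only, and there
  is a copy of the states for each component of the boundary, so two for n = 1 and one for n at
  least 2. For n = 0 the boundary is empty, whence the guards \<open>1 \<le> n\<close>. Words of
  transitions are nonempty, so the universally quantified index determines both end states.\<close>

definition latch :: "('u, 'u, 'l) ts \<Rightarrow> nat \<Rightarrow> ('u, 'u, 'l) ts" where
  "latch X n = \<lparr>states = {tag (\<alpha>, latch_comp n i) | \<alpha> i. \<alpha> \<in> states X \<and> i \<le> n \<and> 1 \<le> n},
     actions = {w \<in> tag ` (actions X \<times> {..n}). 1 \<le> n},
     label = (\<lambda>w \<in> {w \<in> tag ` (actions X \<times> {..n}). 1 \<le> n}. label X (fst (untag w))),
     transitions = {(\<alpha>', us, \<beta>'). \<exists>\<alpha> \<beta>. 1 \<le> n \<and> set us \<subseteq> tag ` (actions X \<times> {..n}) \<and>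
       (snd \<circ> untag) ` set us \<noteq> {..n} \<and> (\<alpha>, map (fst \<circ> untag) us, \<beta>) \<in> transitions X \<and>
       (\<forall>i \<in> (snd \<circ> untag) ` set us. \<alpha>' = tag (\<alpha>, latch_comp n i) \<and> \<beta>' = tag (\<beta>, latch_comp n i))}\<rparr>"

lemma latch_simps:
  "states (latch X n) = {tag (\<alpha>, latch_comp n i) | \<alpha> i. \<alpha> \<in> states X \<and> i \<le> n \<and> 1 \<le> n}"
  "actions (latch X n) = {w \<in> tag ` (actions X \<times> {..n}). 1 \<le> n}"
  "label (latch X n) = (\<lambda>w \<in> {w \<in> tag ` (actions X \<times> {..n}). 1 \<le> n}. label X (fst (untag w)))"
  "(\<alpha>', us, \<beta>') \<in> transitions (latch X n) \<longleftrightarrow> (\<exists>\<alpha> \<beta>. 1 \<le> n \<and> set us \<subseteq> tag ` (actions X \<times> {..n}) \<and>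
       (snd \<circ> untag) ` set us \<noteq> {..n} \<and> (\<alpha>, map (fst \<circ> untag) us, \<beta>) \<in> transitions X \<and>
       (\<forall>i \<in> (snd \<circ> untag) ` set us. \<alpha>' = tag (\<alpha>, latch_comp n i) \<and> \<beta>' = tag (\<beta>, latch_comp n i)))"
  by (simp_all add: latch_def)

text \<open>The component of a face can be read off from any of its vertices, here \<theta>
  0.\<close>

definition latch_cocone :: "('u, 'u, 'l) ts \<Rightarrow> nat \<Rightarrow> nat \<times> (nat \<Rightarrow> nat) \<Rightarrow> ('u, 'l) ts_arrow" where
  "latch_cocone X n = (\<lambda>(m, \<theta>). arr (tens X m) (latch X n)
     (\<lambda>\<alpha>. tag (\<alpha>, latch_comp n (\<theta> 0))) (tmap id \<theta>))"

definition latch_arr :: "('u, 'u, 'l) ts \<Rightarrow> nat \<Rightarrow> ('u, 'l) ts_arrow" where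
  "latch_arr X n = arr (latch X n) (tens X n) (fst \<circ> untag) id"

definition vertex :: "nat \<Rightarrow> nat \<Rightarrow> nat" where
  "vertex i = (\<lambda>j \<in> {..0}. i)"

lemma vertex_Delta: "i \<le> n \<Longrightarrow> vertex i \<in> Delta 0 n"
  unfolding Delta_def vertex_def by (auto simp: mono_on_def)

lemma Delta_le: "\<theta> \<in> Delta m n \<Longrightarrow> i \<le> m \<Longrightarrow> \<theta> i \<le> n"
  unfolding Delta_def by (auto dest: PiE_mem)

lemma Delta_vertex: "\<theta> \<in> Delta m n \<Longrightarrow> j \<le> m \<Longrightarrow> compose {..0} \<theta> (vertex j) = vertex (\<theta> j)"
  by (auto simp: compose_def vertex_def restrict_def)

lemma latching_image:
  assumes "(m, \<theta>) \<in> latching_index n"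
  shows "\<theta> ` {..m} \<subseteq> {..n}" "\<theta> ` {..m} \<noteq> {..n}" "m < n" "\<theta> \<in> Delta m n"
proof -
  have m: "m < n" "\<theta> \<in> Delta m n" "inj_on \<theta> {..m}" using assms unfolding latching_index_def by auto
  show "\<theta> ` {..m} \<subseteq> {..n}" using Delta_le[OF m(2)] by auto
  have "card (\<theta> ` {..m}) = Suc m" using card_image[OF m(3)] by simp
  then show "\<theta> ` {..m} \<noteq> {..n}" using m(1) by auto
  show "m < n" "\<theta> \<in> Delta m n" by (fact m)+
qed

lemma vertex_latching: "i \<le> n \<Longrightarrow> 1 \<le> n \<Longrightarrow> (0, vertex i) \<in> latching_index n"
  unfolding latching_index_def by (auto simp: vertex_Delta)

text \<open>The increasing enumeration of \<open>J\<close> is the face map.\<close>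

lemma ex_face:
  assumes "J \<subseteq> {..n}" "J \<noteq> {..n}" "J \<noteq> {}"
  obtains m \<theta> where "(m, \<theta>) \<in> latching_index n" "\<theta> ` {..m} = J"
proof -
  have fin: "finite J" using assms(1) finite_subset by blast
  then have "card J \<noteq> 0" using assms(3) by simp
  then obtain m where m: "card J = Suc m" by (cases "card J") auto
  have "card J < card {..n}" using assms by (intro psubset_card_mono) auto
  then have "m < n" using m by simp
  obtain h where h: "bij_betw h {..<card J} J" "strict_mono_on {..<card J} h"
    using ex_bij_betw_strict_mono_card[of J] fin by metis
  have eq: "{..<card J} = {..m}" unfolding m by auto
  have "(m, restrict h {..m}) \<in> latching_index n"
    unfolding latching_index_def Delta_def mem_Collect_eq prod.case
  proof (intro conjI)
    show "restrict h {..m} \<in> {..m} \<rightarrow>\<^sub>E {..n}"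
      using bij_betw_imp_surj_on[OF h(1)] assms(1) unfolding eq
        by (intro restrict_PiE_iff[THEN iffD2]) blast
    show "mono_on {..m} (restrict h {..m})"
      using monotone_onD[OF strict_mono_on_imp_mono_on[OF h(2)]] unfolding eq
      by (intro monotone_onI) simp
    show "inj_on (restrict h {..m}) {..m}"
      using bij_betw_imp_inj_on[OF h(1)] unfolding eq by (simp add: inj_on_restrict_eq)
  qed (fact \<open>m < n\<close>)
  moreover have "restrict h {..m} ` {..m} = J" using h(1) unfolding eq bij_betw_def by auto
  ultimately show ?thesis by (rule that)
qed

section \<open>The tensors form a cosimplicial resolution\<close>

context small_labels
begin

lemma tmap_tag [simp]: "tmap h \<theta> (tag (u, i) :: 'u) = tag (h u, \<theta> i)"
  by (simp add: tmap_def)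

lemma fst_untag_tmap: "fst (untag (tmap h \<theta> w :: 'u)) = h (fst (untag w))"
  and snd_untag_tmap: "snd (untag (tmap h \<theta> w :: 'u)) = \<theta> (snd (untag w))"
  by (simp_all add: tmap_def)

lemma tens_label [simp]: "u \<in> actions X \<Longrightarrow> i \<le> n \<Longrightarrow> label (tens X n) (tag (u, i) :: 'u) = label X u"
  by (simp add: tens_def)

lemma fst_untag_image: "(fst \<circ> untag) ` tag ` (L \<times> {..n :: nat}) = (L :: 'u set)"
  by (force simp: image_image)

lemma tens_ob: "X \<in> RTS_ob \<Longrightarrow> tens X n \<in> RTS_ob" for X :: "('u, 'u, 'l) ts"
  unfolding tens_def by (intro pull_RTS_ob small_tag) (auto simp: fst_untag_image RTS_ob_small)

lemma tens_proj_in_hom: "X \<in> RTS_ob \<Longrightarrow> tens_proj X n \<in> hom RTS (tens X n) X"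
  and trivfib_tens_proj: "X \<in> RTS_ob \<Longrightarrow> trivfib (tens_proj X n)"
  for X :: "('u, 'u, 'l) ts"
proof -
  assume X: "X \<in> RTS_ob"
  have small: "tag ` (actions X \<times> {..n}) \<prec> (UNIV :: 'u set)" by (intro small_tag RTS_ob_small X)
    simp
  show "tens_proj X n \<in> hom RTS (tens X n) X"
    unfolding tens_proj_def tens_def
    by (rule pull_proj_in_hom[OF X equalityD1[OF fst_untag_image] small])
  show "trivfib (tens_proj X n)"
    unfolding tens_proj_def tens_def by (rule trivfib_pull[OF X fst_untag_image small])
qed

lemma tmap_ts_map:
  fixes X Y :: "('u, 'u, 'l) ts"
  assumes X: "X \<in> RTS_ob" and f: "ts_map X Y g h" and \<theta>: "\<And>i. i \<le> m \<Longrightarrow> \<theta> i \<le> n"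
  shows "ts_map (tens X m) (tens Y n) g (tmap h \<theta>)"
proof (rule ts_mapI)
  fix \<alpha> us \<beta> assume t: "(\<alpha>, us, \<beta>) \<in> transitions (tens X m)"
  have "map (fst \<circ> untag) (map (tmap h \<theta>) us) = map h (map (fst \<circ> untag) us)"
    by (simp add: fst_untag_tmap)
  moreover have "set (map (tmap h \<theta>) us) \<subseteq> tag ` (actions Y \<times> {..n})"
    using t ts_mapD(2)[OF f] \<theta> by fastforce
  ultimately show "(g \<alpha>, map (tmap h \<theta>) us, g \<beta>) \<in> transitions (tens Y n)"
    using t ts_mapD(4)[OF f, of \<alpha> "map (fst \<circ> untag) us" \<beta>] by (simp del: map_map)
qed (use ts_mapD[OF f] \<theta> in auto)

lemma coact_in_hom:
  fixes X :: "('u, 'u, 'l) ts"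
  assumes "X \<in> RTS_ob" "\<theta> \<in> Delta m n"
  shows "arr (tens X m) (tens X n) id (tmap id \<theta>) \<in> hom RTS (tens X m) (tens X n)"
  by (intro arr_in_hom tens_ob assms(1) tmap_ts_map Delta_le[OF assms(2)]) (auto intro: ts_mapI)

lemma tens_map_in_hom:
  fixes f :: "('u, 'l) ts_arrow"
  assumes f: "f \<in> hom RTS X Y"
  shows "tens_map f n \<in> hom RTS (tens X n) (tens Y n)"
  unfolding tens_map_def hom_RTSD(1,2)[OF f]
  by (intro arr_in_hom tens_ob tmap_ts_map hom_RTSD[OF f]) auto

lemma is_cosimplicial_tens:
  fixes X :: "('u, 'u, 'l) ts"
  assumes X: "X \<in> RTS_ob"
  shows "is_cosimplicial RTS (tens_cosimp X)"
  unfolding is_cosimplicial_def tens_cosimp_simps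
proof (intro conjI allI ballI)
  fix n
  show "tens X n \<in> Ob RTS" using tens_ob[OF X] by simp
  have id: "(\<lambda>j\<in>{..n}. j) \<in> Delta n n" by (auto simp: Delta_def mono_on_def)
  show "arr (tens X n) (tens X n) id (tmap id (\<lambda>j\<in>{..n}. j)) = Id RTS (tens X n)"
    by (rule hom_RTS_eqI[OF coact_in_hom[OF X id] RTS_Id_in_hom[OF tens_ob[OF X]]]) auto
next
  fix m n \<theta> assume "\<theta> \<in> Delta m n"
  then show "arr (tens X m) (tens X n) id (tmap id \<theta>) \<in> hom RTS (tens X m) (tens X n)"
    by (rule coact_in_hom[OF X])
next
  fix k m n \<phi> \<theta> assume \<phi>: "\<phi> \<in> Delta k m" and \<theta>: "\<theta> \<in> Delta m n"
  have c: "compose {..k} \<theta> \<phi> \<in> Delta k n"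
    using Delta_le[OF \<phi>] Delta_le[OF \<theta>] \<phi> \<theta> unfolding Delta_def mono_on_def
    by (auto simp: compose_def)
  show "arr (tens X k) (tens X n) id (tmap id (compose {..k} \<theta> \<phi>)) =
    Comp RTS (arr (tens X m) (tens X n) id (tmap id \<theta>)) (arr (tens X k) (tens X m) id (tmap id \<phi>))"
    by (rule hom_RTS_eqI[OF coact_in_hom[OF X c] RTS_Comp_in_hom[OF coact_in_hom[OF X \<phi>]
      coact_in_hom[OF X \<theta>]]])
      (use Delta_le[OF \<phi>] in \<open>auto simp: compose_def\<close>)
qed

text \<open>All copies occurring in a transition lie in one proper face and hence in one component,
  so the states along it have the form \<open>tag (\<nu>, latch_comp n i)\<close> with a fixed
  component, and each axiom reduces to that of \<open>X\<close>. Parts of a transition use no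
  further copies and stay in a proper face.\<close>

lemma latch_ob:
  fixes X :: "('u, 'u, 'l) ts"
  assumes X: "X \<in> RTS_ob"
  shows "latch X n \<in> RTS_ob"
proof -
  let ?J = "\<lambda>us :: 'u list. (snd \<circ> untag) ` set us"
  let ?\<pi> = "map (fst \<circ> untag) :: 'u list \<Rightarrow> 'u list"
  let ?A = "tag ` (actions X \<times> {..n})"
  note tr = RTS_trans[OF X]
  have J: "?J us \<subseteq> {..n}" if "set us \<subseteq> ?A" for us using that by auto
  have mono: "?J us \<noteq> {..n}" if "?J vs \<noteq> {..n}" "set us \<subseteq> set vs" "set vs \<subseteq> ?A" for us vs
    using that J[OF that(3)] by blast
  \<comment> \<open>Introduction of transitions, and elimination in \<open>TE\<close>, relative to
    any index \<open>i\<close> occurring in the word; by \<open>latch_comp_const\<close> the choice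
    of \<open>i\<close> does not matter.\<close>
  have T: "(tag (\<alpha>, latch_comp n i), us, tag (\<beta>, latch_comp n i)) \<in> transitions (latch X n)"
    if "1 \<le> n" "set us \<subseteq> ?A" "?J us \<noteq> {..n}" "(\<alpha>, ?\<pi> us, \<beta>) \<in> transitions X" "i \<in> ?J us"
      for \<alpha> us \<beta> i
    unfolding latch_simps using that latch_comp_const[OF J[OF that(2)] that(3,5)]
    by (intro exI[of _ \<alpha>] exI[of _ \<beta>]) auto
  have TE: "\<exists>\<alpha> \<beta>. a = tag (\<alpha>, latch_comp n i) \<and> b = tag (\<beta>, latch_comp n i) \<and> 1 \<le> n \<and> set us \<subseteq> ?A \<and>
      ?J us \<noteq> {..n} \<and> (\<alpha>, ?\<pi> us, \<beta>) \<in> transitions X"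
    if "(a, us, b) \<in> transitions (latch X n)" "i \<in> ?J us" for a us b i
    using that unfolding latch_simps by blast
  have TE0: "1 \<le> n \<and> set us \<subseteq> ?A \<and> ?J us \<noteq> {..n} \<and> us \<noteq> [] \<and> (\<exists>i. i \<in> ?J us \<and> i \<le> n)"
    if t: "(a, us, b) \<in> transitions (latch X n)" for a us b
  proof -
    from t have a: "1 \<le> n" "set us \<subseteq> ?A" "?J us \<noteq> {..n}" "\<exists>\<alpha> \<beta>. (\<alpha>, ?\<pi> us, \<beta>) \<in> transitions X"
      unfolding latch_simps by blast+
    from a(4) obtain \<alpha> \<beta> where "(\<alpha>, ?\<pi> us, \<beta>) \<in> transitions X" by blast
    from tr(2)[OF this] have "us \<noteq> []" by simp
    then obtain w where "w \<in> set us" by (cases us) auto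
    then have "(snd \<circ> untag) w \<in> ?J us" "(snd \<circ> untag) w \<le> n" using a(2) by auto
    then show ?thesis using a \<open>us \<noteq> []\<close> by blast
  qed
  have "regular_ts (latch X n)"
  proof (rule regular_tsI)
    fix a us b assume t: "(a, us, b) \<in> transitions (latch X n)"
    obtain i where i: "i \<in> ?J us" "i \<le> n" using TE0[OF t] by blast
    from TE[OF t i(1)] TE0[OF t] i(2) tr
    show "a \<in> states (latch X n) \<and> us \<noteq> [] \<and> set us \<subseteq> actions (latch X n) \<and> b \<in> states (latch X n)"
      unfolding latch_simps by blast
  next
    fix a us b vs assume t: "(a, us, b) \<in> transitions (latch X n)" and m: "mset vs = mset us"
    obtain i where i: "i \<in> ?J us" using TE0[OF t] by blast
    obtain \<alpha> \<beta> where e: "a = tag (\<alpha>, latch_comp n i)" "b = tag (\<beta>, latch_comp n i)" "1 \<le> n"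
      "set us \<subseteq> ?A"
      "?J us \<noteq> {..n}" "(\<alpha>, ?\<pi> us, \<beta>) \<in> transitions X" using TE[OF t i] by blast
    have "(\<alpha>, ?\<pi> vs, \<beta>) \<in> transitions X" using RTS_perm[OF X e(6), of "?\<pi> vs"] m by simp
    then show "(a, vs, b) \<in> transitions (latch X n)"
      unfolding e(1,2) using mset_eq_setD[OF m] e i by (intro T) auto
  next
    fix a b c1 c2 us vs ws
    assume n: "us \<noteq> []" "vs \<noteq> []" "ws \<noteq> []" and t: "(a, us @ vs @ ws, b) \<in> transitions (latch X n)"
      and 1: "(a, us, c1) \<in> transitions (latch X n)" "(c1, vs @ ws, b) \<in> transitions (latch X n)"
      and 2: "(a, us @ vs, c2) \<in> transitions (latch X n)" "(c2, ws, b) \<in> transitions (latch X n)"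
    have j: "(snd \<circ> untag) (hd us) \<in> ?J us" "(snd \<circ> untag) (hd vs) \<in> ?J vs" "(snd \<circ> untag) (hd ws) \<in>
      ?J ws"
      using n by (auto intro!: imageI)
    define i where "i = (snd \<circ> untag) (hd vs)"
    have ij: "i \<in> ?J (us @ vs @ ws)" using j unfolding i_def by auto
    obtain \<alpha> \<beta> where e: "a = tag (\<alpha>, latch_comp n i)" "b = tag (\<beta>, latch_comp n i)" "1 \<le> n"
      "set (us @ vs @ ws) \<subseteq> ?A" "?J (us @ vs @ ws) \<noteq> {..n}" "(\<alpha>, ?\<pi> (us @ vs @ ws), \<beta>) \<in> transitions
        X"
      using TE[OF t ij] by blast
    note const = latch_comp_const[OF J[OF e(4)] e(5)]
    have "latch_comp n ((snd \<circ> untag) (hd us)) = latch_comp n i" "latch_comp n ((snd \<circ> untag) (hd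
      ws)) = latch_comp n i"
      unfolding i_def using j by (intro const; auto)+
    note const = this
    obtain \<nu>1 where c1: "c1 = tag (\<nu>1, latch_comp n i)" "(\<alpha>, ?\<pi> us, \<nu>1) \<in> transitions X"
      using TE[OF 1(1) j(1)] unfolding const e(1) by auto
    have c1': "(\<nu>1, ?\<pi> (vs @ ws), \<beta>) \<in> transitions X"
      using TE[OF 1(2), of i] j(2) unfolding c1 e(2) i_def by auto
    obtain \<nu>2 where c2: "c2 = tag (\<nu>2, latch_comp n i)" "(\<nu>2, ?\<pi> ws, \<beta>) \<in> transitions X"
      using TE[OF 2(2) j(3)] unfolding const e(2) by auto
    have c2': "(\<alpha>, ?\<pi> (us @ vs), \<nu>2) \<in> transitions X"
      using TE[OF 2(1), of i] j(2) unfolding c2 e(1) i_def by auto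
    have "(\<nu>1, ?\<pi> vs, \<nu>2) \<in> transitions X"
      by (rule RTS_compose[OF X, of "?\<pi> us" "?\<pi> vs" "?\<pi> ws" \<alpha> \<beta> \<nu>1 \<nu>2]) (use n e c1 c1' c2 c2' in
        auto)
    then show "(c1, vs, c2) \<in> transitions (latch X n)"
      unfolding c1 c2 using e mono[OF e(5) _ e(4), of vs] j unfolding i_def by (intro T) auto
  next
    fix u assume "u \<in> actions (latch X n)"
    then obtain v i where u: "u = tag (v, i)" "v \<in> actions X" "i \<le> n" "1 \<le> n" unfolding latch_simps
      by auto
    obtain \<alpha> \<beta> where "(\<alpha>, [v], \<beta>) \<in> transitions X" using RTS_used[OF X u(2)] by blast
    \<comment> \<open>A vertex is a proper face because n is at least 1.\<close>
    moreover have "{i} \<noteq> {..n}"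
    proof
      assume "{i} = {..n}"
      then have "card {i} = card {..n}" by simp
      then show False using u(4) by simp
    qed
    ultimately have "(tag (\<alpha>, latch_comp n i), [u], tag (\<beta>, latch_comp n i)) \<in> transitions (latch X
      n)"
      using u by (intro T) auto
    then show "\<exists>a b. (a, [u], b) \<in> transitions (latch X n)" by blast
  next
    fix a us vs b
    assume n: "us \<noteq> []" "vs \<noteq> []" and t: "(a, us @ vs, b) \<in> transitions (latch X n)"
    have j: "(snd \<circ> untag) (hd us) \<in> ?J us" "(snd \<circ> untag) (hd vs) \<in> ?J vs"
      using n by (auto intro!: imageI)
    define i where "i = (snd \<circ> untag) (hd us)"
    have ij: "i \<in> ?J (us @ vs)" using j unfolding i_def by auto
    obtain \<alpha> \<beta> where e: "a = tag (\<alpha>, latch_comp n i)" "b = tag (\<beta>, latch_comp n i)" "1 \<le> n"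
      "set (us @ vs) \<subseteq> ?A" "?J (us @ vs) \<noteq> {..n}" "(\<alpha>, ?\<pi> (us @ vs), \<beta>) \<in> transitions X"
      using TE[OF t ij] by blast
    have const: "latch_comp n i = latch_comp n ((snd \<circ> untag) (hd vs))"
      unfolding i_def using j by (intro latch_comp_const[OF J[OF e(4)] e(5)]; auto)
    obtain \<nu> where \<nu>: "(\<alpha>, ?\<pi> us, \<nu>) \<in> transitions X" "(\<nu>, ?\<pi> vs, \<beta>) \<in> transitions X"
      using RTS_split[OF X, of "?\<pi> us" "?\<pi> vs" \<alpha> \<beta>] n e(6) by (metis map_append map_is_Nil_conv)
    have "(a, us, tag (\<nu>, latch_comp n i)) \<in> transitions (latch X n)"
      unfolding e(1) using \<nu> e mono[OF e(5) _ e(4), of us] j unfolding i_def by (intro T) auto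
    moreover have "(tag (\<nu>, latch_comp n i), vs, b) \<in> transitions (latch X n)"
      unfolding e(2) const using \<nu> e mono[OF e(5) _ e(4), of vs] j by (intro T) auto
    ultimately show "\<exists>c. (a, us, c) \<in> transitions (latch X n) \<and> (c, vs, b) \<in> transitions (latch X
      n)" by blast
  next
    fix a us vs b c c'
    assume n: "us \<noteq> []" "vs \<noteq> []" and t: "(a, us @ vs, b) \<in> transitions (latch X n)"
      and c: "(a, us, c) \<in> transitions (latch X n)" "(c, vs, b) \<in> transitions (latch X n)"
      and c': "(a, us, c') \<in> transitions (latch X n)" "(c', vs, b) \<in> transitions (latch X n)"
    have j: "(snd \<circ> untag) (hd us) \<in> ?J us" "(snd \<circ> untag) (hd vs) \<in> ?J vs"
      using n by (auto intro!: imageI)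
    define i where "i = (snd \<circ> untag) (hd us)"
    have ij: "i \<in> ?J (us @ vs)" using j unfolding i_def by auto
    obtain \<alpha> \<beta> where e: "a = tag (\<alpha>, latch_comp n i)" "b = tag (\<beta>, latch_comp n i)" "1 \<le> n"
      "set (us @ vs) \<subseteq> ?A" "?J (us @ vs) \<noteq> {..n}" "(\<alpha>, ?\<pi> (us @ vs), \<beta>) \<in> transitions X"
      using TE[OF t ij] by blast
    obtain \<nu> where \<nu>: "c = tag (\<nu>, latch_comp n i)" "(\<alpha>, ?\<pi> us, \<nu>) \<in> transitions X"
      using TE[OF c(1) j(1)] unfolding e(1) i_def by auto
    obtain \<nu>' where \<nu>': "c' = tag (\<nu>', latch_comp n i)" "(\<alpha>, ?\<pi> us, \<nu>') \<in> transitions X"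
      using TE[OF c'(1) j(1)] unfolding e(1) i_def by auto
    have "(\<nu>, ?\<pi> vs, \<beta>) \<in> transitions X" "(\<nu>', ?\<pi> vs, \<beta>) \<in> transitions X"
      using TE[OF c(2) j(2)] TE[OF c'(2) j(2)] unfolding \<nu> \<nu>' e(2) by auto
    then show "c = c'"
      using RTS_split_unique[OF X X, of "?\<pi> us" "?\<pi> vs" \<alpha> \<beta> \<nu> \<nu>'] \<nu> \<nu>' e(6) n by simp
  qed
  moreover have "states (latch X n) \<prec> (UNIV :: 'u set)"
  proof (rule small_subset)
    show "states (latch X n) \<subseteq> tag ` (states X \<times> {..n})"
      unfolding latch_simps latch_comp_def by auto
    show "tag ` (states X \<times> {..n}) \<prec> (UNIV :: 'u set)" by (intro small_tag RTS_ob_small X) simp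
  qed
  moreover have "actions (latch X n) \<prec> (UNIV :: 'u set)"
  proof (rule small_subset)
    show "actions (latch X n) \<subseteq> tag ` (actions X \<times> {..n})" unfolding latch_simps by auto
    show "tag ` (actions X \<times> {..n}) \<prec> (UNIV :: 'u set)" by (intro small_tag RTS_ob_small X) simp
  qed
  ultimately show ?thesis unfolding RTS_ob_def by (simp add: latch_simps)
qed

lemma latch_cocone_in_hom:
  fixes X :: "('u, 'u, 'l) ts"
  assumes X: "X \<in> RTS_ob" and i: "(m, \<theta>) \<in> latching_index n"
  shows "latch_cocone X n (m, \<theta>) \<in> hom RTS (tens X m) (latch X n)"
  unfolding latch_cocone_def prod.case
proof (intro arr_in_hom tens_ob latch_ob X, rule ts_mapI)
  note l = latching_image[OF i]
  note le = Delta_le[OF l(4)]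
  fix \<alpha> us \<beta> assume t: "(\<alpha>, us, \<beta>) \<in> transitions (tens X m)"
  have J: "(snd \<circ> untag) ` set (map (tmap id \<theta>) us) \<subseteq> \<theta> ` {..m}"
    using t by (auto simp: snd_untag_tmap)
  have "latch_comp n (\<theta> 0) = latch_comp n j" if "j \<in> (snd \<circ> untag) ` set (map (tmap id \<theta>) us)" for j
    using that J by (intro latch_comp_const[OF l(1,2)]) auto
  moreover have "map (fst \<circ> untag) (map (tmap id \<theta>) us) = map (fst \<circ> untag) us"
    by (simp add: fst_untag_tmap)
  moreover have "set (map (tmap id \<theta>) us) \<subseteq> tag ` (actions X \<times> {..n})" using t le by fastforce
  moreover have "(snd \<circ> untag) ` set (map (tmap id \<theta>) us) \<noteq> {..n}" using J l(1,2) by blast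
  ultimately show "(tag (\<alpha>, latch_comp n (\<theta> 0)), map (tmap id \<theta>) us, tag (\<beta>, latch_comp n (\<theta> 0)))
    \<in> transitions (latch X n)"
    unfolding latch_simps using t l(3) by (intro exI[of _ \<alpha>] exI[of _ \<beta>]) (auto simp del: map_map)
qed (use latching_image[OF i] Delta_le[OF latching_image(4)[OF i]] in \<open>auto simp: latch_simps\<close>)

lemma latch_arr_in_hom:
  fixes X :: "('u, 'u, 'l) ts"
  assumes X: "X \<in> RTS_ob"
  shows "latch_arr X n \<in> hom RTS (latch X n) (tens X n)"
  unfolding latch_arr_def
proof (intro arr_in_hom tens_ob latch_ob X, rule ts_mapI)
  fix a us b assume t: "(a, us, b) \<in> transitions (latch X n)"
  then obtain \<alpha> \<beta> where e: "set us \<subseteq> tag ` (actions X \<times> {..n})" "(\<alpha>, map (fst \<circ> untag) us, \<beta>) \<in>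
    transitions X"
     "\<forall>i \<in> (snd \<circ> untag) ` set us. a = tag (\<alpha>, latch_comp n i) \<and> b = tag (\<beta>, latch_comp n i)"
    unfolding latch_simps by blast
  from RTS_trans(2)[OF X e(2)] have "us \<noteq> []" by simp
  then have "(fst \<circ> untag) a = \<alpha>" "(fst \<circ> untag) b = \<beta>" using e(3) by (cases us; simp)+
  then show "((fst \<circ> untag) a, map id us, (fst \<circ> untag) b) \<in> transitions (tens X n)" using e by simp
qed (auto simp: latch_simps)

text \<open>A cocone is determined by its values at the vertices [0] -> [n]: copy j of an action in
  \<open>tens X m\<close> is the image of the single copy in \<open>tens X 0\<close> under the
  vertex j. Conversely, a transition of \<open>latch X n\<close> uses the copies of some proper
  face, and the component of the cocone at that face sends it to a transition.\<close>

lemma latch_colimit: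
  fixes X :: "('u, 'u, 'l) ts"
  assumes X: "X \<in> RTS_ob"
  shows "is_colimit RTS (latching_index n) (\<lambda>(m, \<theta>). cobj (tens_cosimp X) m)
    (latching_edges (tens_cosimp X) n) (latch X n) (latch_cocone X n)"
  unfolding is_colimit_def
proof (intro conjI allI impI)
  show "is_cocone RTS (latching_index n) (\<lambda>(m, \<theta>). cobj (tens_cosimp X) m)
    (latching_edges (tens_cosimp X) n) (latch X n) (latch_cocone X n)"
    unfolding is_cocone_def
  proof (intro conjI ballI)
    show "latch X n \<in> Ob RTS" using latch_ob[OF X] by simp
    fix j assume "j \<in> latching_index n"
    then show "latch_cocone X n j \<in> hom RTS (case j of (m, \<theta>) \<Rightarrow> cobj (tens_cosimp X) m) (latch X n)"
      using latch_cocone_in_hom[OF X] by (cases j) simp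
  next
    fix e assume "e \<in> latching_edges (tens_cosimp X) n"
    then obtain k \<theta> m \<theta>' \<phi> where e: "e = ((k, \<theta>), coact (tens_cosimp X) k m \<phi>, (m, \<theta>'))"
      and i: "(k, \<theta>) \<in> latching_index n" "(m, \<theta>') \<in> latching_index n" and \<phi>: "\<phi> \<in> Delta k m"
      and comp: "compose {..k} \<theta>' \<phi> = \<theta>"
      unfolding latching_edges_def by blast
    have c: "\<theta>' (\<phi> j) = \<theta> j" if "j \<le> k" for j using comp that by (auto simp: compose_def)
    note l = latching_image[OF i(2)]
    have const: "latch_comp n (\<theta>' 0) = latch_comp n (\<theta> 0)"
      using c[of 0] Delta_le[OF \<phi>, of 0] by (intro latch_comp_const[OF l(1,2)]) (auto simp flip: c)
    have "Comp RTS (latch_cocone X n (m, \<theta>')) (coact (tens_cosimp X) k m \<phi>) = latch_cocone X n (k,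
      \<theta>)"
      unfolding tens_cosimp_simps
      by (rule hom_RTS_eqI[OF RTS_Comp_in_hom[OF coact_in_hom[OF X \<phi>] latch_cocone_in_hom[OF X
        i(2)]]
            latch_cocone_in_hom[OF X i(1)]])
        (use c Delta_le[OF \<phi>] const in \<open>auto simp: latch_cocone_def\<close>)
    then show "case e of (j, f, k) \<Rightarrow> Comp RTS (latch_cocone X n k) f = latch_cocone X n j"
      unfolding e by simp
  qed
next
  fix Z :: "('u, 'u, 'l) ts" and c
  assume co: "is_cocone RTS (latching_index n) (\<lambda>(m, \<theta>). cobj (tens_cosimp X) m)
    (latching_edges (tens_cosimp X) n) Z c"
  have Z: "Z \<in> RTS_ob" using co unfolding is_cocone_def by simp
  have ch: "c (m, \<theta>) \<in> hom RTS (tens X m) Z" if "(m, \<theta>) \<in> latching_index n" for m \<theta>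
    using co that unfolding is_cocone_def by fastforce
  define d where "d i = c (0, vertex i)" for i
  have dh: "d i \<in> hom RTS (tens X 0) Z" if "i \<le> n" "1 \<le> n" for i
    unfolding d_def by (rule ch[OF vertex_latching[OF that]])
  have edge: "Comp RTS (c (m, \<theta>)) (arr (tens X 0) (tens X m) id (tmap id (vertex j))) = d (\<theta> j)"
    if i: "(m, \<theta>) \<in> latching_index n" and j: "j \<le> m" for m \<theta> j
  proof -
    note l = latching_image[OF i]
    have "((0, vertex (\<theta> j)), coact (tens_cosimp X) 0 m (vertex j), (m, \<theta>)) \<in> latching_edges
      (tens_cosimp X) n"
      unfolding latching_edges_def mem_Collect_eq
      by (intro exI[of _ 0] exI[of _ "vertex (\<theta> j)"] exI[of _ m] exI[of _ \<theta>] exI[of _ "vertex j"])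
       (use i vertex_latching[of "\<theta> j" n] vertex_Delta[OF j] Delta_vertex[OF l(4) j] Delta_le[OF
         l(4) j] l(3)
      in \<open>auto simp: atMost_0\<close>)
    then show ?thesis using co unfolding is_cocone_def d_def by auto
  qed
  have cs: "on_states (c (m, \<theta>)) \<alpha> = on_states (d (\<theta> j)) \<alpha>"
    if i: "(m, \<theta>) \<in> latching_index n" and j: "j \<le> m" and \<alpha>: "\<alpha> \<in> states X" for m \<theta> j \<alpha>
    using arg_cong[OF edge[OF i j], of "\<lambda>k. on_states k \<alpha>"] \<alpha> by simp
  have ca: "on_actions (c (m, \<theta>)) (tag (u, j)) = on_actions (d (\<theta> j)) (tag (u, 0))"
    if i: "(m, \<theta>) \<in> latching_index n" and j: "j \<le> m" and u: "u \<in> actions X" for m \<theta> j u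
    using arg_cong[OF edge[OF i j], of "\<lambda>k. on_actions k (tag (u, 0))"] u by (simp add: vertex_def)
  \<comment> \<open>For n at least 2 the edge from 0 to i is a proper face, so the cocone takes the
    same values on states at the vertices 0 and i.\<close>
  have ds: "on_states (d (latch_comp n i)) \<alpha> = on_states (d i) \<alpha>"
    if i: "i \<le> n" and \<alpha>: "\<alpha> \<in> states X" for i \<alpha>
  proof (cases "n = 1 \<or> i = 0")
    case True
    then show ?thesis by (auto simp: latch_comp_def)
  next
    case False
    define \<theta> :: "nat \<Rightarrow> nat" where "\<theta> = (\<lambda>j\<in>{..1}. if j = 0 then 0 else i)"
    have "(1, \<theta>) \<in> latching_index n"
      using False i unfolding latching_index_def Delta_def \<theta>_def mono_on_def inj_on_def by auto
    from cs[OF this, of 0 \<alpha>] cs[OF this, of 1 \<alpha>] show ?thesis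
      using False \<alpha> by (simp add: \<theta>_def latch_comp_def)
  qed
  define hs where "hs a = on_states (d (snd (untag a))) (fst (untag a))" for a
  define ha where "ha w = on_actions (d (snd (untag w))) (tag (fst (untag w), 0))" for w
  have "ts_map (latch X n) Z hs ha"
  proof (rule ts_mapI)
    fix a assume "a \<in> states (latch X n)"
    then obtain \<alpha> i where "a = tag (\<alpha>, latch_comp n i)" "\<alpha> \<in> states X" "i \<le> n" "1 \<le> n"
      unfolding latch_simps by blast
    then show "hs a \<in> states Z" using hom_RTSD(6)[OF dh, of i \<alpha>] ds by (simp add: hs_def)
  next
    fix w assume "w \<in> actions (latch X n)"
    then obtain u i where w: "w = tag (u, i)" "u \<in> actions X" "i \<le> n" "1 \<le> n"
      unfolding latch_simps by auto
    note di = hom_RTSD(7,8)[OF dh[OF w(3,4)], of "tag (u, 0)"]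
    show "ha w \<in> actions Z" using di(1) w by (simp add: ha_def)
    show "label Z (ha w) = label (latch X n) w" using di(2) w by (simp add: ha_def latch_simps)
  next
    fix a us b assume "(a, us, b) \<in> transitions (latch X n)"
    then obtain \<alpha> \<beta> where e: "1 \<le> n" "set us \<subseteq> tag ` (actions X \<times> {..n})"
      "(snd \<circ> untag) ` set us \<noteq> {..n}"
      "(\<alpha>, map (fst \<circ> untag) us, \<beta>) \<in> transitions X"
      "\<forall>i \<in> (snd \<circ> untag) ` set us. a = tag (\<alpha>, latch_comp n i) \<and> b = tag (\<beta>, latch_comp n i)"
      unfolding latch_simps by blast
    note tr = RTS_trans[OF X e(4)]
    have "(snd \<circ> untag) ` set us \<subseteq> {..n}" using e(2) by auto
    \<comment> \<open>The face spanned by exactly the copies that occur; \<open>\<psi>\<close> below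
      renumbers them as vertices of [m].\<close>
    then obtain m \<theta> where \<theta>: "(m, \<theta>) \<in> latching_index n" "\<theta> ` {..m} = (snd \<circ> untag) ` set us"
      using e(3) tr(2) by (elim ex_face) auto
    define \<psi> where "\<psi> = inv_into {..m} \<theta>"
    have \<psi>: "\<psi> (snd (untag w)) \<le> m" "\<theta> (\<psi> (snd (untag w))) = snd (untag w)" if "w \<in> set us" for w
    proof -
      have "snd (untag w) \<in> \<theta> ` {..m}" unfolding \<theta>(2) using that by auto
      from inv_into_into[OF this] f_inv_into_f[OF this]
      show "\<psi> (snd (untag w)) \<le> m" "\<theta> (\<psi> (snd (untag w))) = snd (untag w)" unfolding \<psi>_def by auto
    qed
    have "map (fst \<circ> untag) (map (tmap id \<psi>) us) = map (fst \<circ> untag) us"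
      by (simp add: fst_untag_tmap)
    moreover have "set (map (tmap id \<psi>) us) \<subseteq> tag ` (actions X \<times> {..m})"
      using e(2) \<psi>(1) by (fastforce simp: tmap_def)
    ultimately have "(\<alpha>, map (tmap id \<psi>) us, \<beta>) \<in> transitions (tens X m)"
      using e(4) by (simp del: map_map)
    from hom_RTSD(9)[OF ch[OF \<theta>(1)] this]
    have t: "(on_states (c (m, \<theta>)) \<alpha>, map (on_actions (c (m, \<theta>))) (map (tmap id \<psi>) us),
      on_states (c (m, \<theta>)) \<beta>) \<in> transitions Z" .
    have "map (on_actions (c (m, \<theta>))) (map (tmap id \<psi>) us) = map ha us"
    proof (unfold map_map, rule map_cong[OF refl])
      fix w assume w: "w \<in> set us"
      then obtain u i where ui: "w = tag (u, i)" "u \<in> actions X" using e(2) by auto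
      then show "(on_actions (c (m, \<theta>)) \<circ> tmap id \<psi>) w = ha w"
        using ca[OF \<theta>(1), of "\<psi> i" u] \<psi>[OF w] by (simp add: ha_def)
    qed
    moreover obtain w where w: "w \<in> set us" using tr(2) by (cases us) auto
    let ?i = "snd (untag w)"
    have i: "?i \<le> n" "a = tag (\<alpha>, latch_comp n ?i)" "b = tag (\<beta>, latch_comp n ?i)" using e(2,5) w
      by auto
    have "hs a = on_states (c (m, \<theta>)) \<alpha>"
      using cs[OF \<theta>(1) \<psi>(1)[OF w] tr(1)] \<psi>(2)[OF w] ds[OF i(1) tr(1)] i(2) by (simp add: hs_def)
    moreover have "hs b = on_states (c (m, \<theta>)) \<beta>"
      using cs[OF \<theta>(1) \<psi>(1)[OF w] tr(4)] \<psi>(2)[OF w] ds[OF i(1) tr(4)] i(3) by (simp add: hs_def)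
    ultimately show "(hs a, map ha us, hs b) \<in> transitions Z" using t by metis
  qed
  then have h: "arr (latch X n) Z hs ha \<in> hom RTS (latch X n) Z" (is "?h \<in> _")
    by (rule arr_in_hom[OF latch_ob[OF X] Z])
  show "\<exists>!h. h \<in> hom RTS (latch X n) Z \<and> (\<forall>j\<in>latching_index n. Comp RTS h (latch_cocone X n j) =
    c j)"
  proof (rule ex1I[of _ ?h], intro conjI ballI h)
    fix j assume j: "j \<in> latching_index n"
    obtain m \<theta> where mt: "j = (m, \<theta>)" by (cases j)
    note i = j[unfolded mt]
    note l = latching_image[OF i]
    have "Comp RTS ?h (latch_cocone X n (m, \<theta>)) = c (m, \<theta>)"
    proof (rule hom_RTS_eqI[OF RTS_Comp_in_hom[OF latch_cocone_in_hom[OF X i] h] ch[OF i]])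
      fix \<alpha> assume \<alpha>: "\<alpha> \<in> states (tens X m)"
      then have "tag (\<alpha>, latch_comp n (\<theta> 0)) \<in> states (latch X n)"
        using l(3) Delta_le[OF l(4), of 0] by (auto simp: latch_simps)
      then show "on_states (Comp RTS ?h (latch_cocone X n (m, \<theta>))) \<alpha> = on_states (c (m, \<theta>)) \<alpha>"
        using \<alpha> cs[OF i, of 0 \<alpha>] ds[of "\<theta> 0" \<alpha>] Delta_le[OF l(4), of 0]
          by (simp add: latch_cocone_def hs_def)
    next
      fix w assume w: "w \<in> actions (tens X m)"
      then obtain u k where uk: "w = tag (u, k)" "u \<in> actions X" "k \<le> m" by auto
      have "tag (u, \<theta> k) \<in> actions (latch X n)"
        using l(3) Delta_le[OF l(4) uk(3)] uk(2) by (auto simp: latch_simps)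
      then show "on_actions (Comp RTS ?h (latch_cocone X n (m, \<theta>))) w = on_actions (c (m, \<theta>)) w"
        using w uk ca[OF i uk(3,2)] by (simp add: latch_cocone_def ha_def)
    qed
    then show "Comp RTS ?h (latch_cocone X n j) = c j" unfolding mt .
  next
    fix k assume k: "k \<in> hom RTS (latch X n) Z \<and> (\<forall>j\<in>latching_index n. Comp RTS k (latch_cocone X n
      j) = c j)"
    show "k = ?h"
    proof (rule hom_RTS_eqI[OF conjunct1[OF k] h])
      fix a assume a: "a \<in> states (latch X n)"
      then obtain \<alpha> i where e: "a = tag (\<alpha>, latch_comp n i)" "\<alpha> \<in> states X" "i \<le> n" "1 \<le> n"
        unfolding latch_simps by blast
      have "Comp RTS k (latch_cocone X n (0, vertex i)) = d i"
        using k vertex_latching[OF e(3,4)] unfolding d_def by blast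
      from arg_cong[OF this, of "\<lambda>k. on_states k \<alpha>"]
      show "on_states k a = on_states ?h a"
        using a e ds[OF e(3,2)] by (simp add: latch_cocone_def vertex_def hs_def)
    next
      fix w assume w: "w \<in> actions (latch X n)"
      then obtain u i where e: "w = tag (u, i)" "u \<in> actions X" "i \<le> n" "1 \<le> n"
        unfolding latch_simps by auto
      have "Comp RTS k (latch_cocone X n (0, vertex i)) = d i"
        using k vertex_latching[OF e(3,4)] unfolding d_def by blast
      from arg_cong[OF this, of "\<lambda>k. on_actions k (tag (u, 0))"]
      show "on_actions k w = on_actions ?h w"
        using w e by (simp add: latch_cocone_def vertex_def ha_def)
    qed
  qed
qed

text \<open>The latching maps are the identity on actions, hence cofibrations, and the projections
  to \<open>X\<close> are trivial fibrations, hence weak equivalences.\<close>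

lemma tens_resolution:
  fixes X :: "('u, 'u, 'l) ts"
  assumes X: "X \<in> RTS_ob"
  shows "cosimplicial_resolution RTS RTS_model X (tens_cosimp X) (tens_proj X)"
  unfolding cosimplicial_resolution_def reedy_cofibrant_def
proof (intro conjI allI ballI)
  show "X \<in> Ob RTS" using X by simp
  show "is_cosimplicial RTS (tens_cosimp X)" by (rule is_cosimplicial_tens[OF X])
  fix n
  note lh = latch_arr_in_hom[OF X, of n]
  have "Comp RTS (latch_arr X n) (latch_cocone X n (m, \<theta>)) = coact (tens_cosimp X) m n \<theta>"
    if i: "(m, \<theta>) \<in> latching_index n" for m \<theta>
    unfolding tens_cosimp_simps
  proof (rule hom_RTS_eqI[OF RTS_Comp_in_hom[OF latch_cocone_in_hom[OF X i] lh] coact_in_hom[OF X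
    latching_image(4)[OF i]]])
    fix \<alpha> assume "\<alpha> \<in> states (tens X m)"
    then show "on_states (Comp RTS (latch_arr X n) (latch_cocone X n (m, \<theta>))) \<alpha> =
        on_states (arr (tens X m) (tens X n) id (tmap id \<theta>)) \<alpha>"
      using hom_RTSD(6)[OF latch_cocone_in_hom[OF X i], of \<alpha>]
        by (simp add: latch_cocone_def latch_arr_def)
  next
    fix u assume "u \<in> actions (tens X m)"
    then show "on_actions (Comp RTS (latch_arr X n) (latch_cocone X n (m, \<theta>))) u =
        on_actions (arr (tens X m) (tens X n) id (tmap id \<theta>)) u"
      using hom_RTSD(7)[OF latch_cocone_in_hom[OF X i], of u]
        by (simp add: latch_cocone_def latch_arr_def)
  qed
  moreover have "latch_arr X n \<in> cof RTS_model"
    using hom_Ar[OF lh] by (simp add: RTS_model_simps action_inj_def inj_on_def latch_arr_def)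
  ultimately show "\<exists>L c h. is_colimit RTS (latching_index n) (\<lambda>(m, \<theta>). cobj (tens_cosimp X) m)
      (latching_edges (tens_cosimp X) n) L c \<and> h \<in> hom RTS L (cobj (tens_cosimp X) n) \<and>
      (\<forall>(m, \<theta>)\<in>latching_index n. Comp RTS h (c (m, \<theta>)) = coact (tens_cosimp X) m n \<theta>) \<and>
        h \<in> cof RTS_model"
    using latch_colimit[OF X] lh by (intro exI conjI) auto
next
  fix n
  show "tens_proj X n \<in> hom RTS (cobj (tens_cosimp X) n) X" using tens_proj_in_hom[OF X] by simp
  show "tens_proj X n \<in> weq RTS_model" by (rule trivfib_weq[OF trivfib_tens_proj[OF X]])
next
  fix m n \<theta> assume \<theta>: "\<theta> \<in> Delta m n"
  show "Comp RTS (tens_proj X n) (coact (tens_cosimp X) m n \<theta>) = tens_proj X m"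
    unfolding tens_cosimp_simps
    by (rule hom_RTS_eqI[OF RTS_Comp_in_hom[OF coact_in_hom[OF X \<theta>] tens_proj_in_hom[OF X]]
      tens_proj_in_hom[OF X]])
      (use Delta_le[OF \<theta>] in \<open>auto simp: tens_proj_def\<close>)
qed

lemma tens_map_cosimplicial:
  fixes f :: "('u, 'l) ts_arrow"
  assumes f: "f \<in> hom RTS X Y"
  shows "cosimplicial_map RTS (tens_cosimp X) (tens_cosimp Y) (tens_map f)"
    "Comp RTS (tens_proj Y n) (tens_map f n) = Comp RTS f (tens_proj X n)"
proof -
  note fD = hom_RTSD[OF f] and th = tens_map_in_hom[OF f]
  show "cosimplicial_map RTS (tens_cosimp X) (tens_cosimp Y) (tens_map f)"
    unfolding cosimplicial_map_def tens_cosimp_simps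
  proof (intro conjI allI ballI th)
    fix m n \<theta> assume \<theta>: "\<theta> \<in> Delta m n"
    show "Comp RTS (arr (tens Y m) (tens Y n) id (tmap id \<theta>)) (tens_map f m) =
      Comp RTS (tens_map f n) (arr (tens X m) (tens X n) id (tmap id \<theta>))"
      by (rule hom_RTS_eqI[OF RTS_Comp_in_hom[OF th coact_in_hom[OF fD(4) \<theta>]]
            RTS_Comp_in_hom[OF coact_in_hom[OF fD(3) \<theta>] th]])
        (use fD Delta_le[OF \<theta>] in \<open>auto simp: tens_map_def\<close>)
  qed
  show "Comp RTS (tens_proj Y n) (tens_map f n) = Comp RTS f (tens_proj X n)"
    by (rule hom_RTS_eqI[OF RTS_Comp_in_hom[OF th tens_proj_in_hom[OF fD(4)]]
          RTS_Comp_in_hom[OF tens_proj_in_hom[OF fD(3)] f]])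
      (use fD in \<open>auto simp: tens_map_def tens_proj_def\<close>)
qed

end

section \<open>Systems with injective labelling map\<close>

text \<open>These turn out to be the injective objects for the maps p_x
  (\<open>injective_object_p_maps\<close>).\<close>

definition label_inj :: "('u, 'u, 'l) ts set" where
  "label_inj = {Z \<in> RTS_ob. inj_on (label Z) (actions Z)}"

lemma label_injD:
  assumes "Z \<in> label_inj"
  shows "Z \<in> RTS_ob" "CSA1 Z" "u \<in> actions Z \<Longrightarrow> v \<in> actions Z \<Longrightarrow> label Z u = label Z v \<Longrightarrow> u = v"
  using assms CSA1_if_inj_label RTS_ob_weak unfolding label_inj_def by (auto dest: inj_onD)

subsection \<open>The reflection\<close>

text \<open>Closure under the multiset and composition axioms. In \<open>ex_reflection\<close> the
  existence of intermediate states is inherited from the generators by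
  \<open>ts_closure_split\<close>, and their uniqueness comes from the identification of
  states.\<close>

inductive_set ts_closure :: "('s \<times> 'a list \<times> 's) set \<Rightarrow> ('s \<times> 'a list \<times> 's) set"
  for T :: "('s \<times> 'a list \<times> 's) set" where
  base: "(a, us, b) \<in> T \<Longrightarrow> (a, us, b) \<in> ts_closure T"
| perm: "(a, us, b) \<in> ts_closure T \<Longrightarrow> mset vs = mset us \<Longrightarrow> (a, vs, b) \<in> ts_closure T"
| comp: "us \<noteq> [] \<Longrightarrow> vs \<noteq> [] \<Longrightarrow> ws \<noteq> [] \<Longrightarrow> (a, us @ vs @ ws, b) \<in> ts_closure T \<Longrightarrow>
    (a, us, c) \<in> ts_closure T \<Longrightarrow> (c, vs @ ws, b) \<in> ts_closure T \<Longrightarrow>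
    (a, us @ vs, d) \<in> ts_closure T \<Longrightarrow> (d, ws, b) \<in> ts_closure T \<Longrightarrow> (c, vs, d) \<in> ts_closure T"

text \<open>A transition \<open>(c, vs, d)\<close> obtained from the composition axiom is split by splitting the
  surrounding transition \<open>(a, us @ vs @ ws, b)\<close> inside \<open>vs\<close>.\<close>

lemma ts_closure_split:
  assumes "(a, us, b) \<in> ts_closure T"
    and T: "\<And>a b us us1 us2. (a, us, b) \<in> T \<Longrightarrow> us1 \<noteq> [] \<Longrightarrow> us2 \<noteq> [] \<Longrightarrow>
      mset (us1 @ us2) = mset us \<Longrightarrow> \<exists>c. (a, us1, c) \<in> T \<and> (c, us2, b) \<in> T"
    and "us1 \<noteq> []" "us2 \<noteq> []" "mset (us1 @ us2) = mset us"
  shows "\<exists>c. (a, us1, c) \<in> ts_closure T \<and> (c, us2, b) \<in> ts_closure T"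
  using assms(1,3-)
proof (induction arbitrary: us1 us2 rule: ts_closure.induct)
  case (base a us b)
  obtain c where c: "(a, us1, c) \<in> T" "(c, us2, b) \<in> T" using T[OF base] by blast
  show ?case by (intro exI[of _ c] conjI ts_closure.base c)
next
  case (perm a us b vs)
  show ?case by (rule perm.IH) (use perm.prems perm.hyps(2) in simp_all)
next
  case (comp us vs ws a b c d v1 v2)
  note m = \<open>mset (v1 @ v2) = mset vs\<close>
  have "\<exists>n. (a, us @ v1, n) \<in> ts_closure T \<and> (n, v2 @ ws, b) \<in> ts_closure T"
    using comp.IH(1)[of "us @ v1" "v2 @ ws"] comp.hyps(1-3) m by (simp add: ac_simps)
  then obtain n where n: "(a, us @ v1, n) \<in> ts_closure T" "(n, v2 @ ws, b) \<in> ts_closure T" by blast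
  have w: "(a, us @ v1 @ v2 @ ws, b) \<in> ts_closure T"
    using ts_closure.perm[OF comp.hyps(4), of "us @ v1 @ v2 @ ws"] m by (simp add: ac_simps)
  have c: "(c, v1 @ v2 @ ws, b) \<in> ts_closure T"
    using ts_closure.perm[OF comp.hyps(6), of "v1 @ v2 @ ws"] m by (simp add: ac_simps)
  have d: "(a, us @ v1 @ v2, d) \<in> ts_closure T"
    using ts_closure.perm[OF comp.hyps(7), of "us @ v1 @ v2"] m by (simp add: ac_simps)
  have "(c, v1, n) \<in> ts_closure T"
    by (rule ts_closure.comp[of us v1 "v2 @ ws" a b]) (use comp n w c d in auto)
  moreover have "(n, v2, d) \<in> ts_closure T"
    by (rule ts_closure.comp[of "us @ v1" v2 ws a b]) (use comp n w c d in auto)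
  ultimately show ?case by blast
qed

text \<open>The states of the reflection are classes of states identified by all maps to systems with
  injective labelling map. Its transitions have to be generated from those of \<open>X\<close>, since the
  triples sent to transitions by all such maps need not admit intermediate states.\<close>

lemma (in small_labels) ex_reflection:
  fixes X :: "('u, 'u, 'l) ts"
  assumes X: "X \<in> RTS_ob"
  shows "\<exists>e. is_reflection RTS label_inj X e"
proof -
  define E where "E a b \<longleftrightarrow> b \<in> states X \<and> (\<forall>Z\<in>label_inj. \<forall>f\<in>hom RTS X Z. on_states f a = on_states f
    b)" for a b
  define sr where "sr a = (SOME b. E a b)" for a
  define ar where "ar u = (SOME v. v \<in> actions X \<and> label X v = label X u)" for u
  have Esr: "E a (sr a)" if "a \<in> states X" for a
    unfolding sr_def by (rule someI[of _ a]) (use that in \<open>simp add: E_def\<close>)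
  have sr: "sr a \<in> states X" "\<And>Z f. Z \<in> label_inj \<Longrightarrow> f \<in> hom RTS X Z \<Longrightarrow> on_states f (sr a) =
    on_states f a"
    if "a \<in> states X" for a
    using Esr[OF that] unfolding E_def by auto
  have sr_eq: "sr a = sr b" if "\<And>Z f. Z \<in> label_inj \<Longrightarrow> f \<in> hom RTS X Z \<Longrightarrow>
    on_states f a = on_states f b" for a b
  proof -
    \<comment> \<open>As predicates \<open>E a\<close> and \<open>E b\<close> coincide, so the
      choice operator returns the same representative.\<close>
    have "E a = E b" using that unfolding E_def by auto
    then show ?thesis unfolding sr_def by simp
  qed
  have sr_sr: "sr (sr a) = sr a" if "a \<in> states X" for a using sr[OF that] by (intro sr_eq) auto
  have ar: "ar u \<in> actions X \<and> label X (ar u) = label X u" if "u \<in> actions X" for u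
    unfolding ar_def by (rule someI[of _ u]) (use that in simp)
  have ar_f: "on_actions f (ar u) = on_actions f u" if "Z \<in> label_inj" "f \<in> hom RTS X Z"
    "u \<in> actions X" for Z f u
    using label_injD(3)[OF that(1)] hom_RTSD(7,8)[OF that(2)] ar[OF that(3)] that(3) by simp
  have ar_eq: "ar u = ar v" if "label X u = label X v" for u v unfolding ar_def that ..
  define T where "T = {(sr \<alpha>, map ar us, sr \<beta>) | \<alpha> us \<beta>. (\<alpha>, us, \<beta>) \<in> transitions X}"
  define L where "L = \<lparr>states = sr ` states X, actions = ar ` actions X,
    label = restrict (label X) (ar ` actions X), transitions = ts_closure T\<rparr>"
  have wf: "a \<in> sr ` states X \<and> us \<noteq> [] \<and> set us \<subseteq> ar ` actions X \<and> b \<in> sr ` states X"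
    if "(a, us, b) \<in> ts_closure T" for a us b
    using that
  proof induction
    case (base a us b)
    then obtain \<alpha> vs \<beta> where "(\<alpha>, vs, \<beta>) \<in> transitions X" "a = sr \<alpha>" "us = map ar vs" "b = sr \<beta>"
      unfolding T_def by blast
    with RTS_trans[OF X this(1)] show ?case by auto
  next
    case (perm a us b vs)
    then show ?case using mset_eq_setD[OF perm(2)] by auto
  qed auto
  have f_clo: "(on_states f a, map (on_actions f) us, on_states f b) \<in> transitions Z"
    if "(a, us, b) \<in> ts_closure T" and f: "Z \<in> label_inj" "f \<in> hom RTS X Z" for a us b Z f
    using that(1)
  proof induction
    case (base a us b)
    then obtain \<alpha> vs \<beta> where t: "(\<alpha>, vs, \<beta>) \<in> transitions X" "a = sr \<alpha>" "us = map ar vs" "b = sr \<beta>"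
      unfolding T_def by blast
    note tr = RTS_trans[OF X t(1)]
    have eq: "map (on_actions f) us = map (on_actions f) vs" using tr(3) ar_f[OF f] t(3) by auto
    show ?case unfolding eq t(2,4) sr(2)[OF tr(1) f] sr(2)[OF tr(4) f]
      by (rule hom_RTSD(9)[OF f(2) t(1)])
  next
    case (perm a us b vs)
    have "mset (map (on_actions f) vs) = mset (map (on_actions f) us)" using perm(2) by simp
    then show ?case by (rule RTS_perm[OF label_injD(1)[OF f(1)] perm(3)])
  next
    case (comp us vs ws a b c d)
    then show ?case
      using RTS_compose[OF label_injD(1)[OF f(1)], of "map (on_actions f) us"
        "map (on_actions f) vs"
        "map (on_actions f) ws" "on_states f a" "on_states f b" "on_states f c" "on_states f d"]
          by simp
  qed
  have "regular_ts L"
  proof (rule regular_tsI; (unfold L_def ts.simps)?)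
    fix u assume "u \<in> ar ` actions X"
    then obtain v where v: "v \<in> actions X" "u = ar v" by blast
    obtain \<alpha> \<beta> where t: "(\<alpha>, [v], \<beta>) \<in> transitions X" using RTS_used[OF X v(1)] by blast
    have "(sr \<alpha>, [u], sr \<beta>) \<in> T"
      unfolding T_def mem_Collect_eq by (intro exI[of _ \<alpha>] exI[of _ "[v]"] exI[of _ \<beta>])
        (use t v in simp)
    from ts_closure.base[OF this] show "\<exists>a b. (a, [u], b) \<in> ts_closure T" by blast
  next
    fix a us vs b
    assume n: "us \<noteq> []" "vs \<noteq> []" and t: "(a, us @ vs, b) \<in> ts_closure T"
    show "\<exists>c. (a, us, c) \<in> ts_closure T \<and> (c, vs, b) \<in> ts_closure T"
    proof (rule ts_closure_split[OF t _ n refl])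
      fix a b us us1 us2 assume "(a, us, b) \<in> T" and n: "us1 \<noteq> []" "us2 \<noteq> []"
        and m: "mset (us1 @ us2) = mset us"
      then obtain \<alpha> vs \<beta> where t: "(\<alpha>, vs, \<beta>) \<in> transitions X" "a = sr \<alpha>" "us = map ar vs"
        "b = sr \<beta>"
        unfolding T_def by blast
      obtain \<sigma> where \<sigma>: "\<sigma> permutes {..<length us}" "permute_list \<sigma> us = us1 @ us2"
        using mset_eq_permutation[OF m] .
      have \<sigma>': "\<sigma> permutes {..<length vs}" using \<sigma>(1) t(3) by simp
      have "map ar (permute_list \<sigma> vs) = us1 @ us2" using \<sigma>(2) permute_list_map[OF \<sigma>'] t(3) by metis
      then obtain vs1 vs2 where vs: "permute_list \<sigma> vs = vs1 @ vs2" "us1 = map ar vs1"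
        "us2 = map ar vs2"
        by (auto simp: map_eq_append_conv)
      have "(\<alpha>, vs1 @ vs2, \<beta>) \<in> transitions X"
        using RTS_perm[OF X t(1), of "vs1 @ vs2"] mset_permute_list[OF \<sigma>'] unfolding vs(1) by blast
      then obtain \<nu> where \<nu>: "(\<alpha>, vs1, \<nu>) \<in> transitions X" "(\<nu>, vs2, \<beta>) \<in> transitions X"
        using RTS_split[OF X, of vs1 vs2 \<alpha> \<beta>] vs n by blast
      then show "\<exists>c. (a, us1, c) \<in> T \<and> (c, us2, b) \<in> T"
        unfolding T_def mem_Collect_eq t(2,4) vs(2,3) by blast
    qed
  next
    fix a us vs b c c'
    assume n: "us \<noteq> []" "vs \<noteq> []" and t: "(a, us @ vs, b) \<in> ts_closure T"
      and c: "(a, us, c) \<in> ts_closure T" "(c, vs, b) \<in> ts_closure T"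
      and c': "(a, us, c') \<in> ts_closure T" "(c', vs, b) \<in> ts_closure T"
    \<comment> \<open>Maps into systems satisfying CSA2 cannot separate two intermediate states of
      one splitting, so both have the same representative; being states of \<open>L\<close>, they
      are their own representatives.\<close>
    have "sr c = sr c'"
    proof (rule sr_eq)
      fix Z f assume f: "Z \<in> label_inj" "f \<in> hom RTS X Z"
      note fc = f_clo[OF _ f]
      show "on_states f c = on_states f c'"
        using RTS_split_unique[OF label_injD(1)[OF f(1)] label_injD(1)[OF f(1)], of "map (on_actions
          f) us"
          "map (on_actions f) vs"] n fc[OF t] fc[OF c(1)] fc[OF c(2)] fc[OF c'(1)] fc[OF c'(2)]
            by simp
    qed
    moreover have "sr c = c" "sr c' = c'" using wf[OF c(1)] wf[OF c'(1)] sr_sr by auto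
    ultimately show "c = c'" by simp
  next
    fix a us b assume "(a, us, b) \<in> ts_closure T"
    then show "a \<in> sr ` states X \<and> us \<noteq> [] \<and> set us \<subseteq> ar ` actions X \<and> b \<in> sr ` states X"
      by (rule wf)
  qed (rule ts_closure.perm ts_closure.comp; assumption)+
  moreover have "sr ` states X \<prec> (UNIV :: 'u set)" "ar ` actions X \<prec> (UNIV :: 'u set)"
    using small_image RTS_ob_small[OF X] by auto
  ultimately have L: "L \<in> RTS_ob" unfolding RTS_ob_def by (simp add: L_def)
  have "inj_on (label L) (actions L)"
  proof (rule inj_onI)
    fix u v assume "u \<in> actions L" "v \<in> actions L" and eq: "label L u = label L v"
    then obtain u' v' where u': "u' \<in> actions X" "u = ar u'" and v': "v' \<in> actions X" "v = ar v'"
      unfolding L_def by auto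
    then have "label X u' = label X v'" using eq ar[OF u'(1)] ar[OF v'(1)] by (simp add: L_def)
    then show "u = v" unfolding u' v' by (rule ar_eq)
  qed
  then have Ll: "L \<in> label_inj" using L unfolding label_inj_def by blast
  define e where "e = arr X L sr ar"
  have eh: "e \<in> hom RTS X L"
    unfolding e_def
  proof (rule arr_in_hom[OF X L], rule ts_mapI)
    fix \<alpha> us \<beta> assume "(\<alpha>, us, \<beta>) \<in> transitions X"
    then show "(sr \<alpha>, map ar us, sr \<beta>) \<in> transitions L"
      unfolding L_def ts.simps T_def by (intro ts_closure.base) blast
  qed (use ar in \<open>auto simp: L_def\<close>)
  have "\<exists>!h. h \<in> hom RTS L Z \<and> Comp RTS h e = g" if g: "Z \<in> label_inj" "g \<in> hom RTS X Z" for Z g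
  proof (rule ex_ex1I)
    \<comment> \<open>States and actions of \<open>L\<close> are chosen among those of
      \<open>X\<close>, so the factorization is \<open>g\<close> itself on representatives.\<close>
    have h: "arr L Z (on_states g) (on_actions g) \<in> hom RTS L Z"
      by (rule arr_in_hom[OF L label_injD(1)[OF g(1)]], rule ts_mapI)
        (use sr ar hom_RTSD[OF g(2)] f_clo[OF _ g] in \<open>auto simp: L_def\<close>)
    have "Comp RTS (arr L Z (on_states g) (on_actions g)) e = g"
      by (rule hom_RTS_eqI[OF RTS_Comp_in_hom[OF eh h] g(2)])
        (use sr g ar_f[OF g] in \<open>auto simp: e_def L_def\<close>)
    then show "\<exists>h. h \<in> hom RTS L Z \<and> Comp RTS h e = g" using h by blast
  next
    fix h h' assume h: "h \<in> hom RTS L Z \<and> Comp RTS h e = g" and h': "h' \<in> hom RTS L Z \<and>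
      Comp RTS h' e = g"
    then have eq: "Comp RTS h e = Comp RTS h' e" by simp
    show "h = h'"
    proof (rule hom_RTS_eqI[OF conjunct1[OF h] conjunct1[OF h']])
      fix a assume "a \<in> states L"
      then obtain \<alpha> where "\<alpha> \<in> states X" "a = sr \<alpha>" unfolding L_def by auto
      then show "on_states h a = on_states h' a"
        using arg_cong[OF eq, of "\<lambda>k. on_states k \<alpha>"] by (simp add: e_def)
    next
      fix u assume "u \<in> actions L"
      then obtain v where "v \<in> actions X" "u = ar v" unfolding L_def by auto
      then show "on_actions h u = on_actions h' u"
        using arg_cong[OF eq, of "\<lambda>k. on_actions k v"] by (simp add: e_def)
    qed
  qed
  then have "is_reflection RTS label_inj X e"
    using hom_Ar[OF eh] Ll unfolding is_reflection_def RTS_simps hom_RTSD(1,2)[OF eh] by blast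
  then show ?thesis ..
qed

subsection \<open>Injective objects\<close>

lemma coprod_cube1 [simp]:
  "states (ts_coprod (cube [x]) (cube [x])) = {Inl [False], Inl [True], Inr [False], Inr [True]}"
  "actions (ts_coprod (cube [x]) (cube [x])) = {Inl (x, 0), Inr (x, 0)}"
  "label (ts_coprod (cube [x]) (cube [x])) = case_sum fst fst"
  "transitions (ts_coprod (cube [x]) (cube [x])) =
    {(Inl [False], [Inl (x, 0)], Inl [True]), (Inr [False], [Inr (x, 0)], Inr [True])}"
  unfolding ts_coprod_def ts.simps cube1 by (auto simp: cube_simps(3))

lemma regular_coprod_cube1: "regular_ts (ts_coprod (cube [x]) (cube [x]))"
  by (rule regular_tsI) (auto simp: append_eq_Cons_conv)

abbreviation p_states :: "bool list + bool list \<Rightarrow> nat" where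
  "p_states \<equiv> case_sum (\<lambda>\<epsilon>. if \<epsilon> = [False] then 1 else 2) (\<lambda>\<epsilon>. if \<epsilon> = [False] then 3 else 4)"

lemma p_ts_map:
  "ts_map (ts_coprod (cube [x]) (cube [x])) (double_transition x) p_states (case_sum fst fst)"
  by (rule ts_mapI) auto

text \<open>Being a descent map is invariant under isomorphism of arrows, so it can be checked on
  the concrete systems.\<close>

lemma copies_descent_map:
  assumes A: "weak_ts A" and f: "f \<in> copies A B g h" and g: "bij_betw g (states A) (states B)"
    and h: "h ` actions A = actions B"
    and t: "transitions B \<subseteq> (\<lambda>(\<alpha>, us, \<beta>). (g \<alpha>, map h us, g \<beta>)) ` transitions A"
  shows "descent_map f"
proof -
  obtain gA hA gA' hA' gB hB gB' hB' where
    A1: "ts_map A (src f) gA hA" and A2: "ts_map (src f) A gA' hA'"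
    and A3: "\<forall>\<alpha>\<in>states A. gA' (gA \<alpha>) = \<alpha>" "\<forall>\<alpha>\<in>states (src f). gA (gA' \<alpha>) = \<alpha>"
      "\<forall>u\<in>actions (src f). hA (hA' u) = u"
    and B2: "ts_map (tgt f) B gB' hB'"
    and B3: "\<forall>\<alpha>\<in>states B. gB' (gB \<alpha>) = \<alpha>" "\<forall>\<alpha>\<in>states (tgt f). gB (gB' \<alpha>) = \<alpha>"
      "\<forall>u\<in>actions (tgt f). hB (hB' u) = u"
    and eq: "\<forall>\<alpha>\<in>states A. on_states f (gA \<alpha>) = gB (g \<alpha>)"
      "\<forall>u\<in>actions A. on_actions f (hA u) = hB (h u)" and ar: "f \<in> RTS_ar"
    using f unfolding copies_def ts_iso_def by auto
  have fh: "f \<in> hom RTS (src f) (tgt f)" using ar by (simp add: hom_def)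
  show ?thesis
    unfolding descent_map_def
  proof (intro conjI)
    show "f \<in> RTS_ar" by (fact ar)
    show "bij_betw (on_states f) (states (src f)) (states (tgt f))"
      unfolding bij_betw_def
    proof
      show "inj_on (on_states f) (states (src f))"
      proof (rule inj_onI)
        fix \<alpha> \<beta> assume a: "\<alpha> \<in> states (src f)" "\<beta> \<in> states (src f)" "on_states f \<alpha> = on_states f \<beta>"
        have a': "gA' \<alpha> \<in> states A" "gA' \<beta> \<in> states A" using ts_mapD(1)[OF A2] a by auto
        then have "gB (g (gA' \<alpha>)) = gB (g (gA' \<beta>))" using eq(1) A3(2) a by metis
        then have "g (gA' \<alpha>) = g (gA' \<beta>)"
          using B3(1) bij_betwE[OF g] a' by metis
        then have "gA' \<alpha> = gA' \<beta>" using inj_onD[OF bij_betw_imp_inj_on[OF g]] a' by blast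
        then show "\<alpha> = \<beta>" using A3(2) a by metis
      qed
      show "on_states f ` states (src f) = states (tgt f)"
      proof
        show "on_states f ` states (src f) \<subseteq> states (tgt f)" using hom_RTSD(6)[OF fh] by auto
        show "states (tgt f) \<subseteq> on_states f ` states (src f)"
        proof
          fix \<beta> assume b: "\<beta> \<in> states (tgt f)"
          then have "gB' \<beta> \<in> g ` states A" using ts_mapD(1)[OF B2] bij_betw_imp_surj_on[OF g]
            by blast
          then obtain \<alpha> where \<alpha>: "\<alpha> \<in> states A" "gB' \<beta> = g \<alpha>" by blast
          then have "on_states f (gA \<alpha>) = \<beta>" using eq(1) B3(2) b by metis
          then show "\<beta> \<in> on_states f ` states (src f)" using ts_mapD(1)[OF A1 \<alpha>(1)] by blast
        qed
      qed
    qed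
    show "on_actions f ` actions (src f) = actions (tgt f)"
    proof
      show "on_actions f ` actions (src f) \<subseteq> actions (tgt f)" using hom_RTSD(7)[OF fh] by auto
      show "actions (tgt f) \<subseteq> on_actions f ` actions (src f)"
      proof
        fix v assume v: "v \<in> actions (tgt f)"
        then have "hB' v \<in> h ` actions A" using ts_mapD(2)[OF B2] h by blast
        then obtain u where u: "u \<in> actions A" "hB' v = h u" by blast
        then have "on_actions f (hA u) = v" using eq(2) B3(3) v by metis
        then show "v \<in> on_actions f ` actions (src f)" using ts_mapD(2)[OF A1 u(1)] by blast
      qed
    qed
    show "\<forall>(\<alpha>', us', \<beta>')\<in>transitions (tgt f). \<exists>(\<alpha>, us, \<beta>)\<in>transitions (src f).
        \<alpha>' = on_states f \<alpha> \<and> us' = map (on_actions f) us \<and> \<beta>' = on_states f \<beta>"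
    proof clarify
      fix \<alpha>' us' \<beta>' assume t': "(\<alpha>', us', \<beta>') \<in> transitions (tgt f)"
      note tr' = RTS_trans[OF hom_RTSD(4)[OF fh] t']
      obtain \<alpha> us \<beta> where s: "(\<alpha>, us, \<beta>) \<in> transitions A" "gB' \<alpha>' = g \<alpha>" "map hB' us' = map h us"
        "gB' \<beta>' = g \<beta>"
        using subsetD[OF t ts_mapD(4)[OF B2 t']] by auto
      note tr = weak_ts_trans[OF A s(1)]
      have "us' = map hB (map hB' us')" using tr'(3) B3(3) by (simp add: map_idI subset_iff)
      also have "\<dots> = map (on_actions f) (map hA us)"
        unfolding s(3) using tr(3) eq(2) by auto
      finally have "us' = map (on_actions f) (map hA us)" .
      moreover have "\<alpha>' = on_states f (gA \<alpha>)" "\<beta>' = on_states f (gA \<beta>)"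
        using eq(1) B3(2) tr tr' s by metis+
      ultimately show "\<exists>(\<alpha>, us, \<beta>)\<in>transitions (src f).
        \<alpha>' = on_states f \<alpha> \<and> us' = map (on_actions f) us \<and> \<beta>' = on_states f \<beta>"
        using ts_mapD(4)[OF A1 s(1)] by blast
    qed
  qed
qed

text \<open>p_x is a descent map, and the two actions that it identifies have equal labels, so any
  map into a system with injective labelling identifies them too.\<close>

lemma orth_p_maps:
  assumes s: "s \<in> p_maps" and Z: "Z \<in> label_inj"
  shows "s \<in> RTS_ar" "orth RTS s Z"
proof -
  obtain x where x: "s \<in> copies (ts_coprod (cube [x]) (cube [x])) (double_transition x) p_states
    (case_sum fst fst)"
    using s unfolding p_maps_def by blast
  then show ar: "s \<in> RTS_ar" unfolding copies_def by simp
  then have sh: "s \<in> hom RTS (src s) (tgt s)" by (simp add: hom_def)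
  have desc: "descent_map s"
  proof (rule copies_descent_map[OF _ x])
    show "weak_ts (ts_coprod (cube [x]) (cube [x]))"
      using regular_coprod_cube1[of x] unfolding regular_ts_def by (rule conjunct1)
  qed (auto simp: bij_betw_def inj_on_def)
  show "orth RTS s Z"
    unfolding orth_def RTS_simps
  proof
    fix g assume g: "g \<in> hom RTS (src s) Z"
    show "\<exists>!h. h \<in> hom RTS (tgt s) Z \<and> Comp RTS h s = g"
    proof (rule descent_map_ex1[OF desc sh g])
      fix u v assume u: "u \<in> actions (src s)" and v: "v \<in> actions (src s)"
        and eq: "on_actions s u = on_actions s v"
      show "on_actions g u = on_actions g v"
        by (rule label_injD(3)[OF Z hom_RTSD(7)[OF g u] hom_RTSD(7)[OF g v]])
          (use hom_RTSD(8)[OF g u] hom_RTSD(8)[OF g v] hom_RTSD(8)[OF sh u] hom_RTSD(8)[OF sh v] eq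
            in simp)
    qed
  qed
qed

context small_labels
begin

text \<open>Two transitions with the same label give a map from the source of some \<open>p_x\<close>; any
  extension along \<open>p_x\<close> identifies the two actions.\<close>

lemma p_map_test:
  fixes Q :: "('u, 'u, 'l) ts"
  assumes Q: "Q \<in> RTS_ob" and u: "u \<in> actions Q" "v \<in> actions Q" "label Q u = label Q v"
  obtains s :: "('u, 'l) ts_arrow" and g where "s \<in> p_maps" "g \<in> hom RTS (src s) Q"
    "\<And>k. k \<in> hom RTS (tgt s) Q \<Longrightarrow> Comp RTS k s = g \<Longrightarrow> u = v"
proof -
  define x where "x = label Q u"
  obtain a b where ab: "(a, [u], b) \<in> transitions Q" using RTS_used[OF Q u(1)] by blast
  obtain c d where cd: "(c, [v], d) \<in> transitions Q" using RTS_used[OF Q u(2)] by blast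
  let ?A = "ts_coprod (cube [x]) (cube [x])"
  have reg: "regular_ts ?A" "regular_ts (double_transition x)"
    by (rule regular_coprod_cube1, rule regular_double)
  then have wk: "weak_ts ?A" "weak_ts (double_transition x)" unfolding regular_ts_def by auto
  obtain s :: "('u, 'l) ts_arrow" where s: "s \<in> copies ?A (double_transition x) p_states (case_sum
    fst fst)"
    by (rule ex_copies[OF reg(1) _ _ reg(2) _ _ p_ts_map]) auto
  have "ts_map ?A Q (case_sum (\<lambda>\<epsilon>. if \<epsilon> = [False] then a else b) (\<lambda>\<epsilon>. if \<epsilon> = [False] then c else d))
      (case_sum (\<lambda>_. u) (\<lambda>_. v))"
    by (rule ts_mapI) (use ab cd u RTS_trans[OF Q ab] RTS_trans[OF Q cd] in \<open>auto simp: x_def\<close>)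
  from extend_along_copies[OF wk s Q this] obtain g where g: "g \<in> hom RTS (src s) Q"
    "\<And>k. k \<in> hom RTS (tgt s) Q \<Longrightarrow> Comp RTS k s = g \<Longrightarrow> \<exists>k1 k2.
      ts_map (double_transition x) Q k1 k2 \<and>
      (\<forall>\<alpha>\<in>states ?A. k1 (p_states \<alpha>) = case_sum (\<lambda>\<epsilon>. if \<epsilon> = [False] then a else b) (\<lambda>\<epsilon>.
        if \<epsilon> = [False] then c else d) \<alpha>) \<and>
      (\<forall>w\<in>actions ?A. k2 (case_sum fst fst w) = case_sum (\<lambda>_. u) (\<lambda>_. v) w)"
    by blast
  show ?thesis
  proof (rule that[OF _ g(1)])
    show "s \<in> p_maps" using s unfolding p_maps_def by blast
    fix k assume "k \<in> hom RTS (tgt s) Q" "Comp RTS k s = g"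
    from g(2)[OF this] obtain k2 where "\<forall>w\<in>actions ?A. k2 (case_sum fst fst w) = case_sum (\<lambda>_. u)
      (\<lambda>_. v) w"
      by blast
    then have "k2 x = u" "k2 x = v" by auto
    then show "u = v" by simp
  qed
qed

text \<open>If the labelling is injective, extensions along p_x exist by \<open>orth_p_maps\<close>;
  conversely \<open>p_map_test\<close> turns two actions with the same label into an extension
  problem that forces them to be equal.\<close>

lemma injective_object_p_maps:
  "{Z. injective_object RTS p_maps Z} = (label_inj :: ('u, 'u, 'l) ts set)"
proof (intro set_eqI iffI; (unfold mem_Collect_eq)?)
  fix Z :: "('u, 'u, 'l) ts" assume inj: "injective_object RTS p_maps Z"
  then have Z: "Z \<in> RTS_ob" unfolding injective_object_def by simp
  have "u = v" if uv: "u \<in> actions Z" "v \<in> actions Z" "label Z u = label Z v" for u v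
  proof -
    obtain s g where "s \<in> p_maps" "g \<in> hom RTS (src s) Z"
      "\<And>k. k \<in> hom RTS (tgt s) Z \<Longrightarrow> Comp RTS k s = g \<Longrightarrow> u = v"
      using p_map_test[OF Z uv] by metis
    then show "u = v" using inj unfolding injective_object_def by auto
  qed
  then show "Z \<in> label_inj" using Z unfolding label_inj_def by (auto intro: inj_onI)
next
  fix Z :: "('u, 'u, 'l) ts" assume Z: "Z \<in> label_inj"
  show "injective_object RTS p_maps Z"
    unfolding injective_object_def
  proof (intro conjI ballI)
    fix s :: "('u, 'l) ts_arrow" and g assume "s \<in> p_maps" and g: "g \<in> hom RTS (Dom RTS s) Z"
    with orth_p_maps(2)[OF this(1) Z] show "\<exists>h\<in>hom RTS (Cod RTS s) Z. Comp RTS h s = g"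
      unfolding orth_def by blast
  qed (use label_injD(1)[OF Z] in simp)
qed

lemma is_iso_L_S:
  fixes f :: "('u, 'l) ts_arrow"
  assumes "f \<in> hom RTS X Y"
  shows "is_iso RTS (L_S f) \<longleftrightarrow> (\<forall>Z\<in>label_inj. orth RTS f Z)"
  unfolding L_S_def injective_object_p_maps
  by (rule RTS.is_iso_reflection_map[OF ex_reflection assms]) simp

end

section \<open>Local objects\<close>

subsection \<open>Quotients by interchangeable actions\<close>

text \<open>What it takes for the passage to the quotient by \<open>E\<close> to be a trivial
  fibration, as used in \<open>ex_quotient\<close>.\<close>

definition interchangeable :: "('s, 'a, 'l) ts \<Rightarrow> 'a rel \<Rightarrow> bool" where
  "interchangeable Z E \<longleftrightarrow> equiv (actions Z) E \<and> (\<forall>(u, v) \<in> E. label Z u = label Z v) \<and>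
     (\<forall>\<alpha> us \<beta> vs. (\<alpha>, us, \<beta>) \<in> transitions Z \<and> list_all2 (\<lambda>u v. (u, v) \<in> E) us vs \<longrightarrow>
        (\<alpha>, vs, \<beta>) \<in> transitions Z)"

definition label_eq :: "('s, 'a, 'l) ts \<Rightarrow> 'a rel" where
  "label_eq Z = {(u, v). u \<in> actions Z \<and> v \<in> actions Z \<and> label Z u = label Z v}"

text \<open>The identifications demanded by CSA1. Reflexivity amounts to regularity; transitivity is
  derived from fibrancy in \<open>interchangeable_parallel\<close>.\<close>

definition parallel :: "('s, 'a, 'l) ts \<Rightarrow> 'a rel" where
  "parallel Z = {(u, v). u \<in> actions Z \<and> v \<in> actions Z \<and> label Z u = label Z v \<and>
     (\<exists>\<alpha> \<beta>. (\<alpha>, [u], \<beta>) \<in> transitions Z \<and> (\<alpha>, [v], \<beta>) \<in> transitions Z)}"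

lemma interchangeableD:
  assumes "interchangeable Z E"
  shows "equiv (actions Z) E" "(u, v) \<in> E \<Longrightarrow> label Z u = label Z v"
    "(\<alpha>, us, \<beta>) \<in> transitions Z \<Longrightarrow> list_all2 (\<lambda>u v. (u, v) \<in> E) us vs \<Longrightarrow> (\<alpha>, vs, \<beta>) \<in> transitions Z"
  using assms unfolding interchangeable_def by auto

context small_labels
begin

text \<open>Choosing one action in each class, the quotient is realised as a subsystem \<open>Q\<close> of \<open>Z\<close>,
  with inclusion \<open>\<iota>\<close>.\<close>

lemma ex_quotient:
  fixes Z :: "('u, 'u, 'l) ts"
  assumes Z: "Z \<in> RTS_ob" and E: "interchangeable Z E"
  obtains Q \<rho> \<iota> where "\<rho> \<in> hom RTS Z Q" "trivfib \<rho>" "\<iota> \<in> hom RTS Q Z" "Comp RTS \<rho> \<iota> = Id RTS Q"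
    "\<And>\<alpha>. \<alpha> \<in> states Z \<Longrightarrow> on_states \<rho> \<alpha> = \<alpha>" "\<And>\<alpha>. \<alpha> \<in> states Q \<Longrightarrow> on_states \<iota> \<alpha> = \<alpha>"
    "\<And>u v. u \<in> actions Z \<Longrightarrow> v \<in> actions Z \<Longrightarrow> on_actions \<rho> u = on_actions \<rho> v \<longleftrightarrow> (u, v) \<in> E"
proof -
  note ED = interchangeableD[OF E]
  define r where "r u = (SOME v. v \<in> E `` {u})" for u
  have rE: "(u, r u) \<in> E" if "u \<in> actions Z" for u
  proof -
    have "u \<in> E `` {u}" using equiv_class_self[OF ED(1) that] .
    then have "r u \<in> E `` {u}" unfolding r_def by (rule someI)
    then show ?thesis by simp
  qed
  have r_eq: "r u = r v" if "(u, v) \<in> E" for u v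
    unfolding r_def equiv_class_eq[OF ED(1) that] ..
  have EA: "u \<in> actions Z" "v \<in> actions Z" if "(u, v) \<in> E" for u v
    using that equiv_type[OF ED(1)] by auto
  have r_iff: "r u = r v \<longleftrightarrow> (u, v) \<in> E" if "u \<in> actions Z" "v \<in> actions Z" for u v
    using r_eq rE[OF that(1)] rE[OF that(2)] equivE[OF ED(1)] by (metis symE transE)
  have rr: "r (r u) = r u" if "u \<in> actions Z" for u using r_eq[OF rE[OF that]] by simp
  have rA: "r u \<in> actions Z" if "u \<in> actions Z" for u using EA(2)[OF rE[OF that]] .
  define Q where "Q = pull Z (r ` actions Z) id"
  have sub: "id ` r ` actions Z \<subseteq> actions Z" using rA by auto
  have small: "r ` actions Z \<prec> (UNIV :: 'u set)" by (rule small_image[OF RTS_ob_small(2)[OF Z]])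
  have Q: "Q \<in> RTS_ob" unfolding Q_def by (rule pull_RTS_ob[OF Z sub small])
  define \<rho> where "\<rho> = arr Z Q id r"
  define \<iota> where "\<iota> = arr Q Z id id"
  have tr: "(\<alpha>, map r us, \<beta>) \<in> transitions Z" if "(\<alpha>, us, \<beta>) \<in> transitions Z" for \<alpha> us \<beta>
  proof (rule ED(3)[OF that])
    show "list_all2 (\<lambda>u v. (u, v) \<in> E) us (map r us)"
      using RTS_trans(3)[OF Z that] rE by (simp add: list_all2_map2 list_all2_same subset_iff)
  qed
  have \<rho>: "\<rho> \<in> hom RTS Z Q"
    unfolding \<rho>_def
  proof (rule arr_in_hom[OF Z Q], rule ts_mapI)
    fix \<alpha> us \<beta> assume t: "(\<alpha>, us, \<beta>) \<in> transitions Z"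
    then show "(id \<alpha>, map r us, id \<beta>) \<in> transitions Q"
      using tr[OF t] RTS_trans(3)[OF Z t] unfolding Q_def by auto
  qed (use rA ED(2)[OF rE] in \<open>auto simp: Q_def\<close>)
  have \<iota>: "\<iota> \<in> hom RTS Q Z" unfolding \<iota>_def Q_def by (rule pull_proj_in_hom[OF Z sub small])
  have "trivfib \<rho>"
  proof (rule trivfibI[OF \<rho>])
    show "bij_betw (on_states \<rho>) (states Z) (states Q)"
      by (auto simp: \<rho>_def Q_def bij_betw_def inj_on_def)
    show "on_actions \<rho> ` actions Z = actions Q" by (auto simp: \<rho>_def Q_def)
    fix \<alpha> us \<beta> assume a: "\<alpha> \<in> states Z" "set us \<subseteq> actions Z" "\<beta> \<in> states Z"
      and t: "(on_states \<rho> \<alpha>, map (on_actions \<rho>) us, on_states \<rho> \<beta>) \<in> transitions Q"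
    have m: "map (on_actions \<rho>) us = map r us" using a(2) by (auto simp: \<rho>_def)
    have "(\<alpha>, map r us, \<beta>) \<in> transitions Z" using t[unfolded m] a by (simp add: Q_def \<rho>_def)
    then show "(\<alpha>, us, \<beta>) \<in> transitions Z"
    proof (rule ED(3))
      have "(r u, u) \<in> E" if "u \<in> actions Z" for u
        using rE[OF that] ED(1) by (metis equivE symE)
      then show "list_all2 (\<lambda>u v. (u, v) \<in> E) (map r us) us"
        using a(2) by (simp add: list_all2_map1 list_all2_same subset_iff)
    qed
  qed
  moreover have "Comp RTS \<rho> \<iota> = Id RTS Q"
    by (rule hom_RTS_eqI[OF RTS_Comp_in_hom[OF \<iota> \<rho>] RTS_Id_in_hom[OF Q]])
      (use rr rA in \<open>auto simp: \<rho>_def \<iota>_def Q_def\<close>)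
  ultimately show ?thesis
    using that[OF \<rho> _ \<iota>] r_iff by (auto simp: \<rho>_def \<iota>_def Q_def)
qed

text \<open>One pair of end states upstairs serves for all actions \<open>v\<close> at once, so
  parallel transitions of the quotient lift to parallel ones.\<close>

lemma quotient_transition:
  fixes Z :: "('u, 'u, 'l) ts"
  assumes \<rho>: "\<rho> \<in> hom RTS Z Q" "trivfib \<rho>" and t: "(\<alpha>, [u], \<beta>) \<in> transitions Q"
  obtains \<alpha>' \<beta>' where "\<alpha>' \<in> states Z" "on_states \<rho> \<alpha>' = \<alpha>" "on_states \<rho> \<beta>' = \<beta>"
    "\<And>v. v \<in> actions Z \<Longrightarrow> (\<alpha>, [on_actions \<rho> v], \<beta>) \<in> transitions Q \<Longrightarrow> (\<alpha>', [v], \<beta>') \<in> transitions Z"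
proof -
  note tr = RTS_trans[OF hom_RTSD(4)[OF \<rho>(1)] t]
  note D = trivfibD[OF \<rho>(2,1)]
  obtain \<alpha>' \<beta>' where a: "\<alpha>' \<in> states Z" "\<beta>' \<in> states Z" "on_states \<rho> \<alpha>' = \<alpha>" "on_states \<rho> \<beta>' = \<beta>"
    using tr(1,4) unfolding bij_betw_imp_surj_on[OF D(1), symmetric] by blast
  show ?thesis
  proof (rule that[OF a(1,3,4)])
    fix v assume "v \<in> actions Z" "(\<alpha>, [on_actions \<rho> v], \<beta>) \<in> transitions Q"
    then show "(\<alpha>', [v], \<beta>') \<in> transitions Z" using D(3)[of \<alpha>' "[v]" \<beta>'] a by simp
  qed
qed

lemma quotient_label_eq:
  fixes Z :: "('u, 'u, 'l) ts"
  assumes \<rho>: "\<rho> \<in> hom RTS Z Q" "trivfib \<rho>"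
    and E: "\<And>u v. u \<in> actions Z \<Longrightarrow> v \<in> actions Z \<Longrightarrow> on_actions \<rho> u = on_actions \<rho> v \<longleftrightarrow>
      (u, v) \<in> label_eq Z"
  shows "Q \<in> label_inj"
  unfolding label_inj_def
proof (intro CollectI conjI inj_onI)
  show "Q \<in> RTS_ob" by (rule hom_RTSD(4)[OF \<rho>(1)])
  fix x y assume "x \<in> actions Q" "y \<in> actions Q" and eq: "label Q x = label Q y"
  then obtain u v where u: "u \<in> actions Z" "x = on_actions \<rho> u" and v: "v \<in> actions Z"
    "y = on_actions \<rho> v"
    using trivfibD(2)[OF \<rho>(2,1)] by blast
  then show "x = y" using E[OF u(1) v(1)] eq hom_RTSD(8)[OF \<rho>(1)] by (simp add: label_eq_def)
qed

text \<open>Parallel transitions of \<open>Q\<close> with equal labels lift to such transitions of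
  \<open>Z\<close>, so their actions have already been identified.\<close>

lemma quotient_parallel:
  fixes Z :: "('u, 'u, 'l) ts"
  assumes \<rho>: "\<rho> \<in> hom RTS Z Q" "trivfib \<rho>"
    and E: "\<And>u v. u \<in> actions Z \<Longrightarrow> v \<in> actions Z \<Longrightarrow> on_actions \<rho> u = on_actions \<rho> v \<longleftrightarrow>
      (u, v) \<in> parallel Z"
  shows "CSA1 Q"
  unfolding CSA1_def
proof (intro allI impI, elim conjE)
  fix \<alpha> \<beta> x y assume t: "(\<alpha>, [x], \<beta>) \<in> transitions Q" "(\<alpha>, [y], \<beta>) \<in> transitions Q"
    and eq: "label Q x = label Q y"
  have "x \<in> actions Q" "y \<in> actions Q" using t[THEN RTS_trans(3)[OF hom_RTSD(4)[OF \<rho>(1)]]] by auto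
  then obtain u v where u: "u \<in> actions Z" "x = on_actions \<rho> u" and v: "v \<in> actions Z"
    "y = on_actions \<rho> v"
    using trivfibD(2)[OF \<rho>(2,1)] by blast
  obtain \<alpha>' \<beta>' where "(\<alpha>', [u], \<beta>') \<in> transitions Z" "(\<alpha>', [v], \<beta>') \<in> transitions Z"
    using quotient_transition[OF \<rho> t(1)] t u v by metis
  then have "(u, v) \<in> parallel Z"
    using u v eq hom_RTSD(8)[OF \<rho>(1)] unfolding parallel_def by auto
  then show "x = y" using E[OF u(1) v(1)] u v by simp
qed

subsection \<open>Fibrant objects\<close>

lemma two_out_of_threeD:
  assumes "two_out_of_three RTS W" and f: "f \<in> hom RTS X Y" and g: "g \<in> hom RTS Y Z"
  shows "f \<in> W \<Longrightarrow> Comp RTS g f \<in> W \<Longrightarrow> g \<in> W" "g \<in> W \<Longrightarrow> Comp RTS g f \<in> W \<Longrightarrow> f \<in> W"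
proof -
  have "Cod RTS f = Dom RTS g" using hom_Cod[OF f] hom_Dom[OF g] by simp
  with assms(1) hom_Ar[OF f] hom_Ar[OF g]
  show "f \<in> W \<Longrightarrow> Comp RTS g f \<in> W \<Longrightarrow> g \<in> W" "g \<in> W \<Longrightarrow> Comp RTS g f \<in> W \<Longrightarrow> f \<in> W"
    unfolding two_out_of_three_def by blast+
qed

text \<open>Both \<open>p\<close> and the identity are trivial fibrations, so they lie in every
  localizer, and two-out-of-three gives the section.\<close>

lemma weq_sections:
  fixes p i :: "('u, 'l) ts_arrow"
  assumes p: "trivfib p" "p \<in> hom RTS Y X" and i: "i \<in> hom RTS X Y" and "Comp RTS p i = Id RTS X"
  shows "i \<in> weq RTS_model"
  unfolding RTS_model_simps smallest_localizer_def
proof (intro InterI CollectI)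
  fix W :: "('u, 'l) ts_arrow set"
  assume "W \<in> {W. grothendieck_localizer TYPE('u) RTS {i. i \<in> RTS_ar \<and> action_inj i} W}"
  then have W: "two_out_of_three RTS W" "{p. trivfib p} \<subseteq> W"
    unfolding grothendieck_localizer_def rlp_cofibrations by auto
  have "p \<in> W" "Comp RTS p i \<in> W"
    unfolding assms(4) using W(2) p(1) trivfib_Id[OF hom_RTSD(3)[OF i]] by blast+
  then show "i \<in> W" by (rule two_out_of_threeD(2)[OF W(1) i p(2)])
qed

lemma weq_pushout:
  fixes i u i' u' :: "('u, 'l) ts_arrow"
  assumes po: "is_pushout RTS i u i' u'" and i: "i \<in> weq RTS_model" "i \<in> RTS_ar" "action_inj i"
  shows "i' \<in> weq RTS_model"
  unfolding RTS_model_simps smallest_localizer_def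
proof (intro InterI CollectI)
  fix W :: "('u, 'l) ts_arrow set"
  assume W: "W \<in> {W. grothendieck_localizer TYPE('u) RTS {i. i \<in> RTS_ar \<and> action_inj i} W}"
  then have "closed_under_pushouts RTS (W \<inter> {i. i \<in> RTS_ar \<and> action_inj i})"
    unfolding grothendieck_localizer_def by auto
  moreover have "i \<in> W \<inter> {i. i \<in> RTS_ar \<and> action_inj i}"
    using W i unfolding RTS_model_simps smallest_localizer_def by auto
  ultimately show "i' \<in> W" using po unfolding closed_under_pushouts_def by blast
qed

lemma weq_cancel_right:
  fixes f g :: "('u, 'l) ts_arrow"
  assumes f: "f \<in> hom RTS X Y" and g: "g \<in> hom RTS Y Z"
    and w: "f \<in> weq RTS_model" "Comp RTS g f \<in> weq RTS_model"
  shows "g \<in> weq RTS_model"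
  unfolding RTS_model_simps smallest_localizer_def
proof (intro InterI CollectI)
  fix W :: "('u, 'l) ts_arrow set"
  assume W: "W \<in> {W. grothendieck_localizer TYPE('u) RTS {i. i \<in> RTS_ar \<and> action_inj i} W}"
  then have "two_out_of_three RTS W" unfolding grothendieck_localizer_def by blast
  moreover have "f \<in> W" "Comp RTS g f \<in> W"
    using w W unfolding RTS_model_simps smallest_localizer_def by blast+
  ultimately show "g \<in> W" by (rule two_out_of_threeD(1)[OF _ f g])
qed

text \<open>A weak equivalence that is injective on actions lifts against the map to the terminal
  object; the lifting square commutes because its lower right corner is terminal.\<close>

lemma fibrant_extends:
  fixes Z :: "('u, 'u, 'l) ts"
  assumes Z: "fibrant RTS RTS_model Z" and i: "i \<in> weq RTS_model" "i \<in> hom RTS A B" "action_inj i"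
    and g: "g \<in> hom RTS A Z"
  obtains h where "h \<in> hom RTS B Z" "Comp RTS h i = g"
proof -
  obtain t p where t: "is_terminal RTS t" and p: "p \<in> hom RTS Z t" "p \<in> fib RTS_model"
    using Z unfolding fibrant_def by blast
  have "lifts RTS i p" using p(2) i hom_Ar[OF i(2)] unfolding RTS_model_simps rlp_def by auto
  moreover obtain b where b: "b \<in> hom RTS B t"
    using t hom_RTSD(4)[OF i(2)] unfolding is_terminal_def by auto
  moreover have "Comp RTS p g = Comp RTS b i"
    using t hom_RTSD(3)[OF g] RTS_Comp_in_hom[OF g p(1)] RTS_Comp_in_hom[OF i(2) b]
    unfolding is_terminal_def RTS_simps by blast
  ultimately show ?thesis
    using that g hom_RTSD(1,2)[OF i(2)] hom_RTSD(1,2)[OF p(1)] unfolding lifts_def RTS_simps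
      by blast
qed

text \<open>Adding a copy \<open>w\<close> of the action \<open>u\<close> at the single transition \<open>(\<alpha>, [u], \<beta>)\<close> is a pushout
  of a section of a trivial fibration, and adding it everywhere is itself such a section. Hence
  the inclusion \<open>l\<close> of the former system into the latter is a trivial cofibration, along which
  the map sending \<open>w\<close> to \<open>v\<close> extends.\<close>

lemma fibrant_replace:
  fixes Z :: "('u, 'u, 'l) ts"
  assumes fibrant: "fibrant RTS RTS_model Z"
    and u: "(\<alpha>, [u], \<beta>) \<in> transitions Z" and v: "(\<alpha>, [v], \<beta>) \<in> transitions Z"
    and lab: "label Z u = label Z v" and t: "(\<gamma>, us @ u # ws, \<delta>) \<in> transitions Z"
  shows "(\<gamma>, us @ v # ws, \<delta>) \<in> transitions Z"
proof -
  have Z: "Z \<in> RTS_ob" using fibrant unfolding fibrant_def by simp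
  obtain w where w: "w \<notin> actions Z" using fresh[OF RTS_ob_small(2)[OF Z]] by blast
  note tu = RTS_trans[OF Z u] and tv = RTS_trans[OF Z v] and tt = RTS_trans[OF Z t]
  have uA: "u \<in> actions Z" "v \<in> actions Z" "w \<noteq> u" "w \<noteq> v" using tu(3) tv(3) w by auto
  define \<pi> where "\<pi> x = (if x = w then u else x)" for x
  define A where "A = \<lparr>states = {\<alpha>, \<beta>}, actions = {u}, label = restrict (label Z) {u},
    transitions = {(\<alpha>, [u], \<beta>)}\<rparr>"
  have "regular_ts A" by (rule regular_tsI) (auto simp: A_def append_eq_Cons_conv)
  then have A: "A \<in> RTS_ob" unfolding RTS_ob_def by (simp add: A_def small_finite)
  define A2 where "A2 = pull A {u, w} \<pi>"
  have \<pi>A: "\<pi> ` {u, w} = actions A" "{u, w} \<prec> (UNIV :: 'u set)"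
    by (auto simp: \<pi>_def A_def small_finite)
  have A2: "A2 \<in> RTS_ob" unfolding A2_def by (rule pull_RTS_ob[OF A equalityD1[OF \<pi>A(1)] \<pi>A(2)])
  define Z2 where "Z2 = pull Z (insert w (actions Z)) \<pi>"
  have \<pi>Z: "\<pi> ` insert w (actions Z) = actions Z" "insert w (actions Z) \<prec> (UNIV :: 'u set)"
    using uA w small_insert[OF RTS_ob_small(2)[OF Z]] by (auto simp: \<pi>_def)
  have Z2: "Z2 \<in> RTS_ob" unfolding Z2_def by (rule pull_RTS_ob[OF Z equalityD1[OF \<pi>Z(1)] \<pi>Z(2)])
  define Z1 where "Z1 = \<lparr>states = states Z, actions = insert w (actions Z),
    label = (\<lambda>x \<in> insert w (actions Z). label Z (\<pi> x)), transitions = insert (\<alpha>, [w], \<beta>)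
      (transitions Z)\<rparr>"
  have w_notin: "w \<notin> set xs" if "(a, xs, b) \<in> transitions Z" for a xs b
    using RTS_trans(3)[OF Z that] w by auto
  have Z1: "Z1 \<in> RTS_ob"
  proof -
    \<comment> \<open>\<open>w\<close> occurs only in (\<alpha>, [w], \<beta>), so every longer word
      is a transition of \<open>Z\<close> and its parts avoid \<open>w\<close>; the axioms are
      thereby those of \<open>Z\<close>.\<close>
    have long: "(a, xs, b) \<in> transitions Z" if "(a, xs, b) \<in> transitions Z1" "xs \<noteq> [w]" for a xs b
      using that by (simp add: Z1_def)
    have "regular_ts Z1"
    proof (rule regular_tsI)
      fix a xs b assume "(a, xs, b) \<in> transitions Z1"
      then show "a \<in> states Z1 \<and> xs \<noteq> [] \<and> set xs \<subseteq> actions Z1 \<and> b \<in> states Z1"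
        using RTS_trans[OF Z, of a xs b] tu by (auto simp: Z1_def)
    next
      fix a xs b ys assume "(a, xs, b) \<in> transitions Z1" "mset ys = mset xs"
      then show "(a, ys, b) \<in> transitions Z1" using RTS_perm[OF Z, of a xs b ys]
        by (auto simp: Z1_def)
    next
      fix a b c d xs ys zs
      assume n: "xs \<noteq> []" "ys \<noteq> []" "zs \<noteq> []" and t: "(a, xs @ ys @ zs, b) \<in> transitions Z1"
        "(a, xs, c) \<in> transitions Z1" "(c, ys @ zs, b) \<in> transitions Z1"
        "(a, xs @ ys, d) \<in> transitions Z1" "(d, zs, b) \<in> transitions Z1"
      have l: "(a, xs @ ys @ zs, b) \<in> transitions Z" using t(1) n
        by (intro long) (auto simp: append_eq_Cons_conv)
      have "(c, ys, d) \<in> transitions Z"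
        by (rule RTS_compose[OF Z n l]) (use t w_notin[OF l] n in \<open>auto simp: append_eq_Cons_conv
          intro!: long\<close>)
      then show "(c, ys, d) \<in> transitions Z1" by (simp add: Z1_def)
    next
      fix x assume "x \<in> actions Z1"
      then consider "x = w" | "x \<in> actions Z" by (auto simp: Z1_def)
      then show "\<exists>a b. (a, [x], b) \<in> transitions Z1"
      proof cases
        case 2
        obtain a b where "(a, [x], b) \<in> transitions Z" using RTS_used[OF Z 2] by blast
        then show ?thesis by (auto simp: Z1_def)
      qed (auto simp: Z1_def)
    next
      fix a xs ys b
      assume n: "xs \<noteq> []" "ys \<noteq> []" and t: "(a, xs @ ys, b) \<in> transitions Z1"
      have "(a, xs @ ys, b) \<in> transitions Z" using t n
        by (intro long) (auto simp: append_eq_Cons_conv)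
      from RTS_split[OF Z n this] show "\<exists>c. (a, xs, c) \<in> transitions Z1 \<and>
        (c, ys, b) \<in> transitions Z1"
        by (auto simp: Z1_def)
    next
      fix a xs ys b c c'
      assume n: "xs \<noteq> []" "ys \<noteq> []" and t: "(a, xs @ ys, b) \<in> transitions Z1"
        "(a, xs, c) \<in> transitions Z1" "(c, ys, b) \<in> transitions Z1"
        "(a, xs, c') \<in> transitions Z1" "(c', ys, b) \<in> transitions Z1"
      have l: "(a, xs @ ys, b) \<in> transitions Z" using t(1) n
        by (intro long) (auto simp: append_eq_Cons_conv)
      show "c = c'"
        by (rule RTS_split_unique[OF Z Z n l]) (use t w_notin[OF l] in \<open>auto intro!: long\<close>)
    qed
    then show ?thesis
      using RTS_ob_small(1)[OF Z] \<pi>Z(2) unfolding RTS_ob_def by (simp add: Z1_def)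
  qed
  define i where "i = arr A A2 id id"
  define k where "k = arr A Z id id"
  define j where "j = arr Z Z1 id id"
  define k' where "k' = arr A2 Z1 id id"
  define l where "l = arr Z1 Z2 id id"
  have i: "i \<in> hom RTS A A2"
    unfolding i_def by (rule arr_in_hom[OF A A2], rule ts_mapI) (auto simp: A_def A2_def \<pi>_def uA)
  have k: "k \<in> hom RTS A Z"
    unfolding k_def by (rule arr_in_hom[OF A Z], rule ts_mapI) (use u tu in \<open>auto simp: A_def\<close>)
  have j: "j \<in> hom RTS Z Z1"
    unfolding j_def by (rule arr_in_hom[OF Z Z1], rule ts_mapI) (use w in \<open>auto simp: Z1_def \<pi>_def\<close>)
  have A2t: "(a, xs, b) \<in> transitions A2 \<longleftrightarrow> a = \<alpha> \<and> b = \<beta> \<and> (xs = [u] \<or> xs = [w])" for a xs b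
    using uA by (auto simp: A2_def A_def \<pi>_def map_eq_Cons_conv split: if_splits)
  have k': "k' \<in> hom RTS A2 Z1"
    unfolding k'_def
  proof (rule arr_in_hom[OF A2 Z1], rule ts_mapI)
    fix a xs b assume "(a, xs, b) \<in> transitions A2"
    then show "(id a, map id xs, id b) \<in> transitions Z1" using u unfolding A2t
      by (auto simp: Z1_def)
  qed (use uA tu in \<open>auto simp: A2_def Z1_def A_def \<pi>_def\<close>)
  have l: "l \<in> hom RTS Z1 Z2"
    unfolding l_def
  proof (rule arr_in_hom[OF Z1 Z2], rule ts_mapI)
    fix a xs b assume a: "(a, xs, b) \<in> transitions Z1"
    show "(id a, map id xs, id b) \<in> transitions Z2"
    proof (cases "xs = [w] \<and> a = \<alpha> \<and> b = \<beta>")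
      case True
      then show ?thesis using u by (simp add: Z2_def \<pi>_def)
    next
      case False
      then have a: "(a, xs, b) \<in> transitions Z" using a by (auto simp: Z1_def)
      have "map \<pi> xs = xs" using w_notin[OF a] by (intro map_idI) (auto simp: \<pi>_def)
      then show ?thesis using a RTS_trans(3)[OF Z a] by (auto simp: Z2_def)
    qed
  qed (auto simp: Z1_def Z2_def)
  have po: "is_pushout RTS i k j k'"
    unfolding is_pushout_def RTS_simps
  proof (intro conjI allI impI, goal_cases)
    case 7
    show ?case
      by (rule hom_RTS_eqI[of _ A Z1]) (use RTS_Comp_in_hom[OF k j] RTS_Comp_in_hom[OF i k'] in
        \<open>auto simp: A_def A2_def i_def k_def j_def k'_def tu uA\<close>)
  next
    case (8 Y f g)
    then have f: "f \<in> hom RTS Z Y" and g: "g \<in> hom RTS A2 Y" and eq: "Comp RTS f k = Comp RTS g i"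
      by (auto simp: k_def i_def)
    have eqs: "on_states f a = on_states g a" if "a \<in> states A" for a
      using arg_cong[OF eq, of "\<lambda>k. on_states k a"] that by (simp add: k_def i_def)
    have eqa: "on_actions f u = on_actions g u"
      using arg_cong[OF eq, of "\<lambda>k. on_actions k u"] by (simp add: k_def i_def A_def)
    \<comment> \<open>Only the value at the new action comes from \<open>A2\<close>; everywhere else
      \<open>f\<close> decides, and the two agree at \<open>u\<close>.\<close>
    define ha where "ha x = (if x = w then on_actions g w else on_actions f x)" for x
    have "ts_map Z1 Y (on_states f) ha"
    proof (rule ts_mapI)
      fix x assume "x \<in> actions Z1"
      then consider "x = w" | "x \<in> actions Z" "x \<noteq> w" using w by (auto simp: Z1_def)
      then show "ha x \<in> actions Y" "label Y (ha x) = label Z1 x"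
        using hom_RTSD(7,8)[OF f, of x] hom_RTSD(7,8)[OF g, of w]
        by (cases; auto simp: ha_def Z1_def A2_def A_def \<pi>_def)+
    next
      fix a xs b assume a: "(a, xs, b) \<in> transitions Z1"
      show "(on_states f a, map ha xs, on_states f b) \<in> transitions Y"
      proof (cases "xs = [w] \<and> a = \<alpha> \<and> b = \<beta>")
        case True
        then show ?thesis
          using hom_RTSD(9)[OF g, of \<alpha> "[w]" \<beta>] eqs[of \<alpha>] eqs[of \<beta>]
          by (simp add: A2t ha_def) (simp add: A_def)
      next
        case False
        then have a: "(a, xs, b) \<in> transitions Z" using a by (auto simp: Z1_def)
        have "map ha xs = map (on_actions f) xs" using w_notin[OF a] by (auto simp: ha_def)
        then show ?thesis using hom_RTSD(9)[OF f a] by metis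
      qed
    qed (use hom_RTSD(6)[OF f] in \<open>simp add: Z1_def\<close>)
    then have h: "arr Z1 Y (on_states f) ha \<in> hom RTS Z1 Y" (is "?h \<in> _")
      by (rule arr_in_hom[OF Z1 hom_RTSD(4)[OF f]])
    show ?case
    proof (rule ex1I[of _ ?h], intro conjI)
      show "?h \<in> hom RTS (tgt j) Y" using h by (simp add: j_def)
      show "Comp RTS ?h j = f"
        by (rule hom_RTS_eqI[OF RTS_Comp_in_hom[OF j h] f]) (use w in \<open>auto simp: j_def Z1_def
          ha_def\<close>)
      show "Comp RTS ?h k' = g"
      proof (rule hom_RTS_eqI[OF RTS_Comp_in_hom[OF k' h] g])
        fix a assume a: "a \<in> states A2"
        then have "a \<in> states A" "a \<in> states Z1" using tu by (auto simp: A2_def A_def Z1_def)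
        then show "on_states (Comp RTS ?h k') a = on_states g a"
          using a eqs by (simp add: k'_def)
      next
        fix x assume x: "x \<in> actions A2"
        then have "x = u \<or> x = w" "x \<in> actions Z1" using uA by (auto simp: A2_def Z1_def)
        then show "on_actions (Comp RTS ?h k') x = on_actions g x"
          using x eqa uA by (auto simp: k'_def ha_def)
      qed
    next
      fix h' assume h': "h' \<in> hom RTS (tgt j) Y \<and> Comp RTS h' j = f \<and> Comp RTS h' k' = g"
      show "h' = ?h"
      proof (rule hom_RTS_eqI)
        show "h' \<in> hom RTS Z1 Y" "?h \<in> hom RTS Z1 Y" using h' h by (auto simp: j_def)
        have e: "Comp RTS h' j = f" "Comp RTS h' k' = g" using h' by auto
        show "on_states h' a = on_states ?h a" if "a \<in> states Z1" for a
          using that arg_cong[OF e(1), of "\<lambda>k. on_states k a"] by (simp add: j_def Z1_def)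
        show "on_actions h' x = on_actions ?h x" if "x \<in> actions Z1" for x
        proof (cases "x = w")
          case True
          then show ?thesis
            using that arg_cong[OF e(2), of "\<lambda>k. on_actions k w"]
              by (simp add: k'_def A2_def ha_def)
        next
          case False
          then show ?thesis
            using that arg_cong[OF e(1), of "\<lambda>k. on_actions k x"] by (simp add: j_def Z1_def ha_def)
        qed
      qed
    qed
  qed (use hom_RTSD(1,2)[OF i] hom_RTSD(1,2)[OF j] hom_RTSD(1,2)[OF k] k' hom_Ar[OF i] hom_Ar[OF j]
    hom_Ar[OF k] in auto)
  have pA: "trivfib (arr A2 A id \<pi>)" "arr A2 A id \<pi> \<in> hom RTS A2 A"
    unfolding A2_def by (rule trivfib_pull[OF A \<pi>A], rule pull_proj_in_hom[OF A equalityD1[OF \<pi>A(1)]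
      \<pi>A(2)])
  have "Comp RTS (arr A2 A id \<pi>) i = Id RTS A"
    by (rule hom_RTS_eqI[OF RTS_Comp_in_hom[OF i pA(2)] RTS_Id_in_hom[OF A]])
      (use uA in \<open>auto simp: i_def A2_def A_def \<pi>_def\<close>)
  then have "i \<in> weq RTS_model" by (rule weq_sections[OF pA i])
  moreover have "action_inj i" by (simp add: i_def action_inj_def inj_on_def)
  ultimately have jw: "j \<in> weq RTS_model" using weq_pushout[OF po] hom_Ar[OF i] by simp
  have pZ: "trivfib (arr Z2 Z id \<pi>)" "arr Z2 Z id \<pi> \<in> hom RTS Z2 Z"
    unfolding Z2_def by (rule trivfib_pull[OF Z \<pi>Z], rule pull_proj_in_hom[OF Z equalityD1[OF \<pi>Z(1)]
      \<pi>Z(2)])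
  note lj = RTS_Comp_in_hom[OF j l]
  have "Comp RTS (arr Z2 Z id \<pi>) (Comp RTS l j) = Id RTS Z"
    by (rule hom_RTS_eqI[OF RTS_Comp_in_hom[OF lj pZ(2)] RTS_Id_in_hom[OF Z]])
      (use w in \<open>auto simp: l_def j_def Z1_def Z2_def \<pi>_def\<close>)
  then have "Comp RTS l j \<in> weq RTS_model" by (rule weq_sections[OF pZ lj])
  then have lw: "l \<in> weq RTS_model" by (rule weq_cancel_right[OF j l jw])
  have linj: "action_inj l" by (simp add: l_def action_inj_def inj_on_def)
  \<comment> \<open>This gives a map out of \<open>Z1\<close> because \<open>w\<close> labels a
    single transition there, which becomes the given one by \<open>v\<close>.\<close>
  define q where "q x = (if x = w then v else x)" for x
  have q: "arr Z1 Z id q \<in> hom RTS Z1 Z" (is "?q \<in> _")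
  proof (rule arr_in_hom[OF Z1 Z], rule ts_mapI)
    fix a xs b assume a: "(a, xs, b) \<in> transitions Z1"
    show "(id a, map q xs, id b) \<in> transitions Z"
    proof (cases "xs = [w] \<and> a = \<alpha> \<and> b = \<beta>")
      case True
      then show ?thesis using v by (simp add: q_def)
    next
      case False
      then have a: "(a, xs, b) \<in> transitions Z" using a by (auto simp: Z1_def)
      have "map q xs = xs" using w_notin[OF a] by (intro map_idI) (auto simp: q_def)
      then show ?thesis using a by simp
    qed
  qed (use uA w lab in \<open>auto simp: Z1_def q_def \<pi>_def\<close>)
  obtain h where h: "h \<in> hom RTS Z2 Z" "Comp RTS h l = ?q"
    by (rule fibrant_extends[OF fibrant lw l linj q])
  have hs: "on_states h a = a" if "a \<in> states Z" for a
    using arg_cong[OF h(2), of "\<lambda>k. on_states k a"] that by (simp add: l_def Z1_def)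
  have ha: "on_actions h x = q x" if "x \<in> insert w (actions Z)" for x
    using arg_cong[OF h(2), of "\<lambda>k. on_actions k x"] that by (simp add: l_def Z1_def)
  have wn: "w \<notin> set us" "w \<notin> set ws" using w_notin[OF t] by auto
  \<comment> \<open>Putting the copy \<open>w\<close> at the chosen occurrence of \<open>u\<close>
    gives a transition of \<open>Z2\<close>, in which \<open>h\<close> turns \<open>w\<close> into
    \<open>v\<close>.\<close>
  have "map \<pi> (us @ w # ws) = us @ u # ws" using wn by (auto simp: \<pi>_def intro!: map_idI)
  then have "(\<gamma>, us @ w # ws, \<delta>) \<in> transitions Z2" using t tt(3) by (auto simp: Z2_def)
  from hom_RTSD(9)[OF h(1) this]
  have "(\<gamma>, map (on_actions h) (us @ w # ws), \<delta>) \<in> transitions Z" using hs tt by simp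
  moreover have "map (on_actions h) (us @ w # ws) = us @ v # ws"
  proof -
    have "map (on_actions h) us = us" "map (on_actions h) ws = ws"
      using tt(3) wn ha by (auto simp: q_def intro!: map_idI)
    then show ?thesis using ha[of w] by (simp add: q_def)
  qed
  ultimately show ?thesis by simp
qed

text \<open>\<open>fibrant_replace\<close> exchanges one letter. Applied to a 1-transition it gives
  transitivity of the relation, applied letter by letter it gives invariance of all
  transitions.\<close>

lemma interchangeable_parallel:
  fixes Z :: "('u, 'u, 'l) ts"
  assumes Z: "fibrant RTS RTS_model Z"
  shows "interchangeable Z (parallel Z)"
proof -
  have ob: "Z \<in> RTS_ob" using Z unfolding fibrant_def by simp
  have rep: "(\<gamma>, us @ v # ws, \<delta>) \<in> transitions Z"
    if "(u, v) \<in> parallel Z" "(\<gamma>, us @ u # ws, \<delta>) \<in> transitions Z" for u v us ws \<gamma> \<delta>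
    using that fibrant_replace[OF Z] unfolding parallel_def by blast
  have "refl_on (actions Z) (parallel Z)"
  proof (rule refl_onI)
    fix u assume "u \<in> actions Z"
    then show "(u, u) \<in> parallel Z" using RTS_used[OF ob] unfolding parallel_def by blast
  qed
  moreover have "parallel Z \<subseteq> actions Z \<times> actions Z" unfolding parallel_def by auto
  moreover have "sym (parallel Z)" unfolding parallel_def sym_def by auto
  moreover have "trans (parallel Z)"
  proof (rule transI)
    fix u v w assume uv: "(u, v) \<in> parallel Z" and vw: "(v, w) \<in> parallel Z"
    then obtain \<alpha> \<beta> where "(\<alpha>, [u], \<beta>) \<in> transitions Z" "(\<alpha>, [v], \<beta>) \<in> transitions Z"
      unfolding parallel_def by blast
    then have "(\<alpha>, [u], \<beta>) \<in> transitions Z" "(\<alpha>, [w], \<beta>) \<in> transitions Z"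
      using rep[OF vw, of \<alpha> "[]" "[]" \<beta>] by auto
    then show "(u, w) \<in> parallel Z" using uv vw unfolding parallel_def by auto
  qed
  ultimately have "equiv (actions Z) (parallel Z)" by (intro equivI)
  \<comment> \<open>\<open>pre\<close> is the part of the word whose letters have already been
    exchanged.\<close>
  moreover have pre: "(\<alpha>, pre @ vs, \<beta>) \<in> transitions Z"
    if "list_all2 (\<lambda>u v. (u, v) \<in> parallel Z) us vs" "(\<alpha>, pre @ us, \<beta>) \<in> transitions Z"
      for us vs pre \<alpha> \<beta>
    using that
  proof (induction arbitrary: pre rule: list_all2_induct)
    case (Cons u us v vs)
    have "(\<alpha>, (pre @ [v]) @ us, \<beta>) \<in> transitions Z" using rep[OF Cons(1), of \<alpha> pre us \<beta>] Cons(4)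
      by simp
    from Cons(3)[OF this] show ?case by simp
  qed simp
  moreover have "(\<alpha>, vs, \<beta>) \<in> transitions Z"
    if "(\<alpha>, us, \<beta>) \<in> transitions Z" "list_all2 (\<lambda>u v. (u, v) \<in> parallel Z) us vs" for us vs \<alpha> \<beta>
    using pre[OF that(2), of \<alpha> "[]" \<beta>] that(1) by simp
  moreover have "\<forall>(u, v)\<in>parallel Z. label Z u = label Z v" unfolding parallel_def by blast
  ultimately show ?thesis unfolding interchangeable_def by blast
qed

end

subsection \<open>Function complexes\<close>

lemma coface_0: "coface 0 0 = vertex 1" "coface 0 1 = vertex 0"
  unfolding coface_def vertex_def by auto

lemma coface_Delta: "i \<le> Suc n \<Longrightarrow> coface n i \<in> Delta n (Suc n)"
  unfolding Delta_def coface_def mono_on_def by auto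

lemma zero_Delta: "(\<lambda>j\<in>{..n}. 0) \<in> Delta n 0"
  unfolding Delta_def mono_on_def by auto

lemma simplices_function_complex [simp]: "simplices (function_complex C A Z) n = hom C (cobj A n) Z"
  by (simp add: function_complex_def)

lemma face_function_complex [simp]:
  "face (function_complex C A Z) n i x = Comp C x (coact A n (Suc n) (coface n i))"
  by (simp add: function_complex_def face_def)

lemma degen_function_complex [simp]:
  "degen (function_complex C A Z) n v = Comp C v (coact A n 0 (\<lambda>j\<in>{..n}. 0))"
  by (simp add: function_complex_def degen_def)

lemma pi0_rel_function_complex:
  "(x, y) \<in> pi0_rel (function_complex C A Z) \<longleftrightarrow> x \<in> hom C (cobj A 0) Z \<and> y \<in> hom C (cobj A 0) Z \<and>
    (\<exists>w \<in> hom C (cobj A 1) Z. Comp C w (coact A 0 1 (vertex 0)) = x \<and> Comp C w (coact A 0 1 (vertex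
      1)) = y)"
  unfolding pi0_rel_def by (simp add: coface_0[simplified])

text \<open>The map on classes is in the form used by \<open>kan_weq\<close>: the image of a class,
  saturated under the target relation.\<close>

lemma bij_betw_quotients:
  assumes R: "equiv S R" and R': "equiv S' R'" and F: "F ` S \<subseteq> S'"
    and inj: "\<And>x y. x \<in> S \<Longrightarrow> y \<in> S \<Longrightarrow> (x, y) \<in> R \<longleftrightarrow> (F x, F y) \<in> R'"
    and surj: "\<And>z. z \<in> S' \<Longrightarrow> \<exists>x\<in>S. (F x, z) \<in> R'"
  shows "bij_betw (\<lambda>c. R' `` (F ` c)) (S // R) (S' // R')"
proof -
  have cls: "R' `` (F ` (R `` {x})) = R' `` {F x}" if x: "x \<in> S" for x
  proof
    have "x \<in> R `` {x}" using equiv_class_self[OF R x] .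
    then show "R' `` {F x} \<subseteq> R' `` (F ` (R `` {x}))" by blast
    show "R' `` (F ` (R `` {x})) \<subseteq> R' `` {F x}"
    proof
      fix z assume "z \<in> R' `` (F ` (R `` {x}))"
      then obtain y where y: "(x, y) \<in> R" and z: "(F y, z) \<in> R'" by blast
      have "y \<in> S" using y equiv_type[OF R] by blast
      then have "(F x, F y) \<in> R'" using inj x y by blast
      then show "z \<in> R' `` {F x}" using z R' by (meson Image_singleton_iff equivE transE)
    qed
  qed
  show ?thesis
    unfolding bij_betw_def
  proof
    show "inj_on (\<lambda>c. R' `` (F ` c)) (S // R)"
    proof (rule inj_onI)
      fix c d assume "c \<in> S // R" "d \<in> S // R" and eq: "R' `` (F ` c) = R' `` (F ` d)"
      then obtain x y where x: "x \<in> S" "c = R `` {x}" and y: "y \<in> S" "d = R `` {y}"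
        by (auto elim!: quotientE)
      have "R' `` {F x} = R' `` {F y}" using eq unfolding x(2) y(2) cls[OF x(1)] cls[OF y(1)] .
      then have "(F x, F y) \<in> R'" using eq_equiv_class_iff[OF R'] F x(1) y(1) by blast
      then show "c = d" unfolding x(2) y(2) using inj[OF x(1) y(1)] equiv_class_eq[OF R] by blast
    qed
    show "(\<lambda>c. R' `` (F ` c)) ` (S // R) = S' // R'"
    proof
      show "(\<lambda>c. R' `` (F ` c)) ` (S // R) \<subseteq> S' // R'"
        using cls F by (auto elim!: quotientE intro!: quotientI)
      show "S' // R' \<subseteq> (\<lambda>c. R' `` (F ` c)) ` (S // R)"
      proof
        fix d assume "d \<in> S' // R'"
        then obtain z where z: "z \<in> S'" "d = R' `` {z}" by (rule quotientE)
        obtain x where x: "x \<in> S" "(F x, z) \<in> R'" using surj[OF z(1)] by blast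
        then have "d = R' `` (F ` (R `` {x}))" using cls[OF x(1)] z(2) equiv_class_eq[OF R' x(2)]
          by simp
        then show "d \<in> (\<lambda>c. R' `` (F ` c)) ` (S // R)" using quotientI[OF x(1)] by blast
      qed
    qed
  qed
qed

context small_labels
begin

text \<open>A simplex of positive dimension is determined by its faces, so that a simplex with all
  faces degenerate at \<open>v\<close> is itself degenerate at \<open>v\<close>.\<close>

lemma pi_cycles_tens:
  fixes X Z :: "('u, 'u, 'l) ts"
  assumes X: "X \<in> RTS_ob" and v: "v \<in> hom RTS (tens X 0) Z"
  shows "pi_cycles (function_complex RTS (tens_cosimp X) Z) n v =
      {degen (function_complex RTS (tens_cosimp X) Z) (Suc n) v}" (is "pi_cycles ?K n v = _")
proof -
  let ?d = "\<lambda>n. degen ?K n v"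
  have d: "?d n \<in> hom RTS (tens X n) Z" for n
    using RTS_Comp_in_hom[OF coact_in_hom[OF X zero_Delta] v] by simp
  have fd: "face ?K n i (?d (Suc n)) = ?d n" if i: "i \<le> Suc n" for n i
  proof -
    note c = coact_in_hom[OF X coface_Delta[OF i]]
    have "Comp RTS (?d (Suc n)) (arr (tens X n) (tens X (Suc n)) id (tmap id (coface n i))) = ?d n"
      by (rule hom_RTS_eqI[OF RTS_Comp_in_hom[OF c d] d])
        (use Delta_le[OF coface_Delta[OF i]] in auto)
    then show ?thesis by simp
  qed
  show ?thesis
  proof
    show "{?d (Suc n)} \<subseteq> pi_cycles ?K n v"
      unfolding pi_cycles_def using d[of "Suc n"] fd by simp
    show "pi_cycles ?K n v \<subseteq> {?d (Suc n)}"
    proof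
      fix x assume "x \<in> pi_cycles ?K n v"
      then have x: "x \<in> hom RTS (tens X (Suc n)) Z" and f: "\<And>i. i \<le> Suc n \<Longrightarrow> face ?K n i x = ?d n"
        unfolding pi_cycles_def by auto
      have "x = ?d (Suc n)"
      proof (rule hom_RTS_eqI[OF x d])
        fix \<alpha> assume "\<alpha> \<in> states (tens X (Suc n))"
        then show "on_states x \<alpha> = on_states (?d (Suc n)) \<alpha>"
          using arg_cong[OF f[of 0], of "\<lambda>k. on_states k \<alpha>"] by simp
      next
        fix w assume "w \<in> actions (tens X (Suc n))"
        then obtain u j where w: "w = tag (u, j)" "u \<in> actions X" "j \<le> Suc n" by auto
        \<comment> \<open>A face that keeps the vertex \<open>j\<close>: face number i omits just
          the vertex i, and \<open>k\<close> is the number of \<open>j\<close> within it.\<close>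
        define i where "i = (if j = 0 then 1 else 0 :: nat)"
        define k where "k = (if j = 0 then 0 else j - 1)"
        have ik: "i \<le> Suc n" "k \<le> n" "coface n i k = j"
          using w(3) by (auto simp: i_def k_def coface_def)
        show "on_actions x w = on_actions (?d (Suc n)) w"
          using arg_cong[OF f[OF ik(1)], of "\<lambda>h. on_actions h (tag (u, k))"] ik w by simp
      qed
      then show "x \<in> {?d (Suc n)}" by simp
    qed
  qed
qed

text \<open>There is only one cycle by \<open>pi_cycles_tens\<close>, and the degenerate simplex one
  dimension higher makes it homotopic to itself. So the homotopy sets of positive degree are
  points.\<close>

lemma pi_succ_tens:
  fixes X Z :: "('u, 'u, 'l) ts"
  assumes X: "X \<in> RTS_ob" and v: "v \<in> hom RTS (tens X 0) Z"
  defines "K \<equiv> function_complex RTS (tens_cosimp X) Z"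
  shows "pi_rel K n v = {(degen K (Suc n) v, degen K (Suc n) v)}"
    "pi_succ K n v = {{degen K (Suc n) v}}"
proof -
  have "degen K (Suc (Suc n)) v \<in> pi_cycles K (Suc n) v"
    unfolding K_def using pi_cycles_tens[OF X v] by blast
  then have "\<exists>w\<in>simplices K (Suc (Suc n)). \<forall>i\<le>Suc (Suc n). face K (Suc n) i w = degen K (Suc n) v"
    unfolding pi_cycles_def by blast
  then obtain w where w: "w \<in> simplices K (Suc (Suc n))"
    "\<And>i. i \<le> Suc (Suc n) \<Longrightarrow> face K (Suc n) i w = degen K (Suc n) v"
    by blast
  show "pi_rel K n v = {(degen K (Suc n) v, degen K (Suc n) v)}"
  proof
    show "pi_rel K n v \<subseteq> {(degen K (Suc n) v, degen K (Suc n) v)}"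
      unfolding pi_rel_def pi_cycles_tens[OF X v, folded K_def] by blast
    have "(degen K (Suc n) v, degen K (Suc n) v) \<in> pi_rel K n v"
      unfolding pi_rel_def pi_cycles_tens[OF X v, folded K_def] mem_Collect_eq prod.case
      by (intro conjI bexI[OF _ w(1)] allI impI w(2)) simp_all
    then show "{(degen K (Suc n) v, degen K (Suc n) v)} \<subseteq> pi_rel K n v" by simp
  qed
  then show "pi_succ K n v = {{degen K (Suc n) v}}"
    unfolding pi_succ_def pi_cycles_tens[OF X v, folded K_def] quotient_def by auto
qed

text \<open>Two maps that agree on states send each action to actions with equal labels, which are
  interchangeable in \<open>Z\<close>. Hence the map that follows \<open>x\<close> on copy 0 and
  \<open>y\<close> on copy 1 of each action preserves transitions, and it is an edge from
  \<open>x\<close> to \<open>y\<close>.\<close>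

lemma pi0_rel_tens:
  fixes X Z :: "('u, 'u, 'l) ts"
  assumes X: "X \<in> RTS_ob" and Z: "interchangeable Z (label_eq Z)"
  shows "(x, y) \<in> pi0_rel (function_complex RTS (tens_cosimp X) Z) \<longleftrightarrow>
    x \<in> hom RTS (tens X 0) Z \<and> y \<in> hom RTS (tens X 0) Z \<and> (\<forall>\<alpha>\<in>states X. on_states x \<alpha> = on_states y
      \<alpha>)"
    (is "?L \<longleftrightarrow> ?R")
proof
  assume ?L
  then obtain w where xy: "x \<in> hom RTS (tens X 0) Z" "y \<in> hom RTS (tens X 0) Z" and
    w: "w \<in> hom RTS (tens X 1) Z" "Comp RTS w (arr (tens X 0) (tens X 1) id (tmap id (vertex 0))) =
      x"
    "Comp RTS w (arr (tens X 0) (tens X 1) id (tmap id (vertex 1))) = y"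
    unfolding pi0_rel_function_complex by auto
  have "on_states x \<alpha> = on_states y \<alpha>" if "\<alpha> \<in> states X" for \<alpha>
    unfolding w(2,3)[symmetric] using that by simp
  then show ?R using xy by blast
next
  assume R: ?R
  then have x: "x \<in> hom RTS (tens X 0) Z" and y: "y \<in> hom RTS (tens X 0) Z"
    and st: "\<forall>\<alpha>\<in>states X. on_states x \<alpha> = on_states y \<alpha>" by auto
  define h where "h w = on_actions (if snd (untag w) = 0 then x else y) (tag (fst (untag w), 0))"
    for w
  have h: "h (tag (u, i)) \<in> actions Z" "label Z (h (tag (u, i))) = label X u" if "u \<in> actions X"
    for u i
    using hom_RTSD(7,8)[OF x, of "tag (u, 0)"] hom_RTSD(7,8)[OF y, of "tag (u, 0)"] that
    by (auto simp: h_def)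
  have "ts_map (tens X 1) Z (on_states x) h"
  proof (rule ts_mapI)
    fix \<alpha> us \<beta> assume t: "(\<alpha>, us, \<beta>) \<in> transitions (tens X 1)"
    let ?us = "map (\<lambda>w. tag (fst (untag w), 0)) us"
    have us: "w \<in> tag ` (actions X \<times> {..1})" if "w \<in> set us" for w using t that by auto
    have "map (fst \<circ> untag) ?us = map (fst \<circ> untag) us" by simp
    moreover have "set ?us \<subseteq> tag ` (actions X \<times> {..0})" using us by fastforce
    ultimately have "(\<alpha>, ?us, \<beta>) \<in> transitions (tens X 0)" using t by (simp del: map_map)
    from hom_RTSD(9)[OF x this]
    show "(on_states x \<alpha>, map h us, on_states x \<beta>) \<in> transitions Z"
    proof (rule interchangeableD(3)[OF Z])
      have "(on_actions x (tag (fst (untag w), 0)), h w) \<in> label_eq Z" if w: "w \<in> set us" for w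
      proof -
        obtain u i where ui: "w = tag (u, i)" "u \<in> actions X" using us[OF w] by auto
        then show ?thesis
          using h[OF ui(2)] hom_RTSD(7,8)[OF x, of "tag (u, 0)"] by (simp add: label_eq_def)
      qed
      then show "list_all2 (\<lambda>u v. (u, v) \<in> label_eq Z) (map (on_actions x) ?us) (map h us)"
        by (simp add: list_all2_map1 list_all2_map2 list_all2_same)
    qed
  qed (use h hom_RTSD(6)[OF x] in auto)
  then have w: "arr (tens X 1) Z (on_states x) h \<in> hom RTS (tens X 1) Z" (is "?w \<in> _")
    by (rule arr_in_hom[OF tens_ob[OF X] hom_RTSD(4)[OF x]])
  have v: "vertex i \<in> Delta 0 1" if "i \<le> 1" for i by (rule vertex_Delta[OF that])
  note c0 = coact_in_hom[OF X v[of 0]] and c1 = coact_in_hom[OF X v[of 1]]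
  have "Comp RTS ?w (arr (tens X 0) (tens X 1) id (tmap id (vertex 0))) = x"
    by (rule hom_RTS_eqI[OF RTS_Comp_in_hom[OF c0 w] x]) (auto simp: vertex_def h_def)
  moreover have "Comp RTS ?w (arr (tens X 0) (tens X 1) id (tmap id (vertex 1))) = y"
    by (rule hom_RTS_eqI[OF RTS_Comp_in_hom[OF c1 w] y]) (use st in \<open>auto simp: vertex_def h_def\<close>)
  ultimately show ?L unfolding pi0_rel_function_complex using x y w by auto
qed

lemma equiv_pi0_rel_tens:
  fixes X Z :: "('u, 'u, 'l) ts"
  assumes "X \<in> RTS_ob" "interchangeable Z (label_eq Z)"
  shows "equiv (hom RTS (tens X 0) Z) (pi0_rel (function_complex RTS (tens_cosimp X) Z))"
proof (rule equivI)
  show "pi0_rel (function_complex RTS (tens_cosimp X) Z) \<subseteq> hom RTS (tens X 0) Z \<times> hom RTS (tens X 0)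
    Z"
    "refl_on (hom RTS (tens X 0) Z) (pi0_rel (function_complex RTS (tens_cosimp X) Z))"
    "sym (pi0_rel (function_complex RTS (tens_cosimp X) Z))"
    "trans (pi0_rel (function_complex RTS (tens_cosimp X) Z))"
    by (auto simp: pi0_rel_tens[OF assms] intro!: refl_onI symI transI)
qed

text \<open>Let \<rho> be the quotient of \<open>Z\<close> that identifies actions with equal
  labels, and \<iota> its section. By \<open>pi0_rel_tens\<close>, composition with \<rho> embeds
  pi_0 of a function complex into the maps to \<open>Q\<close>, and \<iota> makes this onto; on
  those maps \<open>f\<close> acts bijectively by orthogonality. Higher homotopy is trivial on both
  sides.\<close>

lemma induces_weq_if_interchangeable:
  fixes f :: "('u, 'l) ts_arrow"
  assumes f: "f \<in> hom RTS X Y" and Z: "Z \<in> RTS_ob" and E: "interchangeable Z (label_eq Z)"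
    and orth: "\<And>Q :: ('u, 'u, 'l) ts. Q \<in> label_inj \<Longrightarrow> orth RTS f Q"
  shows "induces_weq RTS RTS_model f Z"
proof -
  note fD = hom_RTSD[OF f]
  note X = fD(3) and Y = fD(4)
  let ?K = "function_complex RTS (tens_cosimp Y) Z"
  let ?L = "function_complex RTS (tens_cosimp X) Z"
  let ?F = "\<lambda>n g. Comp RTS g (tens_map f n)"
  note q = tens_map_in_hom[OF f]
  obtain Q \<rho> \<iota> where Q: "\<rho> \<in> hom RTS Z Q" "trivfib \<rho>" "\<iota> \<in> hom RTS Q Z" "Comp RTS \<rho> \<iota> = Id RTS Q"
    "\<And>\<alpha>. \<alpha> \<in> states Z \<Longrightarrow> on_states \<rho> \<alpha> = \<alpha>" "\<And>\<alpha>. \<alpha> \<in> states Q \<Longrightarrow> on_states \<iota> \<alpha> = \<alpha>"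
    "\<And>u v. u \<in> actions Z \<Longrightarrow> v \<in> actions Z \<Longrightarrow> on_actions \<rho> u = on_actions \<rho> v \<longleftrightarrow> (u, v) \<in> label_eq Z"
    by (rule ex_quotient[OF Z E]) blast
  have Ql: "Q \<in> label_inj" by (rule quotient_label_eq[OF Q(1,2,7)])
  \<comment> \<open>\<open>f\<close> and stage 0 of its resolution are related by the projections,
    which are trivial fibrations and hence orthogonal to \<open>Q\<close>.\<close>
  have oq: "orth RTS (tens_map f 0) Q"
  proof (rule RTS.orth_cancel_left[OF q tens_proj_in_hom[OF Y]])
    show "orth RTS (tens_proj Y 0) Q" by (rule orth_trivfib_CSA1[OF trivfib_tens_proj[OF Y]
      label_injD(2)[OF Ql]])
    show "orth RTS (Comp RTS (tens_proj Y 0) (tens_map f 0)) Q"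
      unfolding tens_map_cosimplicial(2)[OF f]
      by (rule RTS.orth_Comp[OF tens_proj_in_hom[OF X] f
            orth_trivfib_CSA1[OF trivfib_tens_proj[OF X] label_injD(2)[OF Ql]] orth[OF Ql]])
  qed
  have same: "Comp RTS \<rho> x = Comp RTS \<rho> y \<longleftrightarrow> (\<forall>\<alpha>\<in>states A. on_states x \<alpha> = on_states y \<alpha>)"
    if x: "x \<in> hom RTS A Z" and y: "y \<in> hom RTS A Z" for A x y
  proof
    assume eq: "Comp RTS \<rho> x = Comp RTS \<rho> y"
    show "\<forall>\<alpha>\<in>states A. on_states x \<alpha> = on_states y \<alpha>"
    proof
      fix \<alpha> assume "\<alpha> \<in> states A"
      then show "on_states x \<alpha> = on_states y \<alpha>"
        using arg_cong[OF eq, of "\<lambda>k. on_states k \<alpha>"] hom_RTSD(1,6)[OF x] hom_RTSD(1,6)[OF y] Q(5)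
          by simp
    qed
  next
    assume st: "\<forall>\<alpha>\<in>states A. on_states x \<alpha> = on_states y \<alpha>"
    show "Comp RTS \<rho> x = Comp RTS \<rho> y"
    proof (rule hom_RTS_eqI[OF RTS_Comp_in_hom[OF x Q(1)] RTS_Comp_in_hom[OF y Q(1)]])
      fix u assume u: "u \<in> actions A"
      have "(on_actions x u, on_actions y u) \<in> label_eq Z"
        using hom_RTSD(7,8)[OF x u] hom_RTSD(7,8)[OF y u] by (simp add: label_eq_def)
      then show "on_actions (Comp RTS \<rho> x) u = on_actions (Comp RTS \<rho> y) u"
        using Q(7) u hom_RTSD(1,7)[OF x] hom_RTSD(1,7)[OF y] by simp
    qed (use st hom_RTSD(1)[OF x] hom_RTSD(1)[OF y] in simp)
  qed
  have pi0: "bij_betw (\<lambda>c. pi0_rel ?L `` (?F 0 ` c)) (pi0 ?K) (pi0 ?L)"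
    unfolding pi0_def simplices_function_complex tens_cosimp_simps
  proof (rule bij_betw_quotients[OF equiv_pi0_rel_tens[OF Y E] equiv_pi0_rel_tens[OF X E]])
    show "?F 0 ` hom RTS (tens Y 0) Z \<subseteq> hom RTS (tens X 0) Z" using RTS_Comp_in_hom[OF q] by auto
    fix x y assume x: "x \<in> hom RTS (tens Y 0) Z" and y: "y \<in> hom RTS (tens Y 0) Z"
    have "Comp RTS \<rho> (?F 0 x) = Comp RTS (Comp RTS \<rho> x) (tens_map f 0)"
      "Comp RTS \<rho> (?F 0 y) = Comp RTS (Comp RTS \<rho> y) (tens_map f 0)"
      by (simp_all only: RTS.Comp_assoc[OF q x Q(1)] RTS.Comp_assoc[OF q y Q(1)])
    then have "Comp RTS \<rho> x = Comp RTS \<rho> y \<longleftrightarrow> Comp RTS \<rho> (?F 0 x) = Comp RTS \<rho> (?F 0 y)"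
      using RTS.orth_unique[OF oq q RTS_Comp_in_hom[OF x Q(1)] RTS_Comp_in_hom[OF y Q(1)]] by metis
    then show "(x, y) \<in> pi0_rel ?K \<longleftrightarrow> (?F 0 x, ?F 0 y) \<in> pi0_rel ?L"
      unfolding pi0_rel_tens[OF Y E] pi0_rel_tens[OF X E]
      using same[OF x y] same[OF RTS_Comp_in_hom[OF q x] RTS_Comp_in_hom[OF q y]] x y
        RTS_Comp_in_hom[OF q x] RTS_Comp_in_hom[OF q y] by simp
  next
    fix z assume z: "z \<in> hom RTS (tens X 0) Z"
    obtain m where m: "m \<in> hom RTS (tens Y 0) Q" "Comp RTS m (tens_map f 0) = Comp RTS \<rho> z"
      using RTS.orth_ex[OF oq q RTS_Comp_in_hom[OF z Q(1)]] .
    \<comment> \<open>The section \<iota> turns a map into \<open>Q\<close> back into a map into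
      \<open>Z\<close>.\<close>
    define x where "x = Comp RTS \<iota> m"
    have x: "x \<in> hom RTS (tens Y 0) Z" unfolding x_def by (rule RTS_Comp_in_hom[OF m(1) Q(3)])
    have "Comp RTS \<rho> x = m"
      unfolding x_def RTS.Comp_assoc[OF m(1) Q(3,1), symmetric] Q(4)
        by (rule RTS.Comp_Id_left[OF m(1)])
    then have "Comp RTS \<rho> (?F 0 x) = Comp RTS \<rho> z"
      using RTS.Comp_assoc[OF q x Q(1)] m(2) by simp
    then have "(?F 0 x, z) \<in> pi0_rel ?L"
      unfolding pi0_rel_tens[OF X E] using same[OF RTS_Comp_in_hom[OF q x] z] z RTS_Comp_in_hom[OF q
        x] by simp
    then show "\<exists>x\<in>hom RTS (tens Y 0) Z. (?F 0 x, z) \<in> pi0_rel ?L" using x by blast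
  qed
  have "bij_betw (\<lambda>c. pi_rel ?L n (?F 0 v) `` (?F (Suc n) ` c)) (pi_succ ?K n v) (pi_succ ?L n (?F 0
    v))"
    if "v \<in> simplices ?K 0" for v n
  proof -
    have v: "v \<in> hom RTS (tens Y 0) Z" using that by simp
    note w = RTS_Comp_in_hom[OF q v]
    have "?F (Suc n) (degen ?K (Suc n) v) = degen ?L (Suc n) (?F 0 v)"
      unfolding degen_function_complex tens_cosimp_simps
      by (rule hom_RTS_eqI[OF RTS_Comp_in_hom[OF q RTS_Comp_in_hom[OF coact_in_hom[OF Y zero_Delta]
        v]]
            RTS_Comp_in_hom[OF coact_in_hom[OF X zero_Delta] w]])
        (use fD in \<open>auto simp: tens_map_def\<close>)
    then show ?thesis
      unfolding pi_succ_tens[OF Y v] pi_succ_tens[OF X w] by (auto simp: bij_betw_def)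
  qed
  then have "kan_weq ?K ?L ?F" unfolding kan_weq_def using pi0 by blast
  then show ?thesis
    unfolding induces_weq_def RTS_simps fD(1,2)
    using tens_resolution[OF X] tens_resolution[OF Y] tens_map_cosimplicial[OF f] by blast
qed

subsection \<open>Maps inducing weak equivalences of function complexes\<close>

text \<open>The main access to an arbitrary resolution: its augmentations are weak equivalences,
  hence orthogonal to systems satisfying CSA1.\<close>

lemma resolution_orth:
  fixes A :: "(('u, 'u, 'l) ts, ('u, 'l) ts_arrow) cosimp"
  assumes "cosimplicial_resolution RTS RTS_model X A a" and Q: "Q \<in> RTS_ob" "CSA1 Q"
  shows "a n \<in> hom RTS (cobj A n) X" "orth RTS (a n) Q"
  using assms weq_RTS_orth(2)[OF _ Q] unfolding cosimplicial_resolution_def by auto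

text \<open>The degenerate edge at \<open>x\<close> joins it to itself; thus every point lies in its
  own class, for any target \<open>Z\<close>.\<close>

lemma resolution_pi0_rel_refl:
  fixes A :: "(('u, 'u, 'l) ts, ('u, 'l) ts_arrow) cosimp"
  assumes A: "cosimplicial_resolution RTS RTS_model X A a" and x: "x \<in> hom RTS (cobj A 0) Z"
  shows "(x, x) \<in> pi0_rel (function_complex RTS A Z)"
proof -
  have cs: "is_cosimplicial RTS A" using A unfolding cosimplicial_resolution_def reedy_cofibrant_def
    by blast
  then have co: "coact A m n \<theta> \<in> hom RTS (cobj A m) (cobj A n)" if "\<theta> \<in> Delta m n" for m n \<theta>
    using that unfolding is_cosimplicial_def by blast
  let ?s = "\<lambda>j\<in>{..1 :: nat}. 0 :: nat"
  note s = zero_Delta[of 1]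
  have e: "Comp RTS (Comp RTS x (coact A 1 0 ?s)) (coact A 0 1 (vertex i)) = x" if i: "i \<le> 1" for i
  proof -
    note v = vertex_Delta[OF i]
    have "compose {..0} ?s (vertex i) = (\<lambda>j\<in>{..0}. j)"
      using i by (auto simp: compose_def vertex_def restrict_def)
    then have "Comp RTS (coact A 1 0 ?s) (coact A 0 1 (vertex i)) = Id RTS (cobj A 0)"
      using cs v s unfolding is_cosimplicial_def by metis
    then show ?thesis
      using RTS.Comp_assoc[OF co[OF v] co[OF s] x] RTS.Comp_Id_right[OF x] by simp
  qed
  show ?thesis
    unfolding pi0_rel_function_complex using x e[of 0] e[of 1] RTS_Comp_in_hom[OF co[OF s] x]
      by auto
qed

text \<open>An edge \<open>w\<close> followed by \<rho> factors through the augmentation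
  \<open>a 1\<close> by some \<open>m\<close>; after \<rho>, both ends of the edge then equal
  \<open>m\<close> composed with \<open>a 0\<close>.\<close>

lemma resolution_pi0_rel_eq:
  fixes A :: "(('u, 'u, 'l) ts, ('u, 'l) ts_arrow) cosimp"
  assumes A: "cosimplicial_resolution RTS RTS_model X A a" and Q: "CSA1 Q" and \<rho>: "\<rho> \<in> hom RTS Z Q"
    and xy: "(x, y) \<in> pi0_rel (function_complex RTS A Z)"
  shows "Comp RTS \<rho> x = Comp RTS \<rho> y"
proof -
  note o = resolution_orth[OF A hom_RTSD(4)[OF \<rho>] Q]
  have co: "coact A 0 1 (vertex i) \<in> hom RTS (cobj A 0) (cobj A 1)"
    and a: "Comp RTS (a 1) (coact A 0 1 (vertex i)) = a 0" if "i \<le> 1" for i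
    using A vertex_Delta[OF that]
    unfolding cosimplicial_resolution_def reedy_cofibrant_def is_cosimplicial_def by blast+
  obtain w where w: "w \<in> hom RTS (cobj A 1) Z" "Comp RTS w (coact A 0 1 (vertex 0)) = x"
    "Comp RTS w (coact A 0 1 (vertex 1)) = y"
    using xy unfolding pi0_rel_function_complex by blast
  obtain m where m: "m \<in> hom RTS X Q" "Comp RTS m (a 1) = Comp RTS \<rho> w"
    using RTS.orth_ex[OF o(2) o(1) RTS_Comp_in_hom[OF w(1) \<rho>]] .
  have e: "Comp RTS \<rho> (Comp RTS w (coact A 0 1 (vertex i))) = Comp RTS m (a 0)" if i: "i \<le> 1" for i
    using RTS.Comp_assoc[OF co[OF i] w(1) \<rho>] RTS.Comp_assoc[OF co[OF i] o(1) m(1)] m(2) a[OF i]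
      by simp
  show ?thesis using e[of 0] e[of 1] unfolding w by simp
qed

text \<open>Rests on surjectivity on pi_0. The composite of \<open>g\<close> with \<open>a 0\<close>
  is joined by an edge to the restriction of some \<open>h\<close>. After \<rho> this becomes an
  equality; then \<rho> after \<open>h\<close> factors through the augmentation of \<open>Y\<close>,
  and \<open>a 0\<close> is cancelled by orthogonality.\<close>

lemma induces_weq_extends:
  fixes f :: "('u, 'l) ts_arrow"
  assumes w: "induces_weq RTS RTS_model f Z" and f: "f \<in> hom RTS X Y"
    and Q: "CSA1 Q" and \<rho>: "\<rho> \<in> hom RTS Z Q" and g: "g \<in> hom RTS X Z"
  obtains m where "m \<in> hom RTS Y Q" "Comp RTS m f = Comp RTS \<rho> g"
proof -
  obtain A a B b q where A: "cosimplicial_resolution RTS RTS_model X A a"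
    and B: "cosimplicial_resolution RTS RTS_model Y B b" and q: "cosimplicial_map RTS A B q"
    and bq: "\<forall>n. Comp RTS (b n) (q n) = Comp RTS f (a n)"
    and kan: "kan_weq (function_complex RTS B Z) (function_complex RTS A Z) (\<lambda>n g. Comp RTS g (q
      n))"
    using w unfolding induces_weq_def RTS_simps hom_RTSD(1,2)[OF f] by blast
  note Qob = hom_RTSD(4)[OF \<rho>]
  note oA = resolution_orth[OF A Qob Q] and oB = resolution_orth[OF B Qob Q]
  have q0: "q 0 \<in> hom RTS (cobj A 0) (cobj B 0)" using q unfolding cosimplicial_map_def by blast
  let ?K = "function_complex RTS B Z" and ?L = "function_complex RTS A Z"
  note ga = RTS_Comp_in_hom[OF oA(1) g]
  have "pi0_rel ?L `` {Comp RTS g (a 0)} \<in> pi0 ?L"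
    unfolding pi0_def by (rule quotientI) (simp add: ga)
  then obtain c where c: "c \<in> pi0 ?K" "pi0_rel ?L `` ((\<lambda>x. Comp RTS x (q 0)) ` c) = pi0_rel ?L ``
    {Comp RTS g (a 0)}"
    using kan unfolding kan_weq_def bij_betw_def by (metis (no_types, lifting) imageE)
  \<comment> \<open>The class attached to this point contains the point itself, so some member of
    \<open>c\<close> restricts to a point related to it.\<close>
  have "Comp RTS g (a 0) \<in> pi0_rel ?L `` {Comp RTS g (a 0)}"
    using resolution_pi0_rel_refl[OF A ga] by blast
  then obtain h where h: "h \<in> c" "(Comp RTS h (q 0), Comp RTS g (a 0)) \<in> pi0_rel ?L"
    unfolding c(2)[symmetric] by blast
  have hK: "h \<in> hom RTS (cobj B 0) Z"
    using c(1) h(1) unfolding pi0_def by (auto elim!: quotientE simp: pi0_rel_function_complex)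
  have eq: "Comp RTS \<rho> (Comp RTS h (q 0)) = Comp RTS \<rho> (Comp RTS g (a 0))"
    by (rule resolution_pi0_rel_eq[OF A Q \<rho> h(2)])
  obtain m where m: "m \<in> hom RTS Y Q" "Comp RTS m (b 0) = Comp RTS \<rho> h"
    using RTS.orth_ex[OF oB(2,1) RTS_Comp_in_hom[OF hK \<rho>]] .
  have "Comp RTS (Comp RTS m f) (a 0) = Comp RTS (Comp RTS \<rho> g) (a 0)"
  proof -
    have "Comp RTS (Comp RTS m f) (a 0) = Comp RTS m (Comp RTS (b 0) (q 0))"
      using RTS.Comp_assoc[OF oA(1) f m(1)] bq by simp
    also have "\<dots> = Comp RTS (Comp RTS \<rho> h) (q 0)"
      using RTS.Comp_assoc[OF q0 oB(1) m(1)] m(2) by simp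
    also have "\<dots> = Comp RTS \<rho> (Comp RTS g (a 0))"
      using RTS.Comp_assoc[OF q0 hK \<rho>] eq by simp
    also have "\<dots> = Comp RTS (Comp RTS \<rho> g) (a 0)"
      using RTS.Comp_assoc[OF oA(1) g \<rho>] by simp
    finally show ?thesis .
  qed
  then have "Comp RTS m f = Comp RTS \<rho> g"
    by (rule RTS.orth_unique[OF oA(2,1) RTS_Comp_in_hom[OF f m(1)] RTS_Comp_in_hom[OF g \<rho>]])
  then show ?thesis using that m(1) by blast
qed

text \<open>For \<open>Z\<close> satisfying CSA1, the function complexes into \<open>Z\<close> are discrete.\<close>

lemma orth_if_induces_weq:
  fixes f :: "('u, 'l) ts_arrow"
  assumes w: "induces_weq RTS RTS_model f Z" and f: "f \<in> hom RTS X Y" and Z: "Z \<in> RTS_ob" "CSA1 Z"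
  shows "orth RTS f Z"
proof (rule RTS.orthI[OF f])
  fix g assume g: "g \<in> hom RTS X Z"
  show "\<exists>h. h \<in> hom RTS Y Z \<and> Comp RTS h f = g"
    using induces_weq_extends[OF w f Z(2) RTS_Id_in_hom[OF Z(1)] g] RTS.Comp_Id_left[OF g] by metis
next
  fix m m' assume m: "m \<in> hom RTS Y Z" and m': "m' \<in> hom RTS Y Z" and eq: "Comp RTS m f =
    Comp RTS m' f"
  obtain A a B b q where A: "cosimplicial_resolution RTS RTS_model X A a"
    and B: "cosimplicial_resolution RTS RTS_model Y B b" and q: "cosimplicial_map RTS A B q"
    and bq: "\<forall>n. Comp RTS (b n) (q n) = Comp RTS f (a n)"
    and kan: "kan_weq (function_complex RTS B Z) (function_complex RTS A Z) (\<lambda>n g. Comp RTS g (q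
      n))"
    using w unfolding induces_weq_def RTS_simps hom_RTSD(1,2)[OF f] by blast
  note oA = resolution_orth[OF A Z] and oB = resolution_orth[OF B Z]
  have q0: "q 0 \<in> hom RTS (cobj A 0) (cobj B 0)" using q unfolding cosimplicial_map_def by blast
  let ?K = "function_complex RTS B Z" and ?L = "function_complex RTS A Z"
  have cls: "pi0_rel ?K `` {x} = {x}" if x: "x \<in> hom RTS (cobj B 0) Z" for x
  proof -
    have "y = x" if xy: "(x, y) \<in> pi0_rel ?K" for y
    proof -
      have y: "y \<in> hom RTS (cobj B 0) Z" using xy unfolding pi0_rel_function_complex by blast
      show ?thesis
        using resolution_pi0_rel_eq[OF B Z(2) RTS_Id_in_hom[OF Z(1)] xy]
          RTS.Comp_Id_left[OF x] RTS.Comp_Id_left[OF y] by simp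
    qed
    then show ?thesis using resolution_pi0_rel_refl[OF B x] by blast
  qed
  note mb = RTS_Comp_in_hom[OF oB(1)[of 0] m] and mb' = RTS_Comp_in_hom[OF oB(1)[of 0] m']
  \<comment> \<open>The resolution \<open>q\<close> covers \<open>f\<close>, so maps that agree
    after \<open>f\<close> give points with the same image under precomposition with
    \<open>q 0\<close>.\<close>
  have e: "Comp RTS (Comp RTS k (b 0)) (q 0) = Comp RTS (Comp RTS k f) (a 0)"
    if k: "k \<in> hom RTS Y Z" for k
    using RTS.Comp_assoc[OF q0 oB(1) k] RTS.Comp_assoc[OF oA(1) f k] bq by simp
  have pi0: "{x} \<in> pi0 ?K" if x: "x \<in> hom RTS (cobj B 0) Z" for x
    using quotientI[of x "simplices ?K 0" "pi0_rel ?K"] cls[OF x] x unfolding pi0_def by simp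
  have "inj_on (\<lambda>c. pi0_rel ?L `` ((\<lambda>g. Comp RTS g (q 0)) ` c)) (pi0 ?K)"
    using kan unfolding kan_weq_def bij_betw_def by blast
  then have "{Comp RTS m (b 0)} = {Comp RTS m' (b 0)}"
    by (rule inj_onD) (use e[OF m] e[OF m'] eq pi0[OF mb] pi0[OF mb'] in simp_all)
  then show "m = m'" by (intro RTS.orth_unique[OF oB(2,1) m m']) simp
qed

subsection \<open>Characterisation of local objects and local equivalences\<close>

lemma interchangeable_if_label_inj:
  assumes Z: "Z \<in> label_inj"
  shows "interchangeable Z (label_eq Z)"
proof -
  have E: "label_eq Z = Id_on (actions Z)" using label_injD(3)[OF Z] unfolding label_eq_def by auto
  have "(\<alpha>, vs, \<beta>) \<in> transitions Z"
    if t: "(\<alpha>, us, \<beta>) \<in> transitions Z" and l: "list_all2 (\<lambda>u v. (u, v) \<in> label_eq Z) us vs"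
      for \<alpha> us \<beta> vs
  proof -
    have "us = vs" using l unfolding E by (induction rule: list_all2_induct) auto
    then show ?thesis using t by simp
  qed
  moreover have "equiv (actions Z) (label_eq Z)"
    unfolding E by (intro equivI refl_onI symI transI) auto
  ultimately show ?thesis unfolding interchangeable_def label_eq_def by blast
qed

text \<open>Orthogonality of weak equivalences to systems satisfying CSA1 gives lifts against the
  map to the terminal object, hence fibrancy. Locality follows because each p_x is orthogonal to all
  systems with injective labelling.\<close>

lemma local_object_if_label_inj:
  fixes Z :: "('u, 'u, 'l) ts"
  assumes Z: "Z \<in> label_inj"
  shows "local_object RTS RTS_model p_maps Z"
  unfolding local_object_def
proof (intro conjI ballI)
  note ob = label_injD(1)[OF Z]
  obtain t :: "('u, 'u, 'l) ts" where t: "is_terminal RTS t" using ex_terminal by blast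
  then obtain p where p: "p \<in> hom RTS Z t" using ob unfolding is_terminal_def by auto
  have "lifts RTS i p" if i: "i \<in> weq RTS_model" for i
    unfolding lifts_def RTS_simps hom_RTSD(1,2)[OF p]
  proof (intro ballI impI)
    have ih: "i \<in> hom RTS (src i) (tgt i)"
      using weq_RTS_orth(1)[OF i ob label_injD(2)[OF Z]] by (simp add: hom_def)
    fix u v assume u: "u \<in> hom RTS (src i) Z" and v: "v \<in> hom RTS (tgt i) t"
    obtain h where h: "h \<in> hom RTS (tgt i) Z" "Comp RTS h i = u"
      using RTS.orth_ex[OF weq_RTS_orth(2)[OF i ob label_injD(2)[OF Z]] ih u] .
    moreover have "Comp RTS p h = v"
      using t RTS_Comp_in_hom[OF h(1) p] v hom_RTSD(4)[OF ih] unfolding is_terminal_def RTS_simps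
        by blast
    ultimately show "\<exists>h\<in>hom RTS (tgt i) Z. Comp RTS h i = u \<and> Comp RTS p h = v" by blast
  qed
  then have "p \<in> fib RTS_model" unfolding RTS_model_simps rlp_def using hom_Ar[OF p] by blast
  then show "fibrant RTS RTS_model Z" unfolding fibrant_def using ob t p by auto
  fix s :: "('u, 'l) ts_arrow" assume s: "s \<in> p_maps"
  have "s \<in> hom RTS (src s) (tgt s)" using orth_p_maps(1)[OF s Z] by (simp add: hom_def)
  then show "induces_weq RTS RTS_model s Z"
    by (rule induces_weq_if_interchangeable[OF _ ob interchangeable_if_label_inj[OF Z]
      orth_p_maps(2)[OF s]])
qed

text \<open>Fibrancy provides the quotient \<open>Q\<close> by parallel actions, which satisfies
  CSA1. Two actions of \<open>Q\<close> with equal labels give a map out of the source of p_x;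
  locality of \<open>Z\<close> extends it along p_x in \<open>Q\<close>, so the two actions coincide
  there and come from parallel actions of \<open>Z\<close>.\<close>

lemma interchangeable_if_local_object:
  fixes Z :: "('u, 'u, 'l) ts"
  assumes Z: "local_object RTS RTS_model p_maps Z"
  shows "Z \<in> RTS_ob" "interchangeable Z (label_eq Z)"
proof -
  have fib: "fibrant RTS RTS_model Z" and ind: "\<And>s. s \<in> p_maps \<Longrightarrow> induces_weq RTS RTS_model s Z"
    using Z unfolding local_object_def by auto
  then show ob: "Z \<in> RTS_ob" unfolding fibrant_def by simp
  note E = interchangeable_parallel[OF fib]
  obtain Q \<rho> \<iota> where Q: "\<rho> \<in> hom RTS Z Q" "trivfib \<rho>" "\<iota> \<in> hom RTS Q Z" "Comp RTS \<rho> \<iota> = Id RTS Q"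
    "\<And>u v. u \<in> actions Z \<Longrightarrow> v \<in> actions Z \<Longrightarrow> on_actions \<rho> u = on_actions \<rho> v \<longleftrightarrow> (u, v) \<in> parallel Z"
    by (rule ex_quotient[OF ob E]) blast
  have csa: "CSA1 Q" by (rule quotient_parallel[OF Q(1,2,5)])
  have "(u, v) \<in> parallel Z" if uv: "u \<in> actions Z" "v \<in> actions Z" "label Z u = label Z v" for u v
  proof -
    note \<rho> = hom_RTSD[OF Q(1)]
    obtain s :: "('u, 'l) ts_arrow" and g where s: "s \<in> p_maps" "g \<in> hom RTS (src s) Q"
      "\<And>k. k \<in> hom RTS (tgt s) Q \<Longrightarrow> Comp RTS k s = g \<Longrightarrow> on_actions \<rho> u = on_actions \<rho> v"
      using p_map_test[OF \<rho>(4) \<rho>(7)[OF uv(1)] \<rho>(7)[OF uv(2)]] \<rho>(8) uv by metis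
    have sh: "s \<in> hom RTS (src s) (tgt s)" using s(1) unfolding p_maps_def copies_def
      by (auto simp: hom_def)
    \<comment> \<open>The extension problem is posed in \<open>Q\<close> but locality concerns
      \<open>Z\<close>, so \<open>g\<close> is moved into \<open>Z\<close> by the section \<iota>;
      applying \<rho> recovers \<open>g\<close>.\<close>
    obtain m where m: "m \<in> hom RTS (tgt s) Q" "Comp RTS m s = Comp RTS \<rho> (Comp RTS \<iota> g)"
      by (rule induces_weq_extends[OF ind[OF s(1)] sh csa Q(1) RTS_Comp_in_hom[OF s(2) Q(3)]])
    have "Comp RTS m s = g"
      unfolding m(2) RTS.Comp_assoc[OF s(2) Q(3,1), symmetric] Q(4)
        by (rule RTS.Comp_Id_left[OF s(2)])
    then show ?thesis using s(3) m(1) Q(5) uv by blast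
  qed
  then have "label_eq Z = parallel Z" unfolding label_eq_def parallel_def by blast
  then show "interchangeable Z (label_eq Z)" using E by simp
qed

text \<open>Systems with injective labelling are local and satisfy CSA1, which gives one direction.
  In an arbitrary local object the actions with equal labels are interchangeable, which gives the
  other.\<close>

lemma weq_L_Cub_RTS:
  fixes f :: "('u, 'l) ts_arrow"
  assumes f: "f \<in> hom RTS X Y"
  shows "f \<in> weq L_Cub_RTS \<longleftrightarrow> (\<forall>Z\<in>label_inj. orth RTS f Z)"
proof -
  have "f \<in> weq L_Cub_RTS \<longleftrightarrow> (\<forall>Z. local_object RTS RTS_model p_maps Z \<longrightarrow>
    induces_weq RTS RTS_model f Z)"
    unfolding L_Cub_RTS_def left_bousfield_def local_equivalence_def Let_def using hom_Ar[OF f]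
      by simp
  also have "\<dots> \<longleftrightarrow> (\<forall>Z\<in>label_inj. orth RTS f Z)"
    using local_object_if_label_inj orth_if_induces_weq[OF _ f] label_injD(1,2)
      interchangeable_if_local_object induces_weq_if_interchangeable[OF f] by blast
  finally show ?thesis .
qed

end

theorem theorem6p11:
  fixes X Y :: "('u, 'u, 'l) ts" and f :: "('u, 'l) ts_arrow"
  assumes "universe TYPE('u)"
    and "(UNIV :: 'l set) \<prec> (UNIV :: 'u set)"
    and "X \<in> Ob RTS" and "Y \<in> Ob RTS" and "f \<in> hom RTS X Y"
  shows "f \<in> weq L_Cub_RTS \<longleftrightarrow> is_iso RTS (L_S f)"
proof -
  interpret small_labels "TYPE('u)" "TYPE('l)" by standard (use assms in auto)
  show ?thesis unfolding weq_L_Cub_RTS[OF assms(5)] is_iso_L_S[OF assms(5)] ..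
qed

end
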